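(* A sequence $(d_i)_{i\ge1}$ over a finite alphabet $\mathcal{A}$ of nonnegative integers is the $(-\beta)$-expansion of $-\frac{\beta}{\beta+1}$ for some $\beta>1$ if and only if the following three conditions hold: (a) for all $n\ge1$, $(d_i)_{i\ge1}\preceq(d_i)_{i\ge n}\prec(d^*_{i-1})_{i\ge1}$, where $d^*_0=0$ (i.e. the right-hand side is the word $0d^*_1d^*_2\cdots$); (b) $(d_i)_{i\ge1}\notin\mathbf{Lyn}$; (c) $(d_i)_{i\ge1}\prec\phi^\infty(1)$.
   Context: Alternate order: for two words $x=x_1x_2\cdots$, $y=y_1y_2\cdots$ over a finite alphabet of integers, $x\prec y$ iff there is $k$ with $x_i=y_i$ for all $i<k$ and $(-1)^k(x_k-y_k)<0$; $x\preceq y$ iff $x=y$ or $x\prec y$. An alternate Lyndon word is an infinite word $(d_i)_{i\ge1}$ with $d_1d_2\cdots\preceq d_nd_{n+1}\cdots$ for all $n\ge1$. Its alternate Lyndon system is the set of infinite words $x$ with $d_1d_2\cdots\preceq x_kx_{k+1}\cdots$ for all $k\ge1$, with entropy $\lim_n\frac1n\log H_n$ ($H_n$ = number of words of length $n$ occurring as finite factors of elements of the system); a word is attached to $\beta$ if its system has entropy $\log\beta$. For a finite word $w$, $\overline{w}=www\cdots$. $\phi$ is the morphism on $\{0,1\}^*$ with $\phi(0)=1$, $\phi(1)=100$, and $\phi^\infty(1)=\lim_n\phi^n(1)$. $d^*$: if $(d_i)$ is an alternate Lyndon word attached to $\beta$, then $(d^*_i)_{i\ge1}=\overline{d_1\cdots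 d_{2p}(d_{2p+1}-1)0}$ if there is $p\ge0$ such that $\overline{d_1\cdots d_{2p+1}}$ is an alternate Lyndon word attached to $\beta$ (with $2p+1$ minimal), and $(d^*_i)_{i\ge1}=(d_i)_{i\ge1}$ otherwise. $\mathbf{Lyn}$: the set of alternate Lyndon words $(d_i)_{i\ge1}$ for which there is a periodic alternate Lyndon word $\overline{a_1\cdots a_k}$ ($k$ its minimal period, $a_k\neq0$) with $(d_i)\ne\overline{a_1\cdots a_k}$ and $\min_k\preceq(d_i)_{i\ge1}\preceq\max_k\prec\phi^\infty(1)$, where $\min_k=a_1\cdots a_{k-1}(a_k-1)0\,\overline{a_1\cdots a_k}$ and $\max_k=\overline{a_1\cdots a_k}$ if $k$ is even, and $\min_k=a_1\cdots a_k\,\overline{a_1\cdots a_{k-1}(a_k-1)0}$ and $\max_k=\overline{a_1\cdots a_{k-1}(a_k-1)0}$ if $k$ is odd. $(-\beta)$-expansion (Ito–Sadahiro): for $\beta>1$ let $l_\beta=-\frac{\beta}{\beta+1}$, $r_\beta=\frac{1}{\beta+1}$, and $T_{-\beta}:[l_\beta,r_\beta)\to[l_\beta,r_\beta)$, $T_{-\beta}(x)=-\beta x-\lfloor-\beta x-l_\beta\rfloor$. The $(-\beta)$-expansion of $x\in[l_\beta,r_\beta)$ is the sequence $(x_i)_{i\ge1}$ with $x_i=\lfloor-\beta T_{-\beta}^{i-1}(x)-l_\beta\rfloor$, so that $x=\sum_{i\ge1}x_i(-\beta)^{-i}$. *)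

theory Defs
  imports Complex_Main
begin

text \<open>Infinite words are functions nat => int; index 0 is the first letter (paper index 1).\<close>

definition shiftw :: "(nat \<Rightarrow> int) \<Rightarrow> nat \<Rightarrow> (nat \<Rightarrow> int)" where
  "shiftw x n = (\<lambda>i. x (i + n))"

text \<open>Alternate order. Paper position k corresponds to index k-1 here, so the sign
  condition (-1)^k (x_k - y_k) < 0 becomes: x > y at even index, x < y at odd index.\<close>
definition altless :: "(nat \<Rightarrow> int) \<Rightarrow> (nat \<Rightarrow> int) \<Rightarrow> bool" where
  "altless x y \<longleftrightarrow> (\<exists>k. (\<forall>i<k. x i = y i) \<and>
      (-1::int) ^ (Suc k) * (x k - y k) < 0)"

definition altle :: "(nat \<Rightarrow> int) \<Rightarrow> (nat \<Rightarrow> int) \<Rightarrow> bool" where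
  "altle x y \<longleftrightarrow> x = y \<or> altless x y"

definition alt_lyndon :: "(nat \<Rightarrow> int) \<Rightarrow> bool" where
  "alt_lyndon d \<longleftrightarrow> (\<forall>n. altle d (shiftw d n))"

definition ovl :: "int list \<Rightarrow> (nat \<Rightarrow> int)" where
  "ovl w = (\<lambda>i. w ! (i mod length w))"

definition appw :: "int list \<Rightarrow> (nat \<Rightarrow> int) \<Rightarrow> (nat \<Rightarrow> int)" where
  "appw u x = (\<lambda>i. if i < length u then u ! i else x (i - length u))"

definition alt_system :: "(nat \<Rightarrow> int) \<Rightarrow> (nat \<Rightarrow> int) set" where
  "alt_system d = {x. (\<forall>i. 0 \<le> x i) \<and> (\<forall>k. altle d (shiftw x k))}"

definition Hcount :: "(nat \<Rightarrow> int) \<Rightarrow> nat \<Rightarrow> nat" where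
  "Hcount d n = card {w. length w = n \<and>
      (\<exists>x\<in>alt_system d. \<exists>k. w = map (\<lambda>i. x (k + i)) [0..<n])}"

definition attached :: "(nat \<Rightarrow> int) \<Rightarrow> real \<Rightarrow> bool" where
  "attached d \<beta> \<longleftrightarrow> 0 < \<beta> \<and>
     (\<lambda>n. ln (real (Hcount d n)) / real n) \<longlonglongrightarrow> ln \<beta>"

definition pref :: "(nat \<Rightarrow> int) \<Rightarrow> nat \<Rightarrow> int list" where
  "pref d m = map d [0..<m]"

definition dstar_cond :: "(nat \<Rightarrow> int) \<Rightarrow> real \<Rightarrow> nat \<Rightarrow> bool" where
  "dstar_cond d \<beta> p \<longleftrightarrow> alt_lyndon (ovl (pref d (2*p+1))) \<and> attached (ovl (pref d (2*p+1))) \<beta>"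

definition dstar :: "(nat \<Rightarrow> int) \<Rightarrow> real \<Rightarrow> (nat \<Rightarrow> int)" where
  "dstar d \<beta> = (if \<exists>p. dstar_cond d \<beta> p
     then (let p = (LEAST p. dstar_cond d \<beta> p) in
             ovl (pref d (2*p) @ [d (2*p) - 1, 0]))
     else d)"

text \<open>d* taken with respect to the (unique) beta that d is attached to.\<close>
definition dstar_of :: "(nat \<Rightarrow> int) \<Rightarrow> (nat \<Rightarrow> int)" where
  "dstar_of d = dstar d (THE \<beta>. attached d \<beta>)"

definition phi_letter :: "int \<Rightarrow> int list" where
  "phi_letter c = (if c = 0 then [1] else [1, 0, 0])"

definition phi :: "int list \<Rightarrow> int list" where
  "phi w = concat (map phi_letter w)"

text \<open>phi^n(1) is a prefix of phi^(n+1)(1) and has length > n, so the i-th letter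
  of the limit is the i-th letter of phi^(i+1)(1).\<close>
definition phi_inf :: "nat \<Rightarrow> int" where
  "phi_inf i = ((phi ^^ Suc i) [1]) ! i"

definition dec_last :: "int list \<Rightarrow> int list" where
  "dec_last a = butlast a @ [last a - 1]"

definition min_word :: "int list \<Rightarrow> (nat \<Rightarrow> int)" where
  "min_word a = (if even (length a) then appw (dec_last a @ [0]) (ovl a)
                 else appw a (ovl (dec_last a @ [0])))"

definition max_word :: "int list \<Rightarrow> (nat \<Rightarrow> int)" where
  "max_word a = (if even (length a) then ovl a else ovl (dec_last a @ [0]))"

definition minimal_period :: "int list \<Rightarrow> bool" where
  "minimal_period a \<longleftrightarrow> 0 < length a \<and>
     (\<forall>j. 0 < j \<and> j < length a \<longrightarrow> \<not> (\<forall>i. ovl a (i + j) = ovl a i))"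

definition Lyn :: "(nat \<Rightarrow> int) set" where
  "Lyn = {d. alt_lyndon d \<and>
     (\<exists>a. minimal_period a \<and> last a \<noteq> 0 \<and> alt_lyndon (ovl a) \<and> d \<noteq> ovl a \<and>
          altle (min_word a) d \<and> altle d (max_word a) \<and> altless (max_word a) phi_inf)}"

definition lbeta :: "real \<Rightarrow> real" where
  "lbeta \<beta> = - \<beta> / (\<beta> + 1)"

definition negbeta_T :: "real \<Rightarrow> real \<Rightarrow> real" where
  "negbeta_T \<beta> x = - \<beta> * x - of_int \<lfloor>- \<beta> * x - lbeta \<beta>\<rfloor>"

definition negbeta_exp :: "real \<Rightarrow> real \<Rightarrow> nat \<Rightarrow> int" where
  "negbeta_exp \<beta> x i = \<lfloor>- \<beta> * ((negbeta_T \<beta> ^^ i) x) - lbeta \<beta>\<rfloor>"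

end

theory Submission
  imports Defs
begin

text \<open>
  Counting the factors of the system of an alternate Lyndon word \<open>d\<close> letter by letter gives a
  generating function identity \<open>H(z) D(z) = 1 / (1 - z\<^sup>2)\<close>, where \<open>D(1 / \<beta>)\<close> is the distance
  from \<open>-\<beta> / (\<beta> + 1)\<close> to the number with digits \<open>d\<close> in base \<open>-\<beta>\<close>. So the entropy is
  \<open>log \<beta>\<close> for the first zero \<open>1 / \<beta>\<close> of \<open>D\<close> in \<open>(0, 1)\<close>, if there is one, and at this
  \<open>\<beta>\<close> evaluation maps the whole system monotonically into the closure of the interval of the
  transformation. Hence \<open>d\<close> is the wanted expansion unless some tail of \<open>d\<close> hits the excluded
  right end point. In that case a word other than \<open>d\<close> with the same value as \<open>d\<close> exists, or \<open>d\<close>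
  is periodic, and comparing all words with this value at their first difference exhibits the
  block \<open>a\<close> that puts \<open>d\<close> into \<open>Lyn\<close> or contradicts the upper bound by \<open>d\<^sup>*\<close>.

  Conversely an expansion in base \<open>-\<beta>\<close> that is composed of the blocks \<open>a\<close> and
  \<open>a\<^sub>1 \<cdots> (a\<^sub>k - 1) 0\<close> would embed the system of the periodic word of \<open>a\<close> into the
  interval with separated values, so that its entropy is at most \<open>log \<beta>\<close>; this contradicts the
  lower bound for that entropy in terms of \<open>k\<close> which is obtained by desubstituting words below
  \<open>\<phi>\<^sup>\<infinity>(1)\<close>. The word \<open>\<phi>\<^sup>\<infinity>(1)\<close> separates zero from positive entropy because its series
  \<open>D\<close> is the product of the factors \<open>1 - z ^ |\<phi>\<^sup>n(0)|\<close>.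
\<close>


text \<open>The block \<open>low a\<close> records the only way in which two words of the system of
  \<open>d\<close> can share the value 0: at the first difference the letters differ by exactly one,
  and the tails behind them have the values 0 and 1, the two ends of the closed interval. A tail of
  value 1 is a letter 0 followed by a tail of value 0, so \<open>w @ [c]\<close> competes with
  \<open>w @ [c - 1, 0]\<close>, and what follows either block has value 0 again. The case
  distinctions come from the fact that a prefix of odd length reverses the order. Exactly one of
  \<open>a\<close> and \<open>low a\<close> has even length; the largest concatenation of blocks
  repeats that one, and the smallest starts with the other one, once. The entropy bound for a
  periodic word with block length \<open>k\<close> has the form
  \<open>R ^ k + R ^ Suc k \<le> 1\<close> with \<open>R = 1 / \<beta>\<close>, because the two
  blocks contract values by \<open>z ^ k\<close> and \<open>z ^ Suc k\<close>. If these factors sum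
  to less than 1 and the constant part of the block map is positive, no concatenation of blocks has
  the value 0.\<close>

section \<open>Infinite words and the alternate order\<close>

lemma shiftw_apply [simp]: "shiftw x n i = x (i + n)"
  by (simp add: shiftw_def)

lemma shiftw_0 [simp]: "shiftw x 0 = x"
  by (simp add: shiftw_def)

lemma shiftw_shiftw [simp]: "shiftw (shiftw x m) n = shiftw x (m + n)"
  by (simp add: shiftw_def ac_simps)

lemma length_pref [simp]: "length (pref x n) = n"
  by (simp add: pref_def)

lemma nth_pref [simp]: "i < n \<Longrightarrow> pref x n ! i = x i"
  by (simp add: pref_def)

lemma pref_Suc: "pref x (Suc n) = x 0 # pref (shiftw x 1) n"
  by (rule nth_equalityI) (auto simp: nth_Cons split: nat.splits)

lemma pref_0 [simp]: "pref x 0 = []"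
  by (simp add: pref_def)

lemma pref_eq_iff: "pref x n = pref y n \<longleftrightarrow> (\<forall>i<n. x i = y i)"
  by (metis length_pref nth_pref nth_equalityI)

lemma appw_nth: "i < length w \<Longrightarrow> appw w x i = w ! i"
  by (simp add: appw_def)

lemma appw_plus [simp]: "appw w x (length w + i) = x i" "appw w x (i + length w) = x i"
  by (simp_all add: appw_def)

lemma appw_Nil [simp]: "appw [] x = x"
  by (simp add: appw_def)

lemma appw_Cons_0 [simp]: "appw (c # w) x 0 = c"
  by (simp add: appw_def)

lemma appw_Cons_Suc [simp]: "appw (c # w) x (Suc i) = appw w x i"
  by (simp add: appw_def)

lemma shiftw_appw_Cons [simp]: "shiftw (appw (c # w) x) (Suc 0) = appw w x"
  by (rule ext) simp

lemma appw_append: "appw (u @ v) x = appw u (appw v x)"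
  by (rule ext) (auto simp: appw_def nth_append)

lemma shiftw_appw_length [simp]: "shiftw (appw w x) (length w) = x"
  by (rule ext) simp

lemma shiftw_appw_drop: "i \<le> length w \<Longrightarrow> shiftw (appw w x) i = appw (drop i w) x"
  by (rule ext) (auto simp: appw_def add.commute)

lemma appw_pref [simp]: "appw (pref x n) (shiftw x n) = x"
  by (rule ext) (auto simp: appw_def)

lemma appw_eqI:
  assumes "\<And>i. i < length w \<Longrightarrow> x i = w ! i"
  shows "x = appw w (shiftw x (length w))"
  using assms by (intro ext) (auto simp: appw_def)

lemma pref_appw [simp]: "pref (appw w x) (length w) = w"
  by (rule nth_equalityI) (auto simp: appw_nth)

lemma appw_inject: "length v = length w \<Longrightarrow> appw v x = appw w y \<longleftrightarrow> v = w \<and> x = y"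
  by (metis pref_appw shiftw_appw_length)

lemma ovl_nth: "i < length w \<Longrightarrow> ovl w i = w ! i"
  by (simp add: ovl_def)

lemma appw_ovl: "w \<noteq> [] \<Longrightarrow> appw w (ovl w) = ovl w"
  by (rule ext) (auto simp: appw_def ovl_def le_mod_geq)

lemma shiftw_ovl [simp]: "shiftw (ovl w) (length w) = ovl w"
  by (rule ext) (auto simp: ovl_def)

lemma pref_ovl [simp]: "pref (ovl w) (length w) = w"
  by (rule nth_equalityI) (auto simp: ovl_nth)

lemma eq_ovlI:
  assumes "w \<noteq> []" "y = appw w y"
  shows "y = ovl w"
proof
  fix i show "y i = ovl w i"
  proof (induction i rule: less_induct)
    case (less i)
    show ?case
    proof (cases "i < length w")
      case True
      then show ?thesis by (subst assms(2)) (simp add: appw_nth ovl_nth)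
    next
      case False
      have "y i = y (i - length w)" using False by (subst assms(2)) (simp add: appw_def)
      also have "\<dots> = ovl w (i - length w)" using False assms(1)
        by (intro less) (metis diff_less length_greater_0_conv less_le_trans not_less)
      also have "\<dots> = ovl w i" using False by (simp add: ovl_def le_mod_geq)
      finally show ?thesis .
    qed
  qed
qed

lemma shift_period_ovl:
  assumes "shiftw x k = x" "0 < k"
  shows "x = ovl (pref x k)"
proof (rule eq_ovlI)
  show "pref x k \<noteq> []" using assms(2) by (metis length_pref less_irrefl list.size(3))
  show "x = appw (pref x k) x" using appw_pref[of x k] assms(1) by simp
qed

lemma ovl_in_set: "w \<noteq> [] \<Longrightarrow> ovl w i \<in> set w"
  by (simp add: ovl_def)

lemma altless_iff:
  "altless x y \<longleftrightarrow> (\<exists>k. (\<forall>i<k. x i = y i) \<and> (if even k then y k < x k else x k < y k))"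
proof -
  have "(-1::int) ^ (Suc k) * (x k - y k) < 0 \<longleftrightarrow> (if even k then y k < x k else x k < y k)" for k
    by (cases "even k") auto
  then show ?thesis unfolding altless_def by simp
qed

lemma altlessI:
  assumes "\<And>i. i < k \<Longrightarrow> x i = y i" "even k \<Longrightarrow> y k < x k" "odd k \<Longrightarrow> x k < y k"
  shows "altless x y"
  unfolding altless_iff using assms by (intro exI[of _ k]) auto

lemma altless_irrefl [simp]: "\<not> altless x x"
  by (auto simp: altless_iff)

lemma altle_refl [simp]: "altle x x"
  by (simp add: altle_def)

lemma altless_trans:
  assumes "altless x y" "altless y z"
  shows "altless x z"
proof -
  obtain k where k: "\<forall>i<k. x i = y i" "if even k then y k < x k else x k < y k"
    using assms(1) unfolding altless_iff by blast
  obtain m where m: "\<forall>i<m. y i = z i" "if even m then z m < y m else y m < z m"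
    using assms(2) unfolding altless_iff by blast
  consider "k < m" | "k = m" | "m < k" by linarith
  then show ?thesis
  proof cases
    case 1
    then show ?thesis using k m by (intro altlessI[of k]) (auto split: if_splits)
  next
    case 2
    then show ?thesis using k m by (intro altlessI[of k]) (auto split: if_splits)
  next
    case 3
    then show ?thesis using k m by (intro altlessI[of m]) (auto split: if_splits)
  qed
qed

lemma first_difference:
  assumes "x \<noteq> (y :: nat \<Rightarrow> int)"
  obtains k where "\<And>i. i < k \<Longrightarrow> x i = y i" "x k \<noteq> y k"
proof -
  have "\<exists>k. x k \<noteq> y k" using assms by auto
  then show ?thesis using that[of "LEAST k. x k \<noteq> y k"]
    by (metis (mono_tags, lifting) LeastI_ex not_less_Least)
qed

lemma altless_total: "altless x y \<or> x = y \<or> altless y x"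
proof (cases "x = y")
  case False
  then obtain k where k: "\<And>i. i < k \<Longrightarrow> x i = y i" "x k \<noteq> y k"
    using first_difference by blast
  show ?thesis
  proof (cases "if even k then y k < x k else x k < y k")
    case True
    then show ?thesis using k by (metis altlessI)
  next
    case False
    then have "altless y x" using k by (intro altlessI[of k]) (auto split: if_splits)
    then show ?thesis by simp
  qed
qed simp

lemma not_altless: "\<not> altless x y \<longleftrightarrow> altle y x"
  unfolding altle_def using altless_total altless_trans altless_irrefl by metis

lemma not_altle: "\<not> altle x y \<longleftrightarrow> altless y x"
  using not_altless by blast

lemma altle_trans: "altle x y \<Longrightarrow> altle y z \<Longrightarrow> altle x z"
  unfolding altle_def using altless_trans by metis

lemma altle_less_trans: "altle x y \<Longrightarrow> altless y z \<Longrightarrow> altless x z"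
  unfolding altle_def using altless_trans by metis

lemma altless_le_trans: "altless x y \<Longrightarrow> altle y z \<Longrightarrow> altless x z"
  unfolding altle_def using altless_trans by metis

lemma altless_imp_altle: "altless x y \<Longrightarrow> altle x y"
  by (simp add: altle_def)

lemma altle_at:
  assumes "altle x y" "\<And>i. i < k \<Longrightarrow> x i = y i"
  shows "if even k then y k \<le> x k else x k \<le> y k"
proof (rule ccontr)
  assume neg: "\<not> ?thesis"
  then have "altless y x" using assms(2)
    by (intro altlessI[of k]) (auto split: if_splits)
  then show False using assms(1) not_altle by blast
qed

text \<open>A common prefix moves the first difference by \<open>length w\<close> places, so the
  sign attached to it changes exactly when this length is odd.\<close>

lemma altless_appw:
  "altless (appw w x) (appw w y) \<longleftrightarrow> (if even (length w) then altless x y else altless y x)"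
proof -
  have *: "altless (appw w x) (appw w y)"
    if "if even (length w) then altless x y else altless y x" for x y
  proof -
    obtain k where k: "\<forall>i<k. x i = y i"
      "if even (length w + k) then y k < x k else x k < y k"
    proof (cases "even (length w)")
      case True
      then show ?thesis using that \<open>if even (length w) then altless x y else altless y x\<close>
        unfolding altless_iff by (auto split: if_splits)
    next
      case False
      then obtain k where "\<forall>i<k. y i = x i" "if even k then x k < y k else y k < x k"
        using \<open>if even (length w) then altless x y else altless y x\<close>
        unfolding altless_iff by (auto split: if_splits)
      then show ?thesis using False by (intro that[of k]) (auto split: if_splits)
    qed
    show ?thesis
      by (rule altlessI[of "length w + k"]) (use k in \<open>auto simp: appw_def split: if_splits\<close>)
  qed
  have **: "\<not> altless (appw w x) (appw w y)"
    if "\<not> (if even (length w) then altless x y else altless y x)"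
  proof -
    have "x = y \<or> (if even (length w) then altless y x else altless x y)"
      using that altless_total[of x y] by (auto split: if_splits)
    then show ?thesis using *[of y x] altless_trans altless_irrefl by metis
  qed
  show ?thesis using *[of x y] ** by blast
qed

lemma altle_appw:
  "altle (appw w x) (appw w y) \<longleftrightarrow> (if even (length w) then altle x y else altle y x)"
  unfolding altle_def using altless_appw[of w x y] appw_inject[of w w x y] by auto

lemma altle_between:
  assumes "altle x y" "altle y w" "\<And>i. i < m \<Longrightarrow> x i = w i" "i < m"
  shows "y i = x i"
  using assms(4)
proof (induction i rule: less_induct)
  case (less i)
  have e: "\<And>l. l < i \<Longrightarrow> x l = y l" "\<And>l. l < i \<Longrightarrow> y l = w l"
    using less assms(3) by (metis less_trans)+
  show ?case
    using altle_at[OF assms(1), of i] altle_at[OF assms(2), of i] e assms(3)[OF less.prems]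
    by (auto split: if_splits)
qed

lemma altless_Cons_decomp:
  "altless x y \<longleftrightarrow> y 0 < x 0 \<or> (x 0 = y 0 \<and> altless (shiftw y 1) (shiftw x 1))"
proof -
  have sp: "x = appw [x 0] (shiftw x 1)" for x :: "nat \<Rightarrow> int"
    by (rule ext) (auto simp: appw_def)
  show ?thesis
  proof (cases "x 0 = y 0")
    case True
    then have "altless x y \<longleftrightarrow> altless (shiftw y 1) (shiftw x 1)"
      using altless_appw[of "[x 0]" "shiftw x 1" "shiftw y 1"] sp[of x] sp[of y] by simp
    then show ?thesis using True by simp
  next
    case False
    show ?thesis
    proof
      assume "altless x y"
      then show "y 0 < x 0 \<or> (x 0 = y 0 \<and> altless (shiftw y 1) (shiftw x 1))"
        using altle_at[of x y 0] False by (auto dest: altless_imp_altle)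
    next
      assume "y 0 < x 0 \<or> (x 0 = y 0 \<and> altless (shiftw y 1) (shiftw x 1))"
      then show "altless x y" using False by (intro altlessI[of 0]) auto
    qed
  qed
qed

lemma altle_Cons_decomp:
  "altle x y \<longleftrightarrow> y 0 < x 0 \<or> (x 0 = y 0 \<and> altle (shiftw y 1) (shiftw x 1))"
  using altless_Cons_decomp[of y x] not_altless[of y x]
    not_altless[of "shiftw x 1" "shiftw y 1"] by auto

lemma alt_lyndonD: "alt_lyndon d \<Longrightarrow> altle d (shiftw d n)"
  by (simp add: alt_lyndon_def)

lemma alt_system_shift: "x \<in> alt_system d \<Longrightarrow> shiftw x n \<in> alt_system d"
  by (auto simp: alt_system_def)

lemma alt_system_self: "alt_lyndon d \<Longrightarrow> (\<And>i. 0 \<le> d i) \<Longrightarrow> d \<in> alt_system d"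
  by (simp add: alt_system_def alt_lyndon_def)

lemma alt_system_nonneg: "x \<in> alt_system d \<Longrightarrow> 0 \<le> x i"
  by (simp add: alt_system_def)

lemma alt_system_ge: "x \<in> alt_system d \<Longrightarrow> altle d (shiftw x n)"
  by (simp add: alt_system_def)

lemma alt_system_ge0: "x \<in> alt_system d \<Longrightarrow> altle d x"
  using alt_system_ge[of x d 0] by simp

text \<open>At the first position larger letters give smaller words; hence the minimum
  \<open>d\<close> starts with the largest letter of its system.\<close>

lemma alt_system_le: "x \<in> alt_system d \<Longrightarrow> x i \<le> d 0"
  using altle_at[of d "shiftw x i" 0] alt_system_ge[of x d i] by simp

lemma alt_system_mono:
  assumes "alt_lyndon c" "altle d c" "\<And>i. 0 \<le> c i" 
  shows "c \<in> alt_system d" "alt_system c \<subseteq> alt_system d"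
  using assms unfolding alt_system_def alt_lyndon_def by (auto intro: altle_trans)

lemma alt_system_Cons:
  assumes "y \<in> alt_system d" "0 \<le> c" "altle d (appw [c] y)"
  shows "appw [c] y \<in> alt_system d"
  unfolding alt_system_def
proof (intro CollectI conjI allI)
  fix i show "0 \<le> appw [c] y i"
    using assms(2) alt_system_nonneg[OF assms(1)] by (cases i) auto
next
  fix k show "altle d (shiftw (appw [c] y) k)"
  proof (cases k)
    case 0
    then show ?thesis using assms(3) by simp
  next
    case (Suc n)
    have "shiftw (appw [c] y) (Suc n) = shiftw y n"
      by (rule ext) simp
    then show ?thesis using Suc alt_system_ge[OF assms(1)] by simp
  qed
qed


section \<open>Evaluation of words\<close>

text \<open>For \<^term>\<open>z = 1 / \<beta>\<close> this is the distance from the left end point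
  \<^term>\<open>lbeta \<beta>\<close> to the number with digits \<^term>\<open>x\<close> in base \<^term>\<open>-\<beta>\<close>; it is also the
  kneading series of \<^term>\<open>x\<close>, whose first zero governs the growth of the system.\<close>

definition wval :: "real \<Rightarrow> (nat \<Rightarrow> int) \<Rightarrow> real" where
  "wval z x = 1 + (\<Sum>k. (of_int (x k) + 1) * (- z) ^ Suc k)"

definition bndw :: "(nat \<Rightarrow> int) \<Rightarrow> bool" where
  "bndw x \<longleftrightarrow> (\<exists>K. \<forall>i. \<bar>x i\<bar> \<le> K)"

lemma bndwI: "(\<And>i. 0 \<le> x i) \<Longrightarrow> (\<And>i. x i \<le> K) \<Longrightarrow> bndw x"
  unfolding bndw_def by (intro exI[of _ K]) auto

lemma bndw_shiftw [simp]: "bndw x \<Longrightarrow> bndw (shiftw x n)"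
  unfolding bndw_def by auto

lemma bndw_alt_system: "x \<in> alt_system d \<Longrightarrow> bndw x"
  by (rule bndwI[of _ "d 0"]) (auto simp: alt_system_nonneg alt_system_le)

lemma bndw_appw [simp]: "bndw (appw w x) \<longleftrightarrow> bndw x"
proof
  assume "bndw (appw w x)"
  then show "bndw x" using bndw_shiftw[of "appw w x" "length w"] by simp
next
  assume "bndw x"
  then obtain K where K: "\<And>i. \<bar>x i\<bar> \<le> K" unfolding bndw_def by auto
  have "\<bar>appw w x i\<bar> \<le> max K (Max (insert 0 (abs ` set w)))" for i
  proof (cases "i < length w")
    case True
    have "\<bar>w ! i\<bar> \<le> Max (insert 0 (abs ` set w))" using True by (intro Max_ge) auto
    then show ?thesis using True by (simp add: appw_nth le_max_iff_disj)
  next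
    case False
    then show ?thesis using K[of "i - length w"] by (simp add: appw_def)
  qed
  then show "bndw (appw w x)" unfolding bndw_def by blast
qed

lemma bndw_ovl [simp]:
  assumes "w \<noteq> []"
  shows "bndw (ovl w)"
proof -
  have "\<bar>ovl w i\<bar> \<le> Max (abs ` set w)" for i
    using ovl_in_set[OF assms, of i] by (intro Max_ge) auto
  then show ?thesis unfolding bndw_def by blast
qed

lemma wval_terms_bound:
  fixes z :: real
  assumes "\<And>i. \<bar>x i\<bar> \<le> K" "0 \<le> z"
  shows "norm ((of_int (x k) + 1) * (- z) ^ Suc k) \<le> (of_int K + 1) * z * z ^ k"
proof -
  have "\<bar>real_of_int (x k) + 1\<bar> \<le> of_int K + 1" using assms(1)[of k] by linarith
  then have "\<bar>real_of_int (x k) + 1\<bar> * (z * z ^ k) \<le> (of_int K + 1) * (z * z ^ k)"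
    using assms(2) by (intro mult_right_mono) auto
  then show ?thesis using assms(2) by (simp add: abs_mult power_abs mult_ac)
qed

lemma summable_wval:
  fixes z :: real
  assumes "bndw x" "0 \<le> z" "z < 1"
  shows "summable (\<lambda>k. (of_int (x k) + 1) * (- z) ^ Suc k)"
proof -
  obtain K where K: "\<And>i. \<bar>x i\<bar> \<le> K" using assms(1) unfolding bndw_def by auto
  show ?thesis
    by (rule summable_comparison_test'[of "\<lambda>k. (of_int K + 1) * z * z ^ k" 0])
      (use assms wval_terms_bound[OF K assms(2)] in \<open>auto intro!: summable_mult summable_geometric\<close>)
qed

lemma wval_bound:
  assumes "\<And>i. \<bar>x i\<bar> \<le> K" "0 \<le> z" "z < 1"
  shows "\<bar>wval z x\<bar> \<le> 1 + (of_int K + 1) * z / (1 - z)"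
proof -
  have s: "summable (\<lambda>k. (of_int K + 1) * z * z ^ k)"
    using assms by (auto intro!: summable_mult summable_geometric)
  have "norm (\<Sum>k. (of_int (x k) + 1) * (- z) ^ Suc k) \<le> (\<Sum>k. (of_int K + 1) * z * z ^ k)"
    by (rule norm_suminf_le[OF _ s]) (use wval_terms_bound[OF assms(1,2)] in auto)
  also have "\<dots> = (of_int K + 1) * z * (\<Sum>k. z ^ k)"
    using assms by (intro suminf_mult) (auto intro!: summable_geometric)
  also have "\<dots> = (of_int K + 1) * z / (1 - z)"
    using assms by (simp add: suminf_geometric)
  finally show ?thesis unfolding wval_def by simp
qed

lemma wval_rec:
  assumes "bndw x" "0 \<le> z" "z < 1"
  shows "wval z x = 1 - z * (of_int (x 0) + wval z (shiftw x 1))"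
proof -
  let ?f = "\<lambda>k. (of_int (x k) + 1) * (- z) ^ Suc k"
  have "(\<Sum>k. ?f k) = (\<Sum>k. ?f (Suc k)) + ?f 0"
    using suminf_split_head[OF summable_wval[OF assms]] by simp
  also have "(\<Sum>k. ?f (Suc k)) = (\<Sum>k. (- z) * ((of_int (shiftw x 1 k) + 1) * (- z) ^ Suc k))"
    by (simp add: mult_ac)
  also have "\<dots> = (- z) * (\<Sum>k. (of_int (shiftw x 1 k) + 1) * (- z) ^ Suc k)"
    by (rule suminf_mult[OF summable_wval[OF bndw_shiftw[OF assms(1)] assms(2,3)]])
  finally show ?thesis unfolding wval_def by (simp add: algebra_simps)
qed

lemma isCont_wval:
  assumes "bndw x" "0 \<le> z" "z < 1"
  shows "isCont (\<lambda>z. wval z x) z"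
proof -
  define K where "K = (z + 1) / 2"
  have K: "z < K" "0 < K" "K < 1" using assms by (auto simp: K_def)
  define c where "c k = real_of_int (x k) + 1" for k
  have s: "summable (\<lambda>n. c n * (-K) ^ n)"
  proof -
    have "summable (\<lambda>k. c k * (- K) ^ Suc k)"
      using summable_wval[of x K] assms K unfolding c_def by auto
    then have "summable (\<lambda>k. (- 1 / K) * (c k * (- K) ^ Suc k))" by (rule summable_mult)
    then show ?thesis using K by (simp add: field_simps)
  qed
  have "isCont (\<lambda>y. \<Sum>n. c n * y ^ n) (- z)"
    by (rule isCont_powser[OF s]) (use K assms in auto)
  then have "isCont (\<lambda>y. \<Sum>n. c n * (- y) ^ n) z"
    by (intro isCont_o2[where f = uminus and g = "\<lambda>y. \<Sum>n. c n * y ^ n"]) auto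
  then have cont: "isCont (\<lambda>y. 1 + (- y) * (\<Sum>n. c n * (- y) ^ n)) z"
    by (intro continuous_intros)
  have "\<forall>\<^sub>F y in nhds z. \<bar>y\<bar> < K"
  proof -
    have "\<forall>\<^sub>F y in nhds z. y \<in> {- K <..< K}"
      by (rule eventually_nhds_in_open) (use K assms in auto)
    then show ?thesis by (rule eventually_mono) auto
  qed
  then have "\<forall>\<^sub>F y in nhds z. 1 + (- y) * (\<Sum>n. c n * (- y) ^ n) = wval y x"
  proof (rule eventually_mono)
    fix y :: real assume y: "\<bar>y\<bar> < K"
    have "summable (\<lambda>n. c n * (- y) ^ n)"
      by (rule powser_inside[OF s]) (use y K in auto)
    from suminf_mult[OF this, of "- y"]
    show "1 + (- y) * (\<Sum>n. c n * (- y) ^ n) = wval y x"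
      unfolding wval_def c_def by (simp add: mult_ac)
  qed
  from isCont_cong[OF this] cont show ?thesis by simp
qed

text \<open>The recursion \<open>wval_rec\<close> run along a finite word, as an affine map of the
  value \<open>e\<close> of the tail behind it.\<close>

definition aff :: "real \<Rightarrow> int list \<Rightarrow> real \<Rightarrow> real" where
  "aff z w e = foldr (\<lambda>c e. 1 - z * (of_int c + e)) w e"

lemma aff_Nil [simp]: "aff z [] e = e"
  and aff_Cons [simp]: "aff z (c # w) e = 1 - z * (of_int c + aff z w e)"
  and aff_append: "aff z (v @ w) e = aff z v (aff z w e)"
  by (simp_all add: aff_def)

lemma aff_affine: "aff z w e = aff z w 0 + (- z) ^ length w * e"
  by (induction w) (auto simp: algebra_simps)

lemma aff_diff: "aff z w e - aff z w e' = (- z) ^ length w * (e - e')"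
  using aff_affine[of z w e] aff_affine[of z w e'] by (simp add: algebra_simps)

lemma aff_snoc_dec: "aff z (w @ [c - 1]) e = aff z (w @ [c]) (e - 1)"
  by (simp add: aff_append algebra_simps)

text \<open>A letter 0 turns the tail value \<open>e\<close> into \<open>1 - z * e\<close>, and
  lowering the letter before it by one subtracts 1 again. So both words have the same value if
  \<open>e = 0\<close>; this is the source of the coincidences of values below.\<close>

lemma aff_dec_zero: "aff z (w @ [c - 1, 0]) e = aff z (w @ [c]) (- z * e)"
  by (simp add: aff_append algebra_simps)

lemma wval_appw:
  assumes "bndw x" "0 \<le> z" "z < 1"
  shows "wval z (appw w x) = aff z w (wval z x)"
proof (induction w)
  case (Cons c w)
  have "wval z (appw (c # w) x) = 1 - z * (of_int c + wval z (appw w x))"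
    by (subst wval_rec) (use assms in auto)
  then show ?case using Cons by simp
qed simp

lemma wval_split:
  assumes "bndw x" "0 \<le> z" "z < 1"
  shows "wval z x = aff z (pref x n) (wval z (shiftw x n))"
  by (metis appw_pref wval_appw assms bndw_shiftw)

text \<open>The common prefix contributes only a sign and a scale. When tail values lie in the unit
  interval, the integer gap between the letters therefore decides.\<close>

lemma wval_diff:
  assumes "bndw x" "bndw y" "0 \<le> z" "z < 1" "\<And>i. i < j \<Longrightarrow> x i = y i"
  shows "wval z x - wval z y = (- z) ^ Suc j *
    ((of_int (x j) + wval z (shiftw x (Suc j))) - (of_int (y j) + wval z (shiftw y (Suc j))))"
proof -
  have p: "pref x j = pref y j" using assms(5) by (simp add: pref_eq_iff)
  have r: "wval z (shiftw w j) = 1 - z * (of_int (w j) + wval z (shiftw w (Suc j)))"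
    if "bndw w" for w
    using wval_rec[of "shiftw w j" z] that assms by simp
  have "wval z x - wval z y = (- z) ^ j * (wval z (shiftw x j) - wval z (shiftw y j))"
    using wval_split[of x z j] wval_split[of y z j] assms aff_diff[of z "pref x j"] p by simp
  then show ?thesis using r[OF assms(1)] r[OF assms(2)] by (simp add: algebra_simps)
qed

lemma wval_ovl_fixed:
  assumes "w \<noteq> []" "0 \<le> z" "z < 1"
  shows "wval z (ovl w) = aff z w (wval z (ovl w))"
  by (metis appw_ovl assms bndw_ovl wval_appw)

lemma neg_power_less_one: 
  assumes "0 < (z::real)" "z < 1" "0 < n"
  shows "(- z) ^ n < 1"
proof -
  have "\<bar>(- z) ^ n\<bar> = z ^ n" using assms by (simp add: power_abs)
  also have "\<dots> < 1" using assms power_Suc_less_one[of z "n - 1"] by simp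
  finally show ?thesis by linarith
qed

lemma wval_ovl:
  assumes "w \<noteq> []" "0 < z" "z < 1"
  shows "wval z (ovl w) = aff z w 0 / (1 - (- z) ^ length w)"
proof -
  have "(- z) ^ length w < 1" using assms by (intro neg_power_less_one) auto
  then show ?thesis
    using wval_ovl_fixed[of w z] aff_affine[of z w "wval z (ovl w)"] assms
    by (simp add: field_simps)
qed

section \<open>Counting factors\<close>

definition factors :: "(nat \<Rightarrow> int) \<Rightarrow> nat \<Rightarrow> int list set" where
  "factors d n = (\<lambda>x. pref x n) ` alt_system d"

text \<open>The system is invariant under shifts, so a factor of one of its words is a prefix of
  some word in it.\<close>

lemma Hcount_factors: "Hcount d n = card (factors d n)"
proof -
  have e: "map (\<lambda>i. x (k + i)) [0..<n] = pref (shiftw x k) n" for x :: "nat \<Rightarrow> int" and k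
    by (simp add: pref_def add.commute)
  have "{w. length w = n \<and> (\<exists>x\<in>alt_system d. \<exists>k. w = map (\<lambda>i. x (k + i)) [0..<n])} = factors d n"
    unfolding e factors_def
  proof (intro equalityI subsetI)
    fix w assume "w \<in> (\<lambda>x. pref x n) ` alt_system d"
    then obtain x where "x \<in> alt_system d" "w = pref (shiftw x 0) n" by auto
    then show "w \<in> {w. length w = n \<and> (\<exists>x\<in>alt_system d. \<exists>k. w = pref (shiftw x k) n)}"
      using length_pref by blast
  qed (auto intro: alt_system_shift)
  then show ?thesis by (simp add: Hcount_def)
qed

lemma finite_factors [simp]: "finite (factors d n)"
proof (rule finite_subset)
  show "factors d n \<subseteq> {w. set w \<subseteq> {0..d 0} \<and> length w = n}"
    by (auto simp: factors_def pref_def alt_system_nonneg alt_system_le)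
qed (rule finite_lists_length_eq, simp)

lemma Hcount_submult: "Hcount d (m + n) \<le> Hcount d m * Hcount d n"
proof -
  have "inj_on (\<lambda>w. (take m w, drop m w)) (factors d (m + n))"
    by (rule inj_onI) (metis append_take_drop_id prod.inject)
  moreover have "(\<lambda>w. (take m w, drop m w)) ` factors d (m + n) \<subseteq> factors d m \<times> factors d n"
  proof (clarsimp simp: factors_def, intro conjI)
    fix x assume x: "x \<in> alt_system d"
    have "take m (pref x (m + n)) = pref x m" "drop m (pref x (m + n)) = pref (shiftw x m) n"
      by (auto intro!: nth_equalityI simp: add.commute)
    then show "take m (pref x (m + n)) \<in> (\<lambda>x. pref x m) ` alt_system d"
      "drop m (pref x (m + n)) \<in> (\<lambda>x. pref x n) ` alt_system d"
      using x alt_system_shift[OF x] by auto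
  qed
  ultimately have "card (factors d (m + n)) \<le> card (factors d m \<times> factors d n)"
    by (intro card_inj_on_le) auto
  then show ?thesis by (simp add: Hcount_factors card_cartesian_product)
qed

text \<open>The alternate order on words of equal length; swapping the arguments in the recursive
  call replaces the alternating sign.\<close>

function lless :: "int list \<Rightarrow> int list \<Rightarrow> bool" where
  "lless (c # u) (e # w) = (e < c \<or> c = e \<and> lless w u)"
| "lless [] w = False"
| "lless (c # u) [] = False"
  by pat_completeness auto
termination by (relation "measure (\<lambda>(u, w). length u + length w)") auto

lemma lless_total: "length u = length w \<Longrightarrow> lless u w \<or> u = w \<or> lless w u"
  by (induction u w rule: lless.induct) auto

lemma lless_asym: "lless u w \<Longrightarrow> \<not> lless w u"
  by (induction u w rule: lless.induct) auto

lemma lless_pref: "lless (pref x n) (pref y n) \<Longrightarrow> altless x y"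
proof (induction n arbitrary: x y)
  case (Suc n)
  then show ?case by (subst altless_Cons_decomp) (auto simp: pref_Suc)
qed simp

text \<open>The alternate order exchanges the weak and the strict variant when the first letter is
  removed, which makes both counts satisfy one recursion.\<close>

definition above :: "bool \<Rightarrow> (nat \<Rightarrow> int) \<Rightarrow> (nat \<Rightarrow> int) \<Rightarrow> nat \<Rightarrow> int list set" where
  "above b d x n = {w \<in> factors d n. if b then \<not> lless w (pref x n) else lless (pref x n) w}"

lemma above_subset: "above b d x n \<subseteq> factors d n"
  by (auto simp: above_def)

lemma finite_above [simp]: "finite (above b d x n)"
  using above_subset finite_factors finite_subset by metis

lemma Cons_factors:
  assumes "w \<in> factors d n" "x \<in> alt_system d" "0 \<le> c"
    "c < x 0 \<or> (c = x 0 \<and> \<not> lless (pref (shiftw x 1) n) w)"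
  shows "c # w \<in> factors d (Suc n)"
proof -
  obtain y where y: "y \<in> alt_system d" "w = pref y n" using assms(1) by (auto simp: factors_def)
  have dx: "x 0 < d 0 \<or> d 0 = x 0 \<and> altle (shiftw x 1) (shiftw d 1)"
    using alt_system_ge0[OF assms(2)] altle_Cons_decomp[of d x] by simp
  \<comment> \<open>If \<open>w\<close> is a prefix of the tail of \<open>x\<close>, its chosen
    extension \<open>y\<close> may be too large behind the letter \<open>x 0\<close>; then
    \<open>x\<close> itself is the witness.\<close>
  consider "c < x 0" | "c = x 0" "w = pref (shiftw x 1) n" | "c = x 0" "lless w (pref (shiftw x 1) n)"
    using assms(4) lless_total[of w "pref (shiftw x 1) n"] y by auto
  then show ?thesis
  proof cases
    case 2
    then have "c # w = pref x (Suc n)" by (simp add: pref_Suc)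
    then show ?thesis using assms(2) by (auto simp: factors_def)
  next
    case 1
    then have "altle d (appw [c] y)" using dx by (subst altle_Cons_decomp) auto
    then have "appw [c] y \<in> alt_system d" using alt_system_Cons y assms(3) by blast
    moreover have "c # w = pref (appw [c] y) (Suc n)" using y by (simp add: pref_Suc)
    ultimately show ?thesis by (auto simp: factors_def)
  next
    case 3
    then have "altless y (shiftw x 1)" using y lless_pref by blast
    then have "altle d (appw [c] y)" using dx 3
      by (subst altle_Cons_decomp) (auto intro: altle_trans altless_imp_altle)
    then have "appw [c] y \<in> alt_system d" using alt_system_Cons y assms(3) by blast
    moreover have "c # w = pref (appw [c] y) (Suc n)" using y by (simp add: pref_Suc)
    ultimately show ?thesis by (auto simp: factors_def)
  qed
qed

text \<open>A first letter below \<open>x 0\<close> makes a word larger than \<open>x\<close>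
  whatever follows. An equal first letter leaves the reversed comparison of the tails, and the
  complement of that is a set \<open>above\<close> of the other kind.\<close>

lemma above_Suc:
  assumes "x \<in> alt_system d"
  shows "above b d x (Suc n) = (\<lambda>(c, w). c # w) ` ({0..<x 0} \<times> factors d n)
    \<union> (#) (x 0) ` (factors d n - above (\<not> b) d (shiftw x 1) n)" (is "_ = ?A \<union> ?B")
proof (intro equalityI subsetI)
  fix w assume w: "w \<in> above b d x (Suc n)"
  then obtain y where y: "y \<in> alt_system d" "w = y 0 # pref (shiftw y 1) n"
    by (auto simp: above_def factors_def pref_Suc)
  have f: "pref (shiftw y 1) n \<in> factors d n"
    using alt_system_shift[OF y(1), of 1] by (auto simp: factors_def)
  have "y 0 < x 0 \<or> (y 0 = x 0 \<and> pref (shiftw y 1) n \<notin> above (\<not> b) d (shiftw x 1) n)"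
    using w y f lless_asym[of "pref (shiftw y 1) n" "pref (shiftw x 1) n"]
    by (auto simp: above_def pref_Suc split: if_splits)
  then show "w \<in> ?A \<union> ?B" using y f alt_system_nonneg[OF y(1), of 0] by auto
next
  fix w assume "w \<in> ?A \<union> ?B"
  then obtain c v where cv: "w = c # v" "v \<in> factors d n" "0 \<le> c"
    "c < x 0 \<or> (c = x 0 \<and> v \<notin> above (\<not> b) d (shiftw x 1) n)"
    using alt_system_nonneg[OF assms, of 0] by auto
  have *: "c < x 0 \<or> (c = x 0 \<and> \<not> lless (pref (shiftw x 1) n) v)"
    using cv lless_asym by (auto simp: above_def split: if_splits)
  have "c # v \<in> factors d (Suc n)" using Cons_factors[OF cv(2) assms cv(3) *] .
  then show "w \<in> above b d x (Suc n)"
    using cv * by (auto simp: above_def pref_Suc split: if_splits)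
qed

lemma card_above_Suc:
  assumes "x \<in> alt_system d"
  shows "real (card (above b d x (Suc n))) =
    (of_int (x 0) + 1) * real (Hcount d n) - real (card (above (\<not> b) d (shiftw x 1) n))"
proof -
  let ?A = "(\<lambda>(c, w). c # w) ` ({0..<x 0} \<times> factors d n)"
  let ?B = "(#) (x 0) ` (factors d n - above (\<not> b) d (shiftw x 1) n)"
  have "card ?A = card ({0..<x 0} \<times> factors d n)"
    by (rule card_image) (auto simp: inj_on_def)
  also have "\<dots> = nat (x 0) * Hcount d n" by (simp add: card_cartesian_product Hcount_factors)
  finally have A: "real (card ?A) = of_int (x 0) * real (Hcount d n)"
    using alt_system_nonneg[OF assms, of 0] by simp
  have "card ?B = card (factors d n - above (\<not> b) d (shiftw x 1) n)"
    by (rule card_image) (auto simp: inj_on_def)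
  also have "\<dots> = Hcount d n - card (above (\<not> b) d (shiftw x 1) n)"
    by (simp add: card_Diff_subset above_subset Hcount_factors)
  finally have B: "real (card ?B) = real (Hcount d n) - real (card (above (\<not> b) d (shiftw x 1) n))"
    using card_mono[OF finite_factors above_subset] by (simp add: Hcount_factors of_nat_diff)
  have "card (above b d x (Suc n)) = card ?A + card ?B"
    unfolding above_Suc[OF assms] by (rule card_Un_disjoint) auto
  then show ?thesis using A B by (simp add: algebra_simps)
qed

lemma card_above_le: "card (above b d x n) \<le> Hcount d n"
  using card_mono[OF finite_factors above_subset] by (simp add: Hcount_factors)

definition nonneg_lyndon :: "(nat \<Rightarrow> int) \<Rightarrow> bool" where
  "nonneg_lyndon d \<longleftrightarrow> alt_lyndon d \<and> (\<forall>i. 0 \<le> d i)"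

lemma nonneg_lyndon_mem: "nonneg_lyndon d \<Longrightarrow> d \<in> alt_system d"
  by (simp add: nonneg_lyndon_def alt_system_self)

lemma above_self:
  assumes "nonneg_lyndon d"
  shows "above True d d n = factors d n"
proof -
  have "\<not> lless (pref x n) (pref d n)" if "x \<in> alt_system d" for x
    using lless_pref alt_system_ge0[OF that] not_altless by blast
  then show ?thesis by (auto simp: above_def factors_def)
qed

lemma Hcount_pos: "nonneg_lyndon d \<Longrightarrow> 0 < Hcount d n"
  using nonneg_lyndon_mem finite_factors[of d n]
  by (auto simp: Hcount_factors card_gt_0_iff simp flip: ex_in_conv) (auto simp: factors_def)


section \<open>Entropy\<close>

lemma subadditive_mult:
  fixes a :: "nat \<Rightarrow> real"
  assumes "\<And>m n. a (m + n) \<le> a m + a n"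
  shows "a (q * m + r) \<le> real q * a m + a r"
proof (induction q)
  case (Suc q)
  have "a (Suc q * m + r) = a (m + (q * m + r))" by (simp add: algebra_simps)
  also have "\<dots> \<le> a m + a (q * m + r)" by (rule assms)
  finally show ?case using Suc by (simp add: algebra_simps)
qed simp

text \<open>The limit is obtained as the infimum of the quotients, which gives the last conclusion
  for every \<open>n\<close>.\<close>

lemma fekete:
  fixes a :: "nat \<Rightarrow> real"
  assumes sub: "\<And>m n. a (m + n) \<le> a m + a n" and nonneg: "\<And>n. 0 \<le> a n"
  obtains L where "0 \<le> L" "(\<lambda>n. a n / real n) \<longlonglongrightarrow> L" "\<And>n. real n * L \<le> a n"
proof -
  define S where "S = (\<lambda>n. a n / real n) ` {1..}"
  define L where "L = Inf S"
  have bd: "bdd_below S" unfolding S_def using nonneg by (intro bdd_belowI[of _ 0]) auto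
  have ne: "S \<noteq> {}" unfolding S_def by auto
  have L0: "0 \<le> L" unfolding L_def using nonneg by (intro cInf_greatest ne) (auto simp: S_def)
  have le: "L \<le> a n / real n" if "1 \<le> n" for n
    unfolding L_def by (rule cInf_lower[OF _ bd]) (use that in \<open>auto simp: S_def\<close>)
  have le': "real n * L \<le> a n" for n
    using le[of n] nonneg[of n] by (cases "n = 0") (auto simp: field_simps)
  have "(\<lambda>n. a n / real n) \<longlonglongrightarrow> L"
  proof (rule LIMSEQ_I)
    fix e :: real assume e: "0 < e"
    have "Inf S < L + e / 2" unfolding L_def using e by simp
    then obtain m where m: "1 \<le> m" "a m / real m < L + e / 2"
      using cInf_lessD[OF ne] unfolding S_def by auto
    define B where "B = Max (a ` {..<m})"
    have B: "a r \<le> B" if "r < m" for r unfolding B_def using that by (intro Max_ge) auto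
    have B0: "0 \<le> B" using B[of 0] nonneg[of 0] m by force
    obtain N where N: "B / (e / 2) < real N" using reals_Archimedean2 by blast
    show "\<exists>no. \<forall>n\<ge>no. norm (a n / real n - L) < e"
    proof (intro exI allI impI)
      fix n assume n: "max N 1 \<le> n"
      then have n0: "0 < real n" by auto
      have "a n = a ((n div m) * m + n mod m)" by simp
      also have "\<dots> \<le> real (n div m) * a m + a (n mod m)" by (rule subadditive_mult[OF sub])
      also have "\<dots> \<le> real (n div m) * a m + B" using B[of "n mod m"] m by simp
      also have "real (n div m) * a m = (real (n div m) * real m) * (a m / real m)" using m by simp
      also have "\<dots> \<le> real n * (a m / real m)"
        using nonneg[of m] m 
        by (intro mult_right_mono) (auto simp flip: of_nat_mult)
      finally have "a n / real n \<le> a m / real m + B / real n" using n0 by (simp add: field_simps)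
      moreover have "B / real n < e / 2"
      proof -
        have "B / (e / 2) < real n" using N n by linarith
        then show ?thesis using n0 e by (simp add: field_simps)
      qed
      ultimately have "a n / real n < L + e" using m by linarith
      then show "norm (a n / real n - L) < e" using le[of n] n by auto
    qed
  qed
  then show ?thesis using that L0 le' by blast
qed

lemma attached_unique: "attached d \<beta> \<Longrightarrow> attached d \<beta>' \<Longrightarrow> \<beta> = \<beta>'"
  unfolding attached_def using LIMSEQ_unique ln_inj_iff by blast

lemma attached_the: "attached d \<beta> \<Longrightarrow> (THE \<beta>. attached d \<beta>) = \<beta>"
  using attached_unique by blast

text \<open>The logarithms of the submultiplicative counts are subadditive. The infimum form of the
  limit bounds the counts from below by \<open>\<beta> ^ n\<close> without a constant factor, and
  this is what later makes the kneading series vanish at \<open>1 / \<beta>\<close>.\<close>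

lemma attached_exists:
  assumes "nonneg_lyndon d"
  obtains \<beta> where "attached d \<beta>" "1 \<le> \<beta>" "\<And>n. \<beta> ^ n \<le> real (Hcount d n)"
proof -
  have pos: "1 \<le> real (Hcount d n)" for n using Hcount_pos[OF assms, of n] by simp
  have sub: "ln (real (Hcount d (m + n))) \<le> ln (real (Hcount d m)) + ln (real (Hcount d n))" for m n
  proof -
    have "real (Hcount d (m + n)) \<le> real (Hcount d m) * real (Hcount d n)"
      using Hcount_submult[of d m n] by (simp flip: of_nat_mult)
    then have "ln (real (Hcount d (m + n))) \<le> ln (real (Hcount d m) * real (Hcount d n))"
      using pos[of "m + n"] by (intro ln_mono) auto
    also have "\<dots> = ln (real (Hcount d m)) + ln (real (Hcount d n))"
      using Hcount_pos[OF assms, of m] Hcount_pos[OF assms, of n] by (simp add: ln_mult)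
    finally show ?thesis .
  qed
  have nn: "0 \<le> ln (real (Hcount d n))" for n using pos[of n] by simp
  obtain L where L: "0 \<le> L" "(\<lambda>n. ln (real (Hcount d n)) / real n) \<longlonglongrightarrow> L"
    "\<And>n. real n * L \<le> ln (real (Hcount d n))"
    using fekete[of "\<lambda>n. ln (real (Hcount d n))", OF sub nn] by blast
  have "exp L ^ n \<le> real (Hcount d n)" for n
  proof -
    have "exp L ^ n = exp (real n * L)" by (simp add: exp_of_nat_mult)
    also have "\<dots> \<le> exp (ln (real (Hcount d n)))" using L(3)[of n] by simp
    also have "\<dots> = real (Hcount d n)" using Hcount_pos[OF assms, of n] by simp
    finally show ?thesis .
  qed
  then show ?thesis using that[of "exp L"] L by (auto simp: attached_def)
qed

lemma attached_lower:
  assumes "nonneg_lyndon d" "attached d \<beta>"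
  shows "1 \<le> \<beta>" "\<beta> ^ n \<le> real (Hcount d n)"
  using attached_exists[OF assms(1)] attached_unique[OF assms(2)] by metis+

lemma summable_Hcount:
  assumes "nonneg_lyndon d" "attached d \<beta>" "0 < z" "z < 1 / \<beta>"
  shows "summable (\<lambda>n. real (Hcount d n) * z ^ n)"
proof -
  have b: "1 \<le> \<beta>" using attached_lower[OF assms(1,2)] by simp
  have "\<beta> < 1 / z" using assms b by (simp add: field_simps)
  then obtain q where q: "\<beta> < q" "q < 1 / z" using dense by blast
  have q0: "0 < q" using q b by linarith
  have lim: "(\<lambda>n. ln (real (Hcount d n)) / real n) \<longlonglongrightarrow> ln \<beta>"
    using assms(2) by (simp add: attached_def)
  have "ln \<beta> < ln q" using q b by simp
  then have "\<forall>\<^sub>F n in sequentially. ln (real (Hcount d n)) / real n < ln q"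
    using order_tendstoD(2)[OF lim] by blast
  then obtain N where N: "\<And>n. N \<le> n \<Longrightarrow> ln (real (Hcount d n)) / real n < ln q"
    unfolding eventually_sequentially by blast
  show ?thesis
  proof (rule summable_comparison_test'[of "\<lambda>n. (q * z) ^ n" "max N 1"])
    show "summable (\<lambda>n. (q * z) ^ n)"
      using q q0 assms by (intro summable_geometric) (simp add: field_simps abs_mult)
    fix n assume n: "max N 1 \<le> n"
    then have "ln (real (Hcount d n)) < real n * ln q"
      using N[of n] by (simp add: field_simps)
    also have "\<dots> = ln (q ^ n)" using q0 by (simp add: ln_realpow)
    finally have "real (Hcount d n) < q ^ n"
      using q0 Hcount_pos[OF assms(1), of n] by (subst (asm) ln_less_cancel_iff) auto
    then have "real (Hcount d n) * z ^ n \<le> q ^ n * z ^ n"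
      using assms by (intro mult_right_mono) auto
    then show "norm (real (Hcount d n) * z ^ n) \<le> (q * z) ^ n"
      using assms by (simp add: power_mult_distrib)
  qed
qed

text \<open>Summing \<open>card_above_Suc\<close> against powers of \<open>z\<close> gives a
  recursion for \<open>C b y\<close> in terms of \<open>C (\<not> b) (shiftw y 1)\<close>. Adding
  \<open>H * (wval z y - 1)\<close> removes the terms with \<open>H\<close>, and subtracting
  \<open>\<kappa> b\<close> removes the constants. The remaining \<open>Z\<close> is multiplied by
  \<open>- z\<close> under each shift; being bounded, it vanishes.\<close>

lemma above_generating_function:
  assumes d: "nonneg_lyndon d" "attached d \<beta>" and z: "0 < z" "z < 1 / \<beta>" and x: "x \<in> alt_system d"
  shows "(\<Sum>n. real (card (above True d x n)) * z ^ n)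
    = 1 / (1 - z\<^sup>2) - (\<Sum>n. real (Hcount d n) * z ^ n) * (wval z x - 1)"
proof -
  have b: "1 \<le> \<beta>" using attached_lower[OF d] by simp
  have z1: "z < 1"
  proof -
    have "1 / \<beta> \<le> 1" using b by simp
    then show ?thesis using z by linarith
  qed
  have zz: "z\<^sup>2 < 1" using z z1 by (simp add: abs_square_less_1)
  define H where "H = (\<Sum>n. real (Hcount d n) * z ^ n)"
  have sH: "summable (\<lambda>n. real (Hcount d n) * z ^ n)" by (rule summable_Hcount[OF d z])
  define C where "C b y = (\<Sum>n. real (card (above b d y n)) * z ^ n)" for b y
  have cle: "real (card (above b d y n)) * z ^ n \<le> real (Hcount d n) * z ^ n" for b y n
    using card_above_le z by (intro mult_right_mono) auto
  have sC: "summable (\<lambda>n. real (card (above b d y n)) * z ^ n)" for b y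
    by (rule summable_comparison_test'[OF sH, of 0]) (use cle z in auto)
  have C0: "0 \<le> C b y" for b y unfolding C_def using z by (intro suminf_nonneg sC) auto
  have CH: "C b y \<le> H" for b y unfolding C_def H_def using cle by (intro suminf_le sC sH) auto
  have a0: "real (card (above b d y 0)) = of_bool b" if "y \<in> alt_system d" for b y
  proof -
    have f: "factors d 0 = {[]}" using that by (auto simp: factors_def)
    have "{w \<in> {[]}. \<not> lless w []} = {[]}" "{w \<in> {[]}. lless [] w} = {}" by fastforce+
    then show ?thesis unfolding above_def f by (cases b) (simp_all only: pref_0 if_True if_False, simp_all)
  qed
  have Crec: "C b y = of_bool b + z * (of_int (y 0) + 1) * H - z * C (\<not> b) (shiftw y 1)"
    if y: "y \<in> alt_system d" for b y
  proof -
    have "C b y = (\<Sum>n. real (card (above b d y (Suc n))) * z ^ Suc n) + real (card (above b d y 0))"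
      unfolding C_def using suminf_split_head[OF sC[of b y]] by simp
    also have "(\<Sum>n. real (card (above b d y (Suc n))) * z ^ Suc n) =
      (\<Sum>n. (z * (of_int (y 0) + 1)) * (real (Hcount d n) * z ^ n)
         - z * (real (card (above (\<not> b) d (shiftw y 1) n)) * z ^ n))"
      by (intro suminf_cong) (simp only: card_above_Suc[OF y], simp add: algebra_simps)
    also have "\<dots> = (\<Sum>n. (z * (of_int (y 0) + 1)) * (real (Hcount d n) * z ^ n))
         - (\<Sum>n. z * (real (card (above (\<not> b) d (shiftw y 1) n)) * z ^ n))"
      by (intro suminf_diff[symmetric] summable_mult sC sH)
    also have "\<dots> = (z * (of_int (y 0) + 1)) * H - z * C (\<not> b) (shiftw y 1)"
      unfolding H_def C_def by (simp only: suminf_mult[OF sC] suminf_mult[OF sH])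
    finally show ?thesis using a0[OF y] by simp
  qed
  \<comment> \<open>The solution of
    \<open>\<kappa> b = of_bool b - z * \<kappa> (\<not> b)\<close>.\<close>
  define \<kappa> where "\<kappa> b = (if b then 1 else - z) / (1 - z\<^sup>2)" for b
  have kap: "of_bool b - \<kappa> b - z * \<kappa> (\<not> b) = 0" for b
  proof -
    have "1 - z\<^sup>2 \<noteq> 0" using zz by simp
    then show ?thesis by (cases b) (simp_all add: \<kappa>_def divide_simps power2_eq_square)
  qed
  define Z where "Z b y = C b y + H * (wval z y - 1) - \<kappa> b" for b y
  have Zrec: "Z b y = - z * Z (\<not> b) (shiftw y 1)" if y: "y \<in> alt_system d" for b y
  proof -
    have "wval z y = 1 - z * (of_int (y 0) + wval z (shiftw y 1))"
      using wval_rec[OF bndw_alt_system[OF y]] z z1 by simp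
    then have "Z b y = - z * Z (\<not> b) (shiftw y 1) + (of_bool b - \<kappa> b - z * \<kappa> (\<not> b))"
      unfolding Z_def Crec[OF y, of b] by (simp only:) (simp add: algebra_simps)
    then show ?thesis using kap by simp
  qed
  define B where "B = H + H * (2 + (of_int (d 0) + 1) * z / (1 - z)) + 1 / (1 - z\<^sup>2)"
  have ZB: "\<bar>Z b y\<bar> \<le> B" if y: "y \<in> alt_system d" for b y
  proof -
    have "\<bar>y i\<bar> \<le> d 0" for i using alt_system_le[OF y, of i] alt_system_nonneg[OF y, of i] by simp
    then have "\<bar>wval z y\<bar> \<le> 1 + (of_int (d 0) + 1) * z / (1 - z)"
      using wval_bound[of y "d 0" z] z z1 by simp
    then have w: "\<bar>wval z y - 1\<bar> \<le> 2 + (of_int (d 0) + 1) * z / (1 - z)" by linarith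
    have "0 \<le> H" using C0 CH order_trans by blast
    then have "\<bar>H * (wval z y - 1)\<bar> \<le> H * (2 + (of_int (d 0) + 1) * z / (1 - z))"
      using w by (simp add: abs_mult mult_left_mono)
    moreover have "\<bar>C b y\<bar> \<le> H" using C0 CH by simp
    moreover have "\<bar>\<kappa> b\<bar> \<le> 1 / (1 - z\<^sup>2)"
      using zz z z1 by (auto simp: \<kappa>_def divide_right_mono)
    ultimately show ?thesis unfolding Z_def B_def by linarith
  qed
  have Zn: "\<bar>Z b y\<bar> \<le> z ^ n * B" if "y \<in> alt_system d" for b y n
    using that
  proof (induction n arbitrary: b y)
    case 0
    then show ?case using ZB by simp
  next
    case (Suc n)
    have "\<bar>Z (\<not> b) (shiftw y 1)\<bar> \<le> z ^ n * B" using Suc alt_system_shift by blast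
    then show ?case using Zrec[OF Suc.prems, of b] z by (simp add: abs_mult)
  qed
  have "(\<lambda>n. z ^ n * B) \<longlonglongrightarrow> 0 * B"
    using z z1 by (intro tendsto_intros LIMSEQ_power_zero) auto
  then have "\<bar>Z True x\<bar> \<le> 0"
    using Zn[OF x, of True] by (intro LIMSEQ_le_const) auto
  then show ?thesis unfolding Z_def C_def H_def \<kappa>_def by simp
qed

text \<open>For \<open>x = d\<close> every factor is counted, so
  \<open>H * wval z d = 1 / (1 - z\<^sup>2)\<close>, where \<open>H\<close> dominates the geometric
  series of \<open>\<beta> * z\<close>. For any other \<open>x\<close> the count is at most
  \<open>Hcount\<close>, which yields the comparison.\<close>

lemma wval_below_radius:
  assumes d: "nonneg_lyndon d" "attached d \<beta>" and z: "0 < z" "z < 1 / \<beta>"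
  shows "0 < wval z d" "wval z d \<le> (1 - \<beta> * z) / (1 - z\<^sup>2)"
    "x \<in> alt_system d \<Longrightarrow> wval z d \<le> wval z x"
proof -
  have b: "1 \<le> \<beta>" "\<And>n. \<beta> ^ n \<le> real (Hcount d n)" using attached_lower[OF d] by auto
  have z1: "z < 1"
  proof -
    have "1 / \<beta> \<le> 1" using b by simp
    then show ?thesis using z by linarith
  qed
  have zz: "z\<^sup>2 < 1" using z z1 by (simp add: abs_square_less_1)
  define H where "H = (\<Sum>n. real (Hcount d n) * z ^ n)"
  have sH: "summable (\<lambda>n. real (Hcount d n) * z ^ n)" by (rule summable_Hcount[OF d z])
  have bz: "0 < \<beta> * z" "\<beta> * z < 1" using b z by (auto simp: field_simps)
  have "(\<Sum>n. (\<beta> * z) ^ n) \<le> H" unfolding H_def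
  proof (rule suminf_le[OF _ _ sH])
    show "summable (\<lambda>n. (\<beta> * z) ^ n)" using bz by (intro summable_geometric) auto
  qed (use b z in \<open>auto simp: power_mult_distrib intro!: mult_right_mono\<close>)
  then have H: "1 / (1 - \<beta> * z) \<le> H" using bz by (simp add: suminf_geometric)
  then have H0: "0 < H" using bz by (smt (verit) divide_pos_pos)
  have dH: "H * wval z d = 1 / (1 - z\<^sup>2)"
    using above_generating_function[OF d z nonneg_lyndon_mem[OF d(1)]]
    unfolding above_self[OF d(1)] Hcount_factors[symmetric] H_def by (simp add: algebra_simps)
  have "0 < H * wval z d" unfolding dH using zz by simp
  then show "0 < wval z d" using H0 by (simp add: zero_less_mult_iff)
  have "wval z d = 1 / (1 - z\<^sup>2) * (1 / H)" unfolding dH[symmetric] using H0 by simp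
  also have "\<dots> \<le> 1 / (1 - z\<^sup>2) * (1 - \<beta> * z)"
    using H H0 bz zz by (intro mult_left_mono) (auto simp: field_simps)
  finally show "wval z d \<le> (1 - \<beta> * z) / (1 - z\<^sup>2)" by simp
  assume x: "x \<in> alt_system d"
  have "(\<Sum>n. real (card (above True d x n)) * z ^ n) \<le> H" unfolding H_def
  proof (rule suminf_le[OF _ _ sH])
    show le: "real (card (above True d x n)) * z ^ n \<le> real (Hcount d n) * z ^ n" for n
      using card_above_le z by (intro mult_right_mono) auto
    show "summable (\<lambda>n. real (card (above True d x n)) * z ^ n)"
      by (rule summable_comparison_test'[OF sH, of 0]) (use le z in auto)
  qed
  then have "H * wval z d \<le> H * wval z x"
    using above_generating_function[OF d z x] dH unfolding H_def[symmetric]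
    by (simp add: algebra_simps)
  then show "wval z d \<le> wval z x" using H0 by simp
qed

section \<open>The critical radius\<close>

lemma tendsto_wval_left:
  assumes "bndw x" "0 < R" "R < 1"
  shows "((\<lambda>z. wval z x) \<longlongrightarrow> wval R x) (at_left R)"
  using isCont_wval[of x R] assms unfolding isCont_def
  by (auto intro: filterlim_mono[OF _ order_refl at_le])

lemma eventually_at_left_interval:
  assumes "0 < (R::real)"
  shows "\<forall>\<^sub>F z in at_left R. 0 < z \<and> z < R"
  using assms unfolding eventually_at_left_field by (intro exI[of _ 0]) auto

text \<open>The bounds of \<open>wval_below_radius\<close> pass to the limit from the left;
  \<open>1 < \<beta>\<close> keeps the limit point inside the region where evaluation is
  continuous.\<close>

lemma wval_at_radius:
  assumes d: "nonneg_lyndon d" "attached d \<beta>" and "1 < \<beta>"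
  shows "wval (1 / \<beta>) d = 0" "x \<in> alt_system d \<Longrightarrow> 0 \<le> wval (1 / \<beta>) x"
proof -
  define R where "R = 1 / \<beta>"
  have R: "0 < R" "R < 1" "\<beta> * R = 1" using assms(3) by (auto simp: R_def)
  have RR: "1 - R\<^sup>2 \<noteq> 0" using R abs_square_eq_1[of R] by auto
  have ev: "\<forall>\<^sub>F z in at_left R. 0 < z \<and> z < 1 / \<beta>"
    using eventually_at_left_interval[OF R(1)] by (simp add: R_def)
  show ge: "0 \<le> wval (1 / \<beta>) x" if x: "x \<in> alt_system d" for x
    unfolding R_def[symmetric]
  proof (rule tendsto_lowerbound[OF tendsto_wval_left])
    show "\<forall>\<^sub>F z in at_left R. 0 \<le> wval z x"
      using ev
    proof eventually_elim
      case (elim z)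
      have "0 < wval z d" "wval z d \<le> wval z x"
        using wval_below_radius[OF d, of z] elim x by auto
      then show ?case by linarith
    qed
  qed (use bndw_alt_system[OF x] R in auto)
  have "wval R d \<le> (1 - \<beta> * R) / (1 - R\<^sup>2)"
  proof (rule tendsto_le[OF _ _ tendsto_wval_left])
    show "((\<lambda>z. (1 - \<beta> * z) / (1 - z\<^sup>2)) \<longlongrightarrow> (1 - \<beta> * R) / (1 - R\<^sup>2)) (at_left R)"
      by (intro tendsto_intros RR)
    show "\<forall>\<^sub>F z in at_left R. wval z d \<le> (1 - \<beta> * z) / (1 - z\<^sup>2)"
      using ev by eventually_elim (use wval_below_radius[OF d] in auto)
  qed (use bndw_alt_system[OF nonneg_lyndon_mem[OF d(1)]] R in auto)
  then show "wval (1 / \<beta>) d = 0"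
    using ge[OF nonneg_lyndon_mem[OF d(1)]] R by (simp add: R_def)
qed

section \<open>Order, values and separation on a system\<close>

lemma wval_le_one:
  assumes "x \<in> alt_system d" "0 < z" "z < 1" "0 \<le> wval z (shiftw x 1)"
  shows "wval z x \<le> 1"
proof -
  have "0 \<le> z * (of_int (x 0) + wval z (shiftw x 1))"
    using assms alt_system_nonneg[OF assms(1), of 0] by simp
  then show ?thesis using wval_rec[OF bndw_alt_system[OF assms(1)]] assms by simp
qed

text \<open>This serves for a \<open>z\<close> that is not yet tied to the entropy of
  \<open>d\<close>. If all values on the system are at least \<open>- c\<close>, comparison with
  \<open>d\<close> at the first difference improves the bound to \<open>- (z * c)\<close>; iteration
  leaves 0.\<close>

lemma wval_contraction:
  assumes d: "nonneg_lyndon d" and z: "0 < z" "z < 1"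
    and tails: "\<And>n. 0 \<le> wval z (shiftw d n)" "\<And>n. wval z (shiftw d n) \<le> 1"
    and x: "x \<in> alt_system d"
  shows "0 \<le> wval z x"
proof -
  define B where "B = 1 + (of_int (d 0) + 1) * z / (1 - z)"
  have bd: "bndw d" using bndw_alt_system[OF nonneg_lyndon_mem[OF d]] .
  have B: "- B \<le> wval z y" if "y \<in> alt_system d" for y
  proof -
    have "\<bar>y i\<bar> \<le> d 0" for i
      using alt_system_le[OF that, of i] alt_system_nonneg[OF that, of i] by simp
    then show ?thesis unfolding B_def using wval_bound[of y "d 0" z] z by fastforce
  qed
  have B0: "0 \<le> B" using B[OF nonneg_lyndon_mem[OF d]] tails(2)[of 0] z
    nonneg_lyndon_mem[OF d] alt_system_nonneg[of d d 0] unfolding B_def by simp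
  have step: "- (z * c) \<le> wval z y"
    if c: "0 \<le> c" "\<And>y. y \<in> alt_system d \<Longrightarrow> - c \<le> wval z y" and y: "y \<in> alt_system d" for c y
  proof (cases "y = d")
    case True
    then show ?thesis using tails(1)[of 0] c z by (auto intro: order_trans[of _ 0])
  next
    case False
    then obtain j where j: "\<And>i. i < j \<Longrightarrow> d i = y i" "d j \<noteq> y j"
      by (metis first_difference)
    let ?y = "wval z (shiftw y (Suc j))" and ?d = "wval z (shiftw d (Suc j))"
    have yb: "bndw y" using bndw_alt_system[OF y] .
    have ge: "- c \<le> wval z (shiftw y n)" for n using c(2) alt_system_shift[OF y] by blast
    have up: "?y \<le> 1 + c"
    proof -
      have "?y = 1 - z * (of_int (y (Suc j)) + wval z (shiftw y (Suc (Suc j))))"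
        using wval_rec[of "shiftw y (Suc j)" z] yb z by simp
      moreover have "- c \<le> of_int (y (Suc j)) + wval z (shiftw y (Suc (Suc j)))"
        using ge[of "Suc (Suc j)"] alt_system_nonneg[OF y, of "Suc j"] by linarith
      then have "z * (- c) \<le> z * (of_int (y (Suc j)) + wval z (shiftw y (Suc (Suc j))))"
        using z by (intro mult_left_mono) auto
      moreover have "z * c \<le> c" using z c by (simp add: mult_left_le_one_le)
      ultimately show ?thesis by simp
    qed
    have diff: "wval z y - wval z d = (- z) ^ Suc j * ((of_int (y j) + ?y) - (of_int (d j) + ?d))"
      using wval_diff[of y d z j] yb bd z j by auto
    have zj: "0 \<le> z ^ Suc j" "z ^ Suc j \<le> z" using z by (auto simp: mult_left_le power_le_one)
    have "- c \<le> (- 1) ^ Suc j * ((of_int (y j) + ?y) - (of_int (d j) + ?d))"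
    proof (cases "even j")
      case True
      then have "y j \<le> d j - 1" using altle_at[OF alt_system_ge0[OF y], of j] j by auto
      then have "real_of_int (y j) \<le> of_int (d j) - 1" by linarith
      then show ?thesis using True up tails(1)[of "Suc j"] by simp
    next
      case False
      then have "d j + 1 \<le> y j" using altle_at[OF alt_system_ge0[OF y], of j] j by auto
      then have "real_of_int (d j) + 1 \<le> of_int (y j)" by linarith
      then show ?thesis using False ge[of "Suc j"] tails(2)[of "Suc j"] by simp
    qed
    then have "z ^ Suc j * (- c) \<le> z ^ Suc j * ((- 1) ^ Suc j * ((of_int (y j) + ?y) - (of_int (d j) + ?d)))"
      using zj by (intro mult_left_mono) auto
    also have "\<dots> = wval z y - wval z d"
      unfolding diff by (subst (2) power_minus) (simp add: mult_ac)
    finally have "z ^ Suc j * (- c) \<le> wval z y" using tails(1)[of 0] by simp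
    moreover have "z ^ Suc j * c \<le> z * c" using zj c by (intro mult_right_mono) auto
    ultimately show ?thesis by simp
  qed
  have n: "- (z ^ n * B) \<le> wval z y" if "y \<in> alt_system d" for n y
    using that
  proof (induction n arbitrary: y)
    case 0
    then show ?case using B by simp
  next
    case (Suc n)
    then show ?case using step[of "z ^ n * B" y] B0 z by (simp add: mult_ac)
  qed
  have "(\<lambda>n. - (z ^ n * B)) \<longlonglongrightarrow> - (0 * B)"
    using z by (intro tendsto_intros LIMSEQ_power_zero) auto
  then have "- (0 * B) \<le> wval z x"
    using n[OF x] by (intro LIMSEQ_le_const2) auto
  then show ?thesis by simp
qed

text \<open>A letter gap of at least one cannot be undone by two tail values in
  \<open>[0, 1]\<close>.\<close>

lemma wval_mono:
  assumes z: "0 < z" "z < 1" and b: "bndw x" "bndw y"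
    and x: "\<And>n. 0 \<le> wval z (shiftw x n)" "\<And>n. wval z (shiftw x n) \<le> 1"
    and y: "\<And>n. 0 \<le> wval z (shiftw y n)" "\<And>n. wval z (shiftw y n) \<le> 1"
    and less: "altle x y"
  shows "wval z x \<le> wval z y"
proof (cases "x = y")
  case False
  then obtain j where j: "\<And>i. i < j \<Longrightarrow> x i = y i" "x j \<noteq> y j"
    by (metis first_difference)
  let ?y = "wval z (shiftw y (Suc j))" and ?x = "wval z (shiftw x (Suc j))"
  have diff: "wval z y - wval z x = (- z) ^ Suc j * ((of_int (y j) + ?y) - (of_int (x j) + ?x))"
    using wval_diff[of y x z j] b z j by auto
  have "0 \<le> (- 1) ^ Suc j * ((of_int (y j) + ?y) - (of_int (x j) + ?x))"
  proof (cases "even j")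
    case True
    then have "y j \<le> x j - 1" using altle_at[OF less, of j] j by auto
    then have "real_of_int (y j) \<le> of_int (x j) - 1" by linarith
    then show ?thesis using True y(2)[of "Suc j"] x(1)[of "Suc j"] by simp
  next
    case False
    then have "x j + 1 \<le> y j" using altle_at[OF less, of j] j by auto
    then have "real_of_int (x j) + 1 \<le> of_int (y j)" by linarith
    then show ?thesis using False y(1)[of "Suc j"] x(2)[of "Suc j"] by simp
  qed
  then have "0 \<le> z ^ Suc j * ((- 1) ^ Suc j * ((of_int (y j) + ?y) - (of_int (x j) + ?x)))"
    using z by (intro mult_nonneg_nonneg[of "z ^ Suc j"]) auto
  also have "\<dots> = wval z y - wval z x"
    unfolding diff by (subst (2) power_minus) (simp add: mult_ac)
  finally show ?thesis by simp
qed simp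

text \<open>Distinct factors then have \<^term>\<open>z ^ n * \<delta>\<close>-separated values in \<open>[0, 1]\<close>.\<close>

lemma radius_ge_if_gap:
  assumes c: "nonneg_lyndon c" "attached c \<beta>" and z: "0 < z" "z < 1" and \<delta>: "0 < \<delta>"
    and gap: "\<And>x. x \<in> alt_system c \<Longrightarrow> \<delta> \<le> wval z x"
  shows "\<beta> \<le> 1 / z"
proof (rule ccontr)
  assume "\<not> \<beta> \<le> 1 / z"
  then have bz: "1 < \<beta> * z" using z by (simp add: field_simps)
  have up: "wval z x \<le> 1" if "x \<in> alt_system c" for x
    using wval_le_one[OF that z] gap[OF alt_system_shift[OF that], of 1] \<delta> by linarith
  have card: "real (Hcount c n) \<le> (1 / \<delta> + 1) * (1 / z) ^ n" for n
  proof -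
    define \<eta> where "\<eta> = z ^ n * \<delta>"
    have eta: "0 < \<eta>" using z \<delta> by (simp add: \<eta>_def)
    obtain r where r: "\<And>w. w \<in> factors c n \<Longrightarrow> r w \<in> alt_system c \<and> pref (r w) n = w"
      unfolding factors_def by (metis (mono_tags, lifting) image_iff)
    have sep: "\<eta> \<le> \<bar>wval z (r v) - wval z (r w)\<bar>"
      if v: "v \<in> factors c n" and w: "w \<in> factors c n" and ne: "v \<noteq> w" for v w
    proof -
      let ?x = "r v" and ?y = "r w"
      have "?x \<noteq> ?y" using r[OF v] r[OF w] ne by metis
      then obtain j where j: "\<And>i. i < j \<Longrightarrow> ?x i = ?y i" "?x j \<noteq> ?y j"
        by (metis first_difference)
      have jn: "j < n"
        using j r[OF v] r[OF w] ne pref_eq_iff[of ?x n ?y] by (metis not_less order.strict_trans2)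
      let ?a = "wval z (shiftw ?x (Suc j))" and ?b = "wval z (shiftw ?y (Suc j))"
      have ab: "\<delta> \<le> ?a" "\<delta> \<le> ?b" using gap alt_system_shift r[OF v] r[OF w] by blast+
      \<comment> \<open>The bound \<open>\<delta>\<close> for the next tail pushes each tail value
        below 1 as well. Two tail values are then less than \<open>1 - \<delta>\<close> apart, so
        different letters leave a distance of at least \<open>\<delta>\<close>.\<close>
      have up': "wval z (shiftw x (Suc j)) \<le> 1 - z * \<delta>" if x: "x \<in> alt_system c" for x
      proof -
        have "\<delta> \<le> of_int (x (Suc j)) + wval z (shiftw x (Suc (Suc j)))"
          using gap[OF alt_system_shift[OF x], of "Suc (Suc j)"] alt_system_nonneg[OF x, of "Suc j"]
          by linarith
        then have "z * \<delta> \<le> z * (of_int (x (Suc j)) + wval z (shiftw x (Suc (Suc j))))"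
          using z by (intro mult_left_mono) auto
        then show ?thesis using wval_rec[of "shiftw x (Suc j)" z] bndw_alt_system[OF x] z by simp
      qed
      have ab': "?a \<le> 1 - z * \<delta>" "?b \<le> 1 - z * \<delta>" using up' r[OF v] r[OF w] by blast+
      have "1 \<le> \<bar>real_of_int (?x j) - of_int (?y j)\<bar>" using j(2) by linarith
      then have "\<delta> \<le> \<bar>(of_int (?x j) + ?a) - (of_int (?y j) + ?b)\<bar>"
        using ab ab' z \<delta> mult_pos_pos[of z \<delta>] by linarith
      then have "z ^ Suc j * \<delta> \<le> z ^ Suc j * \<bar>(of_int (?x j) + ?a) - (of_int (?y j) + ?b)\<bar>"
        using z by (intro mult_left_mono) auto
      also have "\<dots> = \<bar>wval z ?x - wval z ?y\<bar>"
      proof -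
        have "bndw ?x" "bndw ?y" using bndw_alt_system r[OF v] r[OF w] by blast+
        then have "wval z ?x - wval z ?y = (- z) ^ Suc j *
            ((of_int (?x j) + ?a) - (of_int (?y j) + ?b))"
          using wval_diff[of ?x ?y z j] j z by simp
        then show ?thesis using z by (simp only: abs_mult power_abs abs_minus_cancel abs_of_pos)
      qed
      finally have "z ^ Suc j * \<delta> \<le> \<bar>wval z ?x - wval z ?y\<bar>" .
      moreover have "z ^ n \<le> z ^ Suc j" using z jn by (intro power_decreasing) auto
      then have "\<eta> \<le> z ^ Suc j * \<delta>" unfolding \<eta>_def using \<delta> by (intro mult_right_mono) auto
      ultimately show ?thesis by linarith
    qed
    \<comment> \<open>Cells of width \<open>\<eta>\<close> hold at most one representative each, so
      counting cells bounds the number of factors.\<close>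
    define f where "f w = nat \<lfloor>wval z (r w) / \<eta>\<rfloor>" for w
    have nn: "0 \<le> wval z (r w) / \<eta>" if "w \<in> factors c n" for w
    proof -
      have "\<delta> \<le> wval z (r w)" using gap r[OF that] by blast
      then show ?thesis using \<delta> eta by simp
    qed
    have "inj_on f (factors c n)"
    proof (rule inj_onI, rule ccontr)
      fix v w assume v: "v \<in> factors c n" and w: "w \<in> factors c n" and e: "f v = f w" and ne: "v \<noteq> w"
      have "\<lfloor>wval z (r v) / \<eta>\<rfloor> = \<lfloor>wval z (r w) / \<eta>\<rfloor>"
        using e nn[OF v] nn[OF w] unfolding f_def by (simp add: nat_eq_iff2)
      then have "\<bar>wval z (r v) / \<eta> - wval z (r w) / \<eta>\<bar> < 1" by linarith
      then have "\<bar>wval z (r v) - wval z (r w)\<bar> < \<eta>"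
        using eta by (simp add: abs_less_iff field_simps)
      then show False using sep[OF v w ne] by simp
    qed
    moreover have "f ` factors c n \<subseteq> {..nat \<lfloor>1 / \<eta>\<rfloor>}"
    proof
      fix m assume "m \<in> f ` factors c n"
      then obtain w where w: "w \<in> factors c n" "m = f w" by auto
      have "wval z (r w) / \<eta> \<le> 1 / \<eta>" using up r[OF w(1)] eta by (simp add: divide_right_mono)
      then show "m \<in> {..nat \<lfloor>1 / \<eta>\<rfloor>}" unfolding w f_def by (auto intro!: nat_mono floor_mono)
    qed
    ultimately have "card (factors c n) \<le> card {..nat \<lfloor>1 / \<eta>\<rfloor>}"
      by (intro card_inj_on_le) auto
    then have "real (Hcount c n) \<le> real (nat \<lfloor>1 / \<eta>\<rfloor>) + 1" by (simp add: Hcount_factors)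
    also have "real (nat \<lfloor>1 / \<eta>\<rfloor>) \<le> 1 / \<eta>" using eta by simp
    finally have "real (Hcount c n) \<le> 1 / \<eta> + 1" by simp
    moreover have "1 / \<eta> = 1 / \<delta> * (1 / z) ^ n" by (simp add: \<eta>_def power_divide)
    moreover have "1 \<le> (1 / z) ^ n" using z by (intro one_le_power) auto
    ultimately show ?thesis by (simp add: algebra_simps)
  qed
  have "(\<beta> * z) ^ n \<le> 1 / \<delta> + 1" for n
  proof -
    have "\<beta> ^ n * z ^ n \<le> ((1 / \<delta> + 1) * (1 / z) ^ n) * z ^ n"
      using attached_lower(2)[OF c, of n] card[of n] z by (intro mult_right_mono) auto
    then show ?thesis using z by (simp add: power_mult_distrib power_divide)
  qed
  moreover obtain n where "1 / \<delta> + 1 < (\<beta> * z) ^ n"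
    using real_arch_pow[OF bz] by blast
  ultimately show False by (meson not_less)
qed


section \<open>The substitution and the critical word\<close>

lemma length_phi_letter: "length (phi_letter c) = (if c = 0 then 1 else 3)"
  by (simp add: phi_letter_def)

lemma phi_Nil [simp]: "phi [] = []"
  and phi_Cons: "phi (c # w) = phi_letter c @ phi w"
  and phi_append: "phi (v @ w) = phi v @ phi w"
  by (simp_all add: phi_def)

lemma length_phi_ge: "length w \<le> length (phi w)"
  by (induction w) (auto simp: phi_Cons length_phi_letter)

lemma pref_add: "pref x (m + n) = pref x m @ pref (shiftw x m) n"
  by (rule nth_equalityI) (auto simp: nth_append)

text \<open>The substitution on infinite words. No letter has an empty image, so the first
  \<open>Suc i\<close> letters of \<open>x\<close> determine letter \<open>i\<close> of the
  image.\<close>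

definition phiw :: "(nat \<Rightarrow> int) \<Rightarrow> (nat \<Rightarrow> int)" where
  "phiw x i = phi (pref x (Suc i)) ! i"

lemma phiw_nth:
  assumes "i < length (phi (pref x n))"
  shows "phiw x i = phi (pref x n) ! i"
proof -
  have i: "i < length (phi (pref x (Suc i)))" using length_phi_ge[of "pref x (Suc i)"] by simp
  show ?thesis
  proof (cases "n \<le> Suc i")
    case True
    then obtain m where "Suc i = n + m" using le_Suc_ex by blast
    then show ?thesis using assms by (simp add: phiw_def pref_add phi_append nth_append)
  next
    case False
    then obtain m where "n = Suc i + m" using le_Suc_ex[of "Suc i" n] by auto
    then show ?thesis using i by (simp only: phiw_def pref_add phi_append nth_append) simp
  qed
qed

lemma phiw_split: "phiw x = appw (phi (pref x n)) (phiw (shiftw x n))"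
proof
  fix i
  let ?l = "length (phi (pref x n))"
  show "phiw x i = appw (phi (pref x n)) (phiw (shiftw x n)) i"
  proof (cases "i < ?l")
    case True
    then show ?thesis by (simp add: appw_nth phiw_nth)
  next
    case False
    let ?m = "Suc (i - ?l)"
    have m: "i - ?l < length (phi (pref (shiftw x n) ?m))"
      using length_phi_ge[of "pref (shiftw x n) ?m"] by simp
    then have "i < length (phi (pref x (n + ?m)))" using False by (simp only: pref_add phi_append length_append)
    from phiw_nth[OF this]
    have "phiw x i = (phi (pref x n) @ phi (pref (shiftw x n) ?m)) ! i" by (simp only: pref_add phi_append)
    also have "\<dots> = phiw (shiftw x n) (i - ?l)" using False by (simp add: nth_append phiw_def)
    finally show ?thesis using False by (simp add: appw_def)
  qed
qed

lemma phiw_appw: "phiw (appw w x) = appw (phi w) (phiw x)"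
  using phiw_split[of "appw w x" "length w"] by simp

lemma phiw_unfold: "phiw x = appw (phi_letter (x 0)) (phiw (shiftw x 1))"
  using phiw_split[of x 1] by (simp add: pref_Suc phi_Cons)

lemma shiftw_phiw: "shiftw (phiw x) (length (phi (pref x m))) = phiw (shiftw x m)"
  using phiw_split[of x m] by (metis shiftw_appw_length)

lemma pref_phiw: "pref (phiw x) (length (phi (pref x m))) = phi (pref x m)"
  using phiw_split[of x m] by (metis pref_appw)

lemma phiw_0 [simp]: "phiw x 0 = 1"
  by (subst phiw_unfold) (simp add: appw_def phi_letter_def)

lemma phiw_1: "phiw x (Suc 0) = (if x 0 = 0 then 1 else 0)"
  by (subst phiw_unfold) (simp add: appw_def phi_letter_def)

lemma phiw_23: "x 0 \<noteq> 0 \<Longrightarrow> phiw x 2 = 0" "x 0 \<noteq> 0 \<Longrightarrow> phiw x 3 = 1"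
  by (subst phiw_unfold, simp add: appw_def phi_letter_def)+

definition binw :: "(nat \<Rightarrow> int) \<Rightarrow> bool" where
  "binw x \<longleftrightarrow> (\<forall>i. x i = 0 \<or> x i = 1)"

lemma binw_nonneg: "binw x \<Longrightarrow> 0 \<le> x i"
  unfolding binw_def by (metis order_refl zero_le_one)

lemma binw_shiftw [simp]: "binw x \<Longrightarrow> binw (shiftw x n)"
  by (simp add: binw_def)

lemma set_phi: "set (phi w) \<subseteq> {0, 1}"
  by (auto simp: phi_def phi_letter_def split: if_splits)

lemma binw_phiw [simp]: "binw (phiw x)"
proof -
  have "phiw x i \<in> set (phi (pref x (Suc i)))" for i
    using length_phi_ge[of "pref x (Suc i)"] by (simp add: phiw_def)
  then show ?thesis using set_phi unfolding binw_def by blast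
qed

text \<open>Both images 1 and 100 have odd length, so block \<open>n\<close> starts at a position of
  the parity of \<open>n\<close>. At the first difference 100 meets 1 followed by the first letter 1
  of the next block, and the sign at that odd offset matches the order of the letters 1 and
  0.\<close>

lemma phiw_altless:
  assumes "binw x" "binw y" "altless x y"
  shows "altless (phiw x) (phiw y)"
proof -
  have "altless (phiw x) (phiw y)"
    if "binw x" "binw y" "\<forall>i<k. x i = y i" "if even k then y k < x k else x k < y k" for k x y
    using that
  proof (induction k arbitrary: x y)
    case 0
    then have "x 0 = 1" "y 0 = 0" unfolding binw_def by (metis even_zero less_irrefl zero_less_one less_asym')+
    then show ?case by (intro altlessI[of 1]) (auto simp: phiw_1)
  next
    case (Suc k)
    have "altless (phiw (shiftw y 1)) (phiw (shiftw x 1))"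
      using Suc.prems by (intro Suc.IH binw_shiftw) (auto split: if_splits)
    moreover have "x 0 = y 0" using Suc.prems by auto
    ultimately show ?case
      using altless_appw[of "phi_letter (x 0)" "phiw (shiftw x 1)" "phiw (shiftw y 1)"]
        phiw_unfold[of x] phiw_unfold[of y] by (simp add: length_phi_letter split: if_splits)
  qed
  then show ?thesis using assms unfolding altless_iff[of x y] by blast
qed

lemma phiw_altless_iff:
  assumes "binw x" "binw y"
  shows "altless (phiw x) (phiw y) \<longleftrightarrow> altless x y"
  using phiw_altless[OF assms] phiw_altless[OF assms(2,1)] altless_total[of x y]
    altless_trans altless_irrefl by metis

lemma phiw_inj: "binw x \<Longrightarrow> binw y \<Longrightarrow> phiw x = phiw y \<Longrightarrow> x = y"
  using phiw_altless[of x y] phiw_altless[of y x] altless_total[of x y] by auto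

lemma phiw_altle_iff:
  assumes "binw x" "binw y"
  shows "altle (phiw x) (phiw y) \<longleftrightarrow> altle x y"
  using phiw_altless_iff[OF assms] phiw_inj[OF assms] unfolding altle_def by blast

text \<open>Each image of a letter is nonzero only at its front, so a nonzero letter marks a cut
  between blocks.\<close>

lemma phiw_block_start:
  assumes "phiw x p \<noteq> 0"
  obtains m where "p = length (phi (pref x m))" "shiftw (phiw x) p = phiw (shiftw x m)"
proof -
  have "\<exists>m. p = length (phi (pref x m))"
    using assms
  proof (induction p arbitrary: x rule: less_induct)
    case (less p)
    let ?l = "length (phi_letter (x 0))"
    show ?case
    proof (cases "p < ?l")
      case True
      have "p = 0"
      proof (rule ccontr)
        assume "p \<noteq> 0"
        then have "phi_letter (x 0) ! p = 0"
          using True by (auto simp: phi_letter_def nth_Cons' split: if_splits)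
        then show False using less.prems True by (subst (asm) phiw_unfold) (simp add: appw_nth)
      qed
      then show ?thesis by (intro exI[of _ 0]) simp
    next
      case False
      then have "phiw x p = phiw (shiftw x 1) (p - ?l)" by (subst phiw_unfold) (simp add: appw_def)
      moreover have "p - ?l < p" using False by (auto simp: length_phi_letter split: if_splits)
      ultimately obtain m where "p - ?l = length (phi (pref (shiftw x 1) m))"
        using less.IH[of "p - ?l" "shiftw x 1"] less.prems by metis
      then have "p = length (phi (pref x (Suc m)))" using False by (simp add: pref_Suc phi_Cons)
      then show ?thesis by blast
    qed
  qed
  then show ?thesis using that shiftw_phiw by blast
qed

section \<open>Iterates of the substitution and the critical word\<close>

lemma phi_funpow_append: "(phi ^^ n) (v @ w) = (phi ^^ n) v @ (phi ^^ n) w"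
  by (induction n) (auto simp: phi_append)

lemma phi_funpow_one: "(phi ^^ Suc n) [1] = (phi ^^ n) [1] @ (phi ^^ n) [0] @ (phi ^^ n) [0]"
proof -
  have "(phi ^^ Suc n) [1] = (phi ^^ n) ([1] @ [0] @ [0])"
    by (simp add: funpow_swap1 phi_def phi_letter_def)
  then show ?thesis by (simp only: phi_funpow_append)
qed

lemma phi_funpow_zero: "(phi ^^ Suc n) [0] = (phi ^^ n) [1]"
  by (simp add: funpow_swap1 phi_def phi_letter_def)

text \<open>\<open>len0 n\<close> runs through the Jacobsthal numbers 1, 1, 3, 5, 11, 21, and so on;
  \<open>len1 n\<close> is the next one.\<close>

abbreviation len0 :: "nat \<Rightarrow> nat" where "len0 n \<equiv> length ((phi ^^ n) [0])"
abbreviation len1 :: "nat \<Rightarrow> nat" where "len1 n \<equiv> length ((phi ^^ n) [1])"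

lemma len0_Suc: "len0 (Suc n) = len1 n"
  by (simp only: phi_funpow_zero)

lemma len1_Suc: "len1 (Suc n) = len1 n + 2 * len0 n"
  by (simp only: phi_funpow_one) simp

lemma odd_lens: "odd (len0 n) \<and> odd (len1 n)"
proof (induction n)
  case (Suc n)
  then show ?case unfolding len0_Suc len1_Suc by simp
qed simp

lemma len0_pos: "0 < len0 n"
  using odd_lens[of n] by (metis even_zero gr0I)

lemma len1_ge: "Suc n \<le> len1 n"
proof (induction n)
  case (Suc n)
  then show ?case unfolding len1_Suc using len0_pos[of n] by linarith
qed simp

lemma len0_ge: "n \<le> len0 n"
  using len1_ge[of "n - 1"] len0_Suc[of "n - 1"] by (cases n) auto

lemma phi_funpow_prefix:
  assumes "n \<le> m"
  shows "\<exists>t. (phi ^^ m) [1] = (phi ^^ n) [1] @ t"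
  using assms
proof (induction m rule: dec_induct)
  case (step m)
  then show ?case unfolding phi_funpow_one by auto
qed simp

lemma phi_inf_nth:
  assumes "i < len1 n"
  shows "phi_inf i = (phi ^^ n) [1] ! i"
proof -
  have i: "i < len1 (Suc i)" using len1_ge[of "Suc i"] by linarith
  show ?thesis
  proof (cases "n \<le> Suc i")
    case True
    then show ?thesis unfolding phi_inf_def using phi_funpow_prefix[OF True] assms by (auto simp: nth_append simp del: funpow.simps)
  next
    case False
    then show ?thesis unfolding phi_inf_def using phi_funpow_prefix[of "Suc i" n] i by (auto simp: nth_append simp del: funpow.simps)
  qed
qed

lemma pref_phi_inf: "pref phi_inf (len1 n) = (phi ^^ n) [1]"
  by (rule nth_equalityI) (auto simp: phi_inf_nth)

lemma phiw_phi_inf [simp]: "phiw phi_inf = phi_inf"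
proof
  fix i
  have i: "i < len1 i" using len1_ge[of i] by simp
  have e: "phi (pref phi_inf (len1 i)) = (phi ^^ Suc i) [1]" by (simp add: pref_phi_inf)
  have "i < len1 (Suc i)" using i len1_Suc[of i] by linarith
  then show "phiw phi_inf i = phi_inf i"
    using phiw_nth[of i phi_inf "len1 i"] phi_inf_nth[of i "Suc i"] unfolding e by simp
qed

lemma binw_phi_inf [simp]: "binw phi_inf"
  using binw_phiw[of phi_inf] by simp

lemma phi_inf_start: "phi_inf 0 = 1" "phi_inf (Suc 0) = 0" "phi_inf 2 = 0" "phi_inf 3 = 1"
  using phiw_0[of phi_inf] phiw_1[of phi_inf] phiw_23[of phi_inf] by simp_all

text \<open>A tail starting with 0 exceeds \<open>phi_inf\<close>, which starts with 1. Any other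
  tail is the image under \<open>phiw\<close> of an earlier tail, and since \<open>phi_inf\<close>
  is its own image, induction applies.\<close>

lemma lyndon_phi_inf: "nonneg_lyndon phi_inf"
proof -
  have "altle phi_inf (shiftw phi_inf p)" for p
  proof (induction p rule: less_induct)
    case (less p)
    show ?case
    proof (cases "phi_inf p = 0")
      case True
      then show ?thesis by (subst altle_Cons_decomp) (simp add: phi_inf_start)
    next
      case False
      then obtain m where m: "p = length (phi (pref phi_inf m))" "shiftw phi_inf p = phiw (shiftw phi_inf m)"
        using phiw_block_start[of phi_inf p] by auto
      show ?thesis
      proof (cases m)
        case 0
        then show ?thesis using m by simp
      next
        case (Suc m')
        then have "m < p" unfolding m
          using length_phi_ge[of "pref (shiftw phi_inf 1) m'"]
          by (simp add: pref_Suc phi_Cons phi_inf_start length_phi_letter)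
        then have "altle (phiw phi_inf) (phiw (shiftw phi_inf m))"
          using less phiw_altle_iff[OF binw_phi_inf binw_shiftw[OF binw_phi_inf]] by blast
        then show ?thesis using m by simp
      qed
    qed
  qed
  then show ?thesis using binw_nonneg[OF binw_phi_inf] by (simp add: nonneg_lyndon_def alt_lyndon_def)
qed

fun phi_const :: "real \<Rightarrow> nat \<Rightarrow> real" where
  "phi_const z 0 = 1"
| "phi_const z (Suc n) = phi_const z n * (1 - z ^ len0 n)"

lemma phi_const_pos: "0 < z \<Longrightarrow> z < 1 \<Longrightarrow> 0 < phi_const z n"
proof (induction n)
  case (Suc n)
  have "z ^ len0 n < 1" using Suc.prems power_strict_decreasing[OF len0_pos[of n], of z] by simp
  then show ?case using Suc by simp
qed simp

text \<open>All lengths are odd, whence the minus signs. Splitting by \<open>phi_funpow_one\<close>,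
  the constant part becomes \<open>phi_const z (Suc n)\<close> minus \<open>z ^ len1 n\<close> times
  the same number, and \<open>len1 n = len0 (Suc n)\<close> makes this the next product.\<close>

lemma aff_phi_funpow:
  "aff z ((phi ^^ n) [0]) e = phi_const z n - z ^ len0 n * e"
  "aff z ((phi ^^ n) [1]) e = phi_const z (Suc n) - z ^ len1 n * e"
proof -
  have "(\<forall>e. aff z ((phi ^^ n) [0]) e = phi_const z n - z ^ len0 n * e)
    \<and> (\<forall>e. aff z ((phi ^^ n) [1]) e = phi_const z (Suc n) - z ^ len1 n * e)"
  proof (induction n)
    case 0
    then show ?case by (simp add: algebra_simps)
  next
    case (Suc n)
    have "aff z ((phi ^^ Suc n) [1]) e = phi_const z (Suc (Suc n)) - z ^ len1 (Suc n) * e" for e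
    proof -
      have "aff z ((phi ^^ Suc n) [1]) e
        = phi_const z (Suc n) - z ^ len1 n * (phi_const z n - z ^ len0 n * (phi_const z n - z ^ len0 n * e))"
        unfolding phi_funpow_one aff_append using Suc by simp
      also have "\<dots> = phi_const z (Suc (Suc n)) - z ^ len1 (Suc n) * e"
      proof -
        have "z ^ (len1 n + 2 * len0 n) = z ^ len1 n * (z ^ len0 n * z ^ len0 n)"
          by (simp add: power_add mult_2)
        then show ?thesis unfolding phi_const.simps len0_Suc len1_Suc by (simp add: algebra_simps)
      qed
      finally show ?thesis .
    qed
    moreover have "aff z ((phi ^^ Suc n) [0]) e = phi_const z (Suc n) - z ^ len0 (Suc n) * e" for e
      unfolding phi_funpow_zero using Suc by simp
    ultimately show ?case by blast
  qed
  then show "aff z ((phi ^^ n) [0]) e = phi_const z n - z ^ len0 n * e"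
    "aff z ((phi ^^ n) [1]) e = phi_const z (Suc n) - z ^ len1 n * e" by blast+
qed

text \<open>A zero \<open>R < 1\<close> of the kneading series would force the products
  \<^term>\<open>phi_const R (Suc n)\<close>, which decay at most like \<open>2\<^sup>-\<^sup>n\<close> eventually, below the
  doubly exponentially small \<^term>\<open>R ^ len1 n\<close>.\<close>

lemma attached_phi_inf:
  assumes "attached phi_inf \<beta>"
  shows "\<beta> = 1"
proof (rule ccontr)
  assume "\<beta> \<noteq> 1"
  then have b: "1 < \<beta>" using attached_lower(1)[OF lyndon_phi_inf assms] by simp
  define R where "R = 1 / \<beta>"
  have R: "0 < R" "R < 1" using b by (auto simp: R_def)
  \<comment> \<open>\<open>wval R phi_inf = 0\<close> is read as an equation for the prefix
    \<open>(phi ^^ n) [1]\<close>, whose tail has a value of at most 1.\<close>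
  have le: "phi_const R (Suc n) \<le> R ^ len1 n" for n
  proof -
    have mem: "shiftw phi_inf m \<in> alt_system phi_inf" for m
      using alt_system_shift nonneg_lyndon_mem[OF lyndon_phi_inf] by blast
    let ?e = "wval R (shiftw phi_inf (len1 n))"
    have "0 = aff R ((phi ^^ n) [1]) ?e"
      using wval_at_radius(1)[OF lyndon_phi_inf assms b]
        wval_split[of phi_inf R "len1 n"] bndw_alt_system[OF mem[of 0]] R
      by (simp add: pref_phi_inf R_def)
    then have "phi_const R (Suc n) = R ^ len1 n * ?e" by (simp add: aff_phi_funpow del: phi_const.simps)
    also have "\<dots> \<le> R ^ len1 n * 1"
    proof (intro mult_left_mono wval_le_one[OF mem R])
      show "0 \<le> wval R (shiftw (shiftw phi_inf (len1 n)) 1)"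
        using wval_at_radius(2)[OF lyndon_phi_inf assms b mem] by (simp add: R_def)
    qed (use R in auto)
    finally show ?thesis by simp
  qed
  obtain N where N: "R ^ N < 1 / 2" using real_arch_pow_inv[of "1 / 2" R] R by auto
  have half: "R ^ len0 n \<le> 1 / 2" if "N \<le> n" for n
  proof -
    have "R ^ len0 n \<le> R ^ N" using R len0_ge[of n] that by (intro power_decreasing) auto
    then show ?thesis using N by simp
  qed
  have low: "phi_const R (Suc N) * (1 / 2) ^ k \<le> phi_const R (Suc (N + k))" for k
  proof (induction k)
    case (Suc k)
    have "phi_const R (Suc N) * (1 / 2) ^ Suc k \<le> phi_const R (Suc (N + k)) * (1 / 2)"
      using Suc by simp
    also have "\<dots> \<le> phi_const R (Suc (N + k)) * (1 - R ^ len0 (Suc (N + k)))"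
      using half[of "Suc (N + k)"] phi_const_pos[OF R, of "Suc (N + k)"] by (intro mult_left_mono) auto
    finally show ?case by simp
  qed simp
  \<comment> \<open>Each step adds \<open>2 * len0 n\<close> to the exponent, hence a factor of at
    most 1/4, against a factor of at least 1/2 in \<open>low\<close>.\<close>
  have up: "R ^ len1 (N + k) \<le> (1 / 4) ^ k" for k
  proof (induction k)
    case 0
    then show ?case using R by (simp add: power_le_one)
  next
    case (Suc k)
    have "R ^ len1 (N + Suc k) = R ^ len1 (N + k) * (R ^ len0 (N + k) * R ^ len0 (N + k))"
      unfolding add_Suc_right len1_Suc by (simp add: power_add mult_2)
    also have "\<dots> \<le> (1 / 4) ^ k * ((1 / 2) * (1 / 2))"
      using Suc half[of "N + k"] R by (intro mult_mono) auto
    finally show ?case by simp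
  qed
  obtain k where k: "(1 / 2 :: real) ^ k < phi_const R (Suc N)"
    using real_arch_pow_inv[of "phi_const R (Suc N)" "1 / 2"] phi_const_pos[OF R, of "Suc N"] by auto
  have "phi_const R (Suc N) * (1 / 2) ^ k \<le> (1 / 4) ^ k"
    using low[of k] le[of "N + k"] up[of k] by linarith
  also have "(1 / 4 :: real) ^ k = (1 / 2) ^ k * (1 / 2) ^ k" by (simp flip: power_mult_distrib)
  finally show False using k by simp
qed

text \<open>The system of \<open>phi_inf\<close> has entropy 0, so every \<open>z < 1\<close> lies
  below its critical radius 1.\<close>

lemma wval_above_phi_inf:
  assumes "x \<in> alt_system phi_inf" "0 < z" "z < 1"
  shows "0 < wval z x"
proof -
  have "attached phi_inf 1"
    using attached_exists[OF lyndon_phi_inf] attached_phi_inf by metis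
  then have "0 < wval z phi_inf" "wval z phi_inf \<le> wval z x"
    using wval_below_radius[OF lyndon_phi_inf, of 1 z] assms by auto
  then show ?thesis by linarith
qed

text \<open>Otherwise \<open>d\<close> would belong to the system of \<open>phi_inf\<close>, on
  which evaluation is positive.\<close>

lemma altless_phi_inf_if_zero:
  assumes "nonneg_lyndon d" "0 < z" "z < 1" "wval z d = 0"
  shows "altless d phi_inf"
proof (rule ccontr)
  assume "\<not> altless d phi_inf"
  then have "d \<in> alt_system phi_inf"
    using alt_system_mono(1)[of d phi_inf] assms(1) by (simp add: not_altless nonneg_lyndon_def)
  then show False using wval_above_phi_inf assms by force
qed

text \<open>A 1 followed by 1 can only be the image of 0, and 100 followed by 1 only the image of 1,
  so the cuts can be read off one after the other.\<close>

lemma phiw_parse: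
  assumes x: "binw x" "x 0 = 1"
    and blocks: "\<And>p. x p = 1 \<Longrightarrow> x (p + 1) = 1 \<or> (x (p + 1) = 0 \<and> x (p + 2) = 0 \<and> x (p + 3) = 1)"
  obtains y where "binw y" "x = phiw y"
proof -
  define pos where "pos n = ((\<lambda>p. p + (if x (p + 1) = 1 then 1 else 3)) ^^ n) 0" for n
  have pos0: "pos 0 = 0" and posS: "pos (Suc n) = pos n + (if x (pos n + 1) = 1 then 1 else 3)" for n
    by (simp_all add: pos_def)
  define y where "y n = (if x (pos n + 1) = 1 then 0 else 1 :: int)" for n
  have one: "x (pos n) = 1" for n
  proof (induction n)
    case (Suc n)
    then show ?case using blocks[of "pos n"] by (auto simp: posS)
  qed (simp add: pos0 x)
  have eq: "x (i + pos n) = phiw (shiftw y n) i" for i n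
  proof (induction i arbitrary: n rule: less_induct)
    case (less i)
    let ?l = "length (phi_letter (y n))"
    have u: "phiw (shiftw y n) = appw (phi_letter (y n)) (phiw (shiftw y (Suc n)))"
      using phiw_unfold[of "shiftw y n"] by simp
    have l: "pos (Suc n) = pos n + ?l" by (simp add: posS y_def length_phi_letter)
    show ?case
    proof (cases "i < ?l")
      case True
      then have "phi_letter (y n) ! i = x (i + pos n)"
        using blocks[OF one[of n]] one[of n]
        by (auto simp: phi_letter_def y_def nth_Cons' numeral_eq_Suc less_Suc_eq split: if_splits)
      then show ?thesis using True unfolding u by (simp add: appw_nth)
    next
      case False
      then have "i - ?l < i" by (auto simp: length_phi_letter split: if_splits)
      have "x (i - ?l + pos (Suc n)) = phiw (shiftw y (Suc n)) (i - ?l)"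
        by (rule less[OF \<open>i - ?l < i\<close>])
      moreover have "i - ?l + pos (Suc n) = i + pos n" using False l by simp
      ultimately show ?thesis using False unfolding u by (simp only: appw_def if_False)
    qed
  qed
  have "x = phiw y" using eq[of _ 0] by (auto simp: pos0)
  moreover have "binw y" by (auto simp: binw_def y_def)
  ultimately show ?thesis using that by blast
qed

lemma lyndon_phiwD:
  assumes "binw y" "nonneg_lyndon (phiw y)"
  shows "nonneg_lyndon y"
proof -
  have "altle y (shiftw y m)" for m
  proof -
    have "altle (phiw y) (phiw (shiftw y m))"
      using assms(2) shiftw_phiw[of y m] unfolding nonneg_lyndon_def alt_lyndon_def by metis
    then show ?thesis using phiw_altle_iff assms(1) by simp
  qed
  then show ?thesis using binw_nonneg[OF assms(1)] by (simp add: nonneg_lyndon_def alt_lyndon_def)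
qed

text \<open>\<open>phi_inf\<close> starts with 1001. A binary \<open>d\<close> below it starts with
  101, 1000 or 1001; in the last case minimality of \<open>d\<close> forces 1 or 001 behind every
  letter 1, so \<open>d\<close> is an image under \<open>phiw\<close>, and its preimage differs from
  \<open>phi_inf\<close> at an earlier position.\<close>

lemma phi_inf_descent:
  assumes "nonneg_lyndon d" "altless d phi_inf"
  shows "2 \<le> d 0 \<or> (\<exists>n y. d = (phiw ^^ n) y \<and> binw y \<and> y 0 = 1 \<and> y 1 = 0 \<and>
    (y 2 = 1 \<or> y 2 = 0 \<and> y 3 = 0))"
proof -
  have "2 \<le> d 0 \<or> (\<exists>n y. d = (phiw ^^ n) y \<and> binw y \<and> y 0 = 1 \<and> y 1 = 0 \<and>
    (y 2 = 1 \<or> y 2 = 0 \<and> y 3 = 0))"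
    if "nonneg_lyndon d" "\<forall>i<k. d i = phi_inf i" "if even k then phi_inf k < d k else d k < phi_inf k" for k d
    using that
  proof (induction k arbitrary: d rule: less_induct)
    case (less k)
    have below: "altless d phi_inf" unfolding altless_iff using less.prems by blast
    have nn: "0 \<le> d i" for i using less.prems(1) by (simp add: nonneg_lyndon_def)
    have lyn: "altle d (shiftw d n)" for n
      using less.prems(1) by (simp add: nonneg_lyndon_def alt_lyndon_def)
    show ?case
    proof (cases "2 \<le> d 0")
      case False
      have d0: "d 0 = 1"
        using altless_Cons_decomp[of d phi_inf] below False by (auto simp: phi_inf_start)
      have le1: "d i \<le> 1" for i
        using altle_at[OF lyn[of i], of 0] d0 by simp
      have bin: "binw d" unfolding binw_def
      proof
        fix i show "d i = 0 \<or> d i = 1" using nn[of i] le1[of i] by linarith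
      qed
      have d1: "d 1 = 0"
      proof (rule ccontr)
        assume "d 1 \<noteq> 0"
        then have "d 1 = 1" using bin unfolding binw_def by blast
        then have "altless phi_inf d" by (intro altlessI[of 1]) (auto simp: phi_inf_start d0)
        then show False using below altless_trans altless_irrefl by blast
      qed
      show ?thesis
      proof (cases "d 2 = 1 \<or> d 2 = 0 \<and> d 3 = 0")
        case True
        then have "d = (phiw ^^ 0) d \<and> binw d \<and> d 0 = 1 \<and> d 1 = 0 \<and> (d 2 = 1 \<or> d 2 = 0 \<and> d 3 = 0)"
          using bin d0 d1 by simp
        then show ?thesis by blast
      next
        case f: False
        have d23: "d 2 = 0" "d 3 = 1" using f bin unfolding binw_def by blast+
        have blocks: "d (p + 1) = 1 \<or> (d (p + 1) = 0 \<and> d (p + 2) = 0 \<and> d (p + 3) = 1)" if "d p = 1" for p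
        proof (cases "d (p + 1) = 1")
          case False
          then have p1: "d (p + 1) = 0" using bin unfolding binw_def by blast
          have "d (2 + p) \<le> 0"
          proof -
            have "d i = shiftw d p i" if "i < 2" for i
            proof -
              have "i = 0 \<or> i = 1" using that by linarith
              then show ?thesis using \<open>d p = 1\<close> p1 d0 d1 by (auto simp: add.commute)
            qed
            then show ?thesis using altle_at[OF lyn[of p], of 2] d23 by simp
          qed
          then have p2: "d (2 + p) = 0" using nn by (metis antisym)
          have "1 \<le> d (3 + p)"
          proof -
            have "d i = shiftw d p i" if "i < 3" for i
            proof -
              have "i = 0 \<or> i = 1 \<or> i = 2" using that by linarith
              then show ?thesis using \<open>d p = 1\<close> p1 p2 d0 d1 d23 by (auto simp: add.commute)
            qed
            then show ?thesis using altle_at[OF lyn[of p], of 3] d23 by simp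
          qed
          then have "d (3 + p) = 1" using le1 by (metis antisym)
          then show ?thesis using p1 p2 by (simp add: add.commute)
        qed simp
        obtain y where y: "binw y" "d = phiw y" using phiw_parse[OF bin d0 blocks] by blast
        have ly: "nonneg_lyndon y" using lyndon_phiwD y less.prems(1) by blast
        have "altless y phi_inf"
          using below phiw_altless_iff[OF y(1) binw_phi_inf] y(2) by simp
        then obtain k' where k': "\<forall>i<k'. y i = phi_inf i" "if even k' then phi_inf k' < y k' else y k' < phi_inf k'"
          unfolding altless_iff by blast
        \<comment> \<open>Agreement of the preimages on \<open>k'\<close> letters gives agreement of
          the images on \<open>k'\<close> blocks, the first of which has three letters.\<close>
        have "k' < k"
        proof (cases k')
          case 0
          have "y 0 \<noteq> 0" using d1 phiw_1[of y] y(2) by auto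
          then have "y 0 = 1" using y(1) unfolding binw_def by blast
          then show ?thesis using k'(2) 0 by (simp add: phi_inf_start)
        next
          case (Suc m)
          have pe: "pref y k' = pref phi_inf k'" using k'(1) by (simp add: pref_eq_iff)
          let ?l = "length (phi (pref phi_inf k'))"
          have "d i = phi_inf i" if "i < ?l" for i
            using phiw_nth[of i y k'] phiw_nth[of i phi_inf k'] that pe y(2) by simp
          then have "?l \<le> k" using less.prems(3) by (metis not_less order_less_irrefl)
          moreover have "k' < ?l" unfolding Suc
            using length_phi_ge[of "pref (shiftw phi_inf 1) m"]
            by (simp add: pref_Suc phi_Cons phi_inf_start length_phi_letter)
          ultimately show ?thesis by simp
        qed
        from less.IH[OF this ly k'] show ?thesis
        proof
          assume "2 \<le> y 0"
          then show ?thesis using y(1) unfolding binw_def by (metis not_numeral_le_zero one_less_numeral_iff not_less semiring_norm(76))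
        next
          assume "\<exists>n ya. y = (phiw ^^ n) ya \<and> binw ya \<and> ya 0 = 1 \<and> ya 1 = 0 \<and> (ya 2 = 1 \<or> ya 2 = 0 \<and> ya 3 = 0)"
          then obtain n ya where "y = (phiw ^^ n) ya" "binw ya \<and> ya 0 = 1 \<and> ya 1 = 0 \<and> (ya 2 = 1 \<or> ya 2 = 0 \<and> ya 3 = 0)"
            by blast
          moreover from this have "d = (phiw ^^ Suc n) ya" using y by simp
          ultimately show ?thesis by blast
        qed
      qed
    qed simp
  qed
  then show ?thesis using assms unfolding altless_iff by blast
qed

section \<open>Entropy bounds below the critical word\<close>

lemma phiw_system:
  assumes "binw x" "binw y" "x \<in> alt_system y"
  shows "phiw x \<in> alt_system (phiw y)"
  unfolding alt_system_def
proof (intro CollectI conjI allI)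
  fix p show "altle (phiw y) (shiftw (phiw x) p)"
  proof (cases "phiw x p = 0")
    case True
    then show ?thesis by (subst altle_Cons_decomp) simp
  next
    case False
    then obtain m where "shiftw (phiw x) p = phiw (shiftw x m)" using phiw_block_start by blast
    then show ?thesis using phiw_altle_iff assms alt_system_ge by simp
  qed
qed (simp add: binw_nonneg)

lemma phiw_funpow_system:
  assumes "binw x" "binw y" "x \<in> alt_system y"
  shows "binw ((phiw ^^ n) x) \<and> (phiw ^^ n) x \<in> alt_system ((phiw ^^ n) y)"
proof -
  have "binw ((phiw ^^ n) x) \<and> binw ((phiw ^^ n) y) \<and> (phiw ^^ n) x \<in> alt_system ((phiw ^^ n) y)"
    using assms by (induction n) (auto simp: phiw_system)
  then show ?thesis by blast
qed

text \<open>A tail of \<open>phiw x\<close> that starts with 1 starts with 11 or 1001, and both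
  exceed 101 and 1000.\<close>

lemma phiw_image_system:
  assumes "y 0 = 1" "y 1 = 0" "y 2 = 1 \<or> y 2 = 0 \<and> y 3 = 0"
  shows "phiw x \<in> alt_system y"
  unfolding alt_system_def
proof (intro CollectI conjI allI)
  fix p show "altle y (shiftw (phiw x) p)"
  proof (cases "phiw x p = 0")
    case True
    then show ?thesis by (subst altle_Cons_decomp) (simp add: assms)
  next
    case False
    then obtain m where m: "shiftw (phiw x) p = phiw (shiftw x m)" using phiw_block_start by blast
    let ?v = "phiw (shiftw x m)"
    have "altless y ?v"
    proof (cases "x m = 0")
      case True
      then show ?thesis using assms by (intro altlessI[of 1]) (auto simp: phiw_1)
    next
      case False
      then have v: "?v 0 = 1" "?v 1 = 0" "?v 2 = 0" "?v 3 = 1"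
        using phiw_1[of "shiftw x m"] phiw_23[of "shiftw x m"] by auto
      show ?thesis
      proof (cases "y 2 = 1")
        case True
        then show ?thesis using v assms by (intro altlessI[of 2]) (auto simp: less_Suc_eq numeral_2_eq_2)
      next
        case False
        have "i = 0 \<or> i = 1 \<or> i = 2" if "i < 3" for i :: nat using that by linarith
        then show ?thesis using False v assms by (intro altlessI[of 3]) fastforce+
      qed
    qed
    then show ?thesis using m by (simp add: altless_imp_altle)
  qed
qed (simp add: binw_nonneg)

text \<open>The word repeats \<open>(phi ^^ m) [1, 0]\<close>. Solving the fixed point equation of
  its value yields a positive multiple of \<open>1 - z ^ len0 m - z ^ len1 m\<close>.\<close>

lemma wval_phiw_funpow_10:
  assumes "0 < z" "z < 1" "0 < wval z ((phiw ^^ m) (ovl [1, 0]))"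
  shows "z ^ len0 m + z ^ len1 m < 1"
proof -
  define X where "X = (phiw ^^ m) (ovl [1, 0])"
  have "X = appw ((phi ^^ m) [1, 0]) X"
    unfolding X_def
  proof (induction m)
    case 0
    then show ?case using appw_ovl[of "[1, 0]"] by simp
  next
    case (Suc m)
    then show ?case by (metis comp_apply funpow.simps(2) phiw_appw)
  qed
  then have X: "X = appw ((phi ^^ m) [1] @ (phi ^^ m) [0]) X"
    using phi_funpow_append[of m "[1]" "[0]"] by simp
  have "bndw X"
  proof (cases m)
    case 0
    then show ?thesis by (simp add: X_def)
  next
    case (Suc k)
    then have "binw X" by (simp add: X_def)
    then show ?thesis unfolding binw_def by (intro bndwI[of _ 1]) (metis order_refl zero_le_one)+
  qed
  then have "wval z X = aff z ((phi ^^ m) [1] @ (phi ^^ m) [0]) (wval z X)"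
    using X wval_appw[of X z] assms by (metis less_imp_le)
  then have "wval z X = phi_const z (Suc m) - z ^ len1 m * (phi_const z m - z ^ len0 m * wval z X)"
    by (simp add: aff_append aff_phi_funpow del: phi_const.simps)
  then have e: "wval z X * (1 - z ^ len1 m * z ^ len0 m) = phi_const z m * (1 - z ^ len0 m - z ^ len1 m)"
    by (simp add: algebra_simps)
  have "z ^ len1 m * z ^ len0 m < 1"
    unfolding power_add[symmetric] using assms power_strict_decreasing[of 0 "len1 m + len0 m" z] len0_pos[of m] by simp
  then have "0 < wval z X * (1 - z ^ len1 m * z ^ len0 m)"
    using assms(3) by (simp add: X_def)
  then show ?thesis unfolding e using phi_const_pos[OF assms(1,2), of m] by (simp add: zero_less_mult_iff)
qed

text \<open>Below the critical radius the value of this word is positive; the bound is the limit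
  from the left. For \<open>\<beta> = 1\<close> the conclusion would read 2 \<le> 1, so entropy 0 is
  excluded at the same time.\<close>

lemma radius_bound_from_10:
  assumes d: "nonneg_lyndon d" "attached d \<beta>" and m: "(phiw ^^ m) (ovl [1, 0]) \<in> alt_system d"
  shows "(1 / \<beta>) ^ len0 m + (1 / \<beta>) ^ len1 m \<le> 1"
proof -
  define R where "R = 1 / \<beta>"
  have b: "1 \<le> \<beta>" using attached_lower[OF d] by simp
  have R: "0 < R" "R \<le> 1" using b by (auto simp: R_def)
  have "R ^ len0 m + R ^ len1 m \<le> 1"
  proof (rule tendsto_upperbound)
    show "((\<lambda>z. z ^ len0 m + z ^ len1 m) \<longlongrightarrow> R ^ len0 m + R ^ len1 m) (at_left R)"
      by (intro tendsto_intros)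
    show "\<forall>\<^sub>F z in at_left R. z ^ len0 m + z ^ len1 m \<le> 1"
      using eventually_at_left_interval[OF R(1)]
    proof eventually_elim
      case (elim z)
      then have "0 < wval z d" "wval z d \<le> wval z ((phiw ^^ m) (ovl [1, 0]))"
        using wval_below_radius[OF d, of z] m by (auto simp: R_def)
      then show ?case using wval_phiw_funpow_10[of z m] elim R by linarith
    qed
  qed simp
  then show ?thesis by (simp add: R_def)
qed

text \<open>A shift by a period leads to a letter 1, hence to a cut, and injectivity of
  \<open>phiw\<close> carries the period over to the preimage.\<close>

lemma period_descent:
  assumes "binw y" "shiftw ((phiw ^^ n) y) k = (phiw ^^ n) y" "0 < k"
  shows "\<exists>m>0. shiftw y m = y \<and> k = length ((phi ^^ n) (pref y m))"
  using assms
proof (induction n arbitrary: y)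
  case 0
  then show ?case by auto
next
  case (Suc n)
  then obtain m' where m': "0 < m'" "shiftw (phiw y) m' = phiw y" "k = length ((phi ^^ n) (pref (phiw y) m'))"
    using Suc.IH[of "phiw y"] by (metis binw_phiw comp_apply funpow_Suc_right)
  have "phiw y m' = phiw y 0" using m'(2) by (metis shiftw_apply add_0)
  then obtain m where m: "m' = length (phi (pref y m))" "shiftw (phiw y) m' = phiw (shiftw y m)"
    using phiw_block_start[of y m'] by auto
  have "0 < m" using m m' by (cases m) auto
  moreover have "shiftw y m = y" using m m' phiw_inj[of "shiftw y m" y] Suc.prems by simp
  moreover have "k = length ((phi ^^ Suc n) (pref y m))"
    using m' m pref_phiw[of y m] by (simp add: funpow_swap1)
  ultimately show ?case by blast
qed

lemma binw_ovl_10: "binw (ovl [1, 0])"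
  using ovl_in_set[of "[1, 0]"] by (auto simp: binw_def)

text \<open>The descent puts the periodic word of 10, or an image of it under iterates of
  \<open>phiw\<close>, into the system of \<open>d\<close>. The second claim is the entropy bound
  that later rules out words of \<open>Lyn\<close>.\<close>

lemma below_phi_inf:
  assumes d: "nonneg_lyndon d" "attached d \<beta>" "altless d phi_inf"
  shows "1 < \<beta>"
    and "\<And>k. shiftw d k = d \<Longrightarrow> 0 < k \<Longrightarrow> (1 / \<beta>) ^ k + (1 / \<beta>) ^ Suc k \<le> 1"
proof -
  define R where "R = 1 / \<beta>"
  have b: "1 \<le> \<beta>" using attached_lower[OF d(1,2)] by simp
  have R: "0 < R" "R \<le> 1" using b by (auto simp: R_def)
  have gt: "1 < \<beta>" if "R ^ p + R ^ q \<le> 1" for p q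
  proof (rule ccontr)
    assume "\<not> 1 < \<beta>"
    then have "\<beta> = 1" using b by simp
    then show False using that by (simp add: R_def)
  qed
  have "1 < \<beta> \<and> (\<forall>k. shiftw d k = d \<and> 0 < k \<longrightarrow> R ^ k + R ^ Suc k \<le> 1)"
    using phi_inf_descent[OF d(1,3)]
  proof
    assume d0: "2 \<le> d 0"
    have "altle d (shiftw (ovl [1, 0]) k)" for k
    proof -
      have "shiftw (ovl [1, 0]) k 0 < d 0"
        using binw_ovl_10 d0 unfolding binw_def by (smt (verit) shiftw_apply)
      then show ?thesis by (subst altle_Cons_decomp) blast
    qed
    then have "(phiw ^^ 0) (ovl [1, 0]) \<in> alt_system d"
      using binw_nonneg[OF binw_ovl_10] by (simp add: alt_system_def)
    from radius_bound_from_10[OF d(1,2) this] have half: "R + R \<le> 1" by (simp add: R_def)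
    have "R ^ k + R ^ Suc k \<le> 1" if "0 < k" for k
    proof -
      have "R ^ k \<le> R ^ 1" "R ^ Suc k \<le> R ^ 1" using R that by (intro power_decreasing; simp)+
      then show ?thesis using half by simp
    qed
    then show ?thesis using gt[of 1 1] half by simp
  next
    assume "\<exists>n y. d = (phiw ^^ n) y \<and> binw y \<and> y 0 = 1 \<and> y 1 = 0 \<and> (y 2 = 1 \<or> y 2 = 0 \<and> y 3 = 0)"
    then obtain n y where y: "d = (phiw ^^ n) y" "binw y" "y 0 = 1" "y 1 = 0" "y 2 = 1 \<or> y 2 = 0 \<and> y 3 = 0"
      by blast
    have "phiw (ovl [1, 0]) \<in> alt_system y" using phiw_image_system y(3,4,5) .
    then have "(phiw ^^ n) (phiw (ovl [1, 0])) \<in> alt_system d"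
      using phiw_funpow_system[of "phiw (ovl [1, 0])" y n] y by simp
    then have "(phiw ^^ Suc n) (ovl [1, 0]) \<in> alt_system d" by (simp add: funpow_swap1)
    from radius_bound_from_10[OF d(1,2) this]
    have le: "R ^ len1 n + R ^ (len1 n + 2 * len0 n) \<le> 1" unfolding len0_Suc len1_Suc R_def .
    \<comment> \<open>Since \<open>y\<close> starts with 10, its periods are at least 2, so a period
      \<open>k\<close> of \<open>d\<close> has at least the length of
      \<open>(phi ^^ n) [1, 0]\<close>.\<close>
    have "R ^ k + R ^ Suc k \<le> 1" if k: "shiftw d k = d" "0 < k" for k
    proof -
      obtain m where m: "0 < m" "shiftw y m = y" "k = length ((phi ^^ n) (pref y m))"
        using period_descent[of y n k] k y by auto
      have "m \<noteq> 1" using m(2) y(3,4) by (metis shiftw_apply add_0 zero_neq_one)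
      then obtain m' where m': "m = 2 + m'" using m(1) by (metis One_nat_def add_2_eq_Suc gr0_conv_Suc not0_implies_Suc)
      have "pref y 2 = [1] @ [0]" using y by (simp add: pref_Suc numeral_2_eq_2)
      then have "k = len1 n + len0 n + length ((phi ^^ n) (pref (shiftw y 2) m'))"
        unfolding m(3) m' pref_add by (simp only: phi_funpow_append length_append)
      then have "len1 n + len0 n \<le> k" by simp
      then have "R ^ k \<le> R ^ (len1 n + len0 n)" "R ^ Suc k \<le> R ^ (len1 n + len0 n)"
        using R by (intro power_decreasing; simp)+
      \<comment> \<open>The inequality between the arithmetic and the geometric mean, as the
        exponent on the left is the mean of those on the right.\<close>
      moreover have "2 * R ^ (len1 n + len0 n) \<le> R ^ len1 n + R ^ (len1 n + 2 * len0 n)"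
      proof -
        define p q where "p = R ^ len1 n" and "q = R ^ len0 n"
        have "0 \<le> p * (1 - q)\<^sup>2" using R by (simp add: p_def)
        then have "2 * (p * q) \<le> p + p * q\<^sup>2" by (simp add: power2_eq_square algebra_simps)
        moreover have "R ^ (len1 n + len0 n) = p * q" by (simp add: p_def q_def power_add)
        moreover have "R ^ (len1 n + 2 * len0 n) = p * q\<^sup>2"
          unfolding p_def q_def power_add power_mult[symmetric] by (simp add: mult.commute)
        ultimately show ?thesis by (simp add: p_def)
      qed
      ultimately show ?thesis using le by linarith
    qed
    then show ?thesis using gt le by blast
  qed
  then show "1 < \<beta>" "\<And>k. shiftw d k = d \<Longrightarrow> 0 < k \<Longrightarrow> (1 / \<beta>) ^ k + (1 / \<beta>) ^ Suc k \<le> 1"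
    by (auto simp: R_def)
qed


section \<open>Blocks\<close>

lemma appw_eqI_length:
  assumes "n = length w" "\<And>i. i < length w \<Longrightarrow> x i = w ! i"
  shows "x = appw w (shiftw x n)"
  unfolding assms(1) by (rule appw_eqI) (rule assms(2))

text \<open>The word that replaces the block \<open>a\<close> at a discontinuity of the transformation.\<close>

definition low :: "int list \<Rightarrow> int list" where
  "low a = dec_last a @ [0]"

lemma dec_last_snoc [simp]: "dec_last (w @ [c]) = w @ [c - 1]"
  by (simp add: dec_last_def)

lemma low_snoc: "low (w @ [c]) = w @ [c - 1, 0]"
  by (simp add: low_def)

lemma length_dec_last [simp]: "a \<noteq> [] \<Longrightarrow> length (dec_last a) = length a"
  by (simp add: dec_last_def)

lemma length_low [simp]: "a \<noteq> [] \<Longrightarrow> length (low a) = Suc (length a)"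
  by (simp add: low_def)

lemma low_nonempty [simp]: "low a \<noteq> []"
  by (simp add: low_def)

lemma aff_low: "a \<noteq> [] \<Longrightarrow> aff z (low a) e = aff z a (- z * e)"
  using aff_dec_zero[of z "butlast a" "last a" e] by (simp add: low_def dec_last_def)

lemma appw_low: "appw (low a) x = appw (dec_last a) (appw [0] x)"
  by (simp add: low_def appw_append)

lemma max_word_fixed:
  assumes "a \<noteq> []"
  shows "max_word a = (if even (length a) then appw a (max_word a) else appw (low a) (max_word a))"
  using assms appw_ovl[of a] appw_ovl[of "low a"] by (simp add: max_word_def low_def)

lemma min_word_max_word:
  "min_word a = (if even (length a) then appw (low a) (max_word a) else appw a (max_word a))"
  by (simp add: min_word_def max_word_def low_def)

lemma altless_dec_last:
  assumes "a \<noteq> []"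
  shows "even (length a) \<Longrightarrow> altless (appw (dec_last a) x) (appw a y)"
    and "odd (length a) \<Longrightarrow> altless (appw a y) (appw (dec_last a) x)"
proof -
  obtain w c where a: "a = w @ [c]" using assms by (metis rev_exhaust)
  show "even (length a) \<Longrightarrow> altless (appw (dec_last a) x) (appw a y)"
    "odd (length a) \<Longrightarrow> altless (appw a y) (appw (dec_last a) x)"
    by (rule altlessI[of "length w"]; simp add: a appw_nth nth_append)+
qed

text \<open>A first position at which \<open>x\<close> would exceed \<open>M\<close> lies behind the
  common prefix \<open>W\<close>. Removing \<open>W\<close>, which has even length, gives an element
  of \<open>E\<close> with an earlier such position.\<close>

lemma altle_fixed_wordI:
  assumes W: "even (length W)" "W \<noteq> []" "M = appw W M"
    and step: "\<And>x. x \<in> E \<Longrightarrow> (\<exists>x'\<in>E. x = appw W x') \<or> altless x M"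
    and x: "x \<in> E"
  shows "altle x M"
proof -
  have "\<not> ((\<forall>i<r. M i = x i) \<and> (if even r then x r < M r else M r < x r))" if "x \<in> E" for r x
    using that
  proof (induction r arbitrary: x rule: less_induct)
    case (less r)
    show ?case
    proof
      assume r: "(\<forall>i<r. M i = x i) \<and> (if even r then x r < M r else M r < x r)"
      then have "altless M x" unfolding altless_iff by blast
      then have "\<not> altless x M" using altless_trans altless_irrefl by blast
      then obtain x' where x': "x' \<in> E" "x = appw W x'" using step[OF less.prems] by blast
      have same: "M i = x i" if "i < length W" for i
        using that by (subst W(3)) (simp add: x' appw_nth)
      have rl: "length W \<le> r"
      proof (rule ccontr)
        assume "\<not> length W \<le> r"
        then have "M r = x r" using same by simp
        then show False using r by (auto split: if_splits)
      qed
      define q where "q = r - length W"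
      have q: "r = q + length W" using rl by (simp add: q_def)
      have M: "M (i + length W) = M i" for i by (subst W(3)) simp
      have x: "x (i + length W) = x' i" for i by (simp add: x')
      have "q < r" using q W(2) by simp
      moreover have "M i = x' i" if "i < q" for i
      proof -
        have "i + length W < r" using that q by simp
        then have "M (i + length W) = x (i + length W)" using r by blast
        then show ?thesis using M x by simp
      qed
      moreover have "if even q then x' q < M q else M q < x' q"
        using conjunct2[OF r] M[of q] x[of q] W(1) unfolding q by (auto split: if_splits)
      ultimately show False using less.IH[of q x'] x' by blast
    qed
  qed
  then have "\<not> altless M x" using x unfolding altless_iff by blast
  then show ?thesis by (simp add: not_altless)
qed

lemma eq_ovl_coinduct:
  assumes "W \<noteq> []" "x \<in> E" "\<And>x. x \<in> E \<Longrightarrow> \<exists>x'\<in>E. x = appw W x'"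
  shows "x = ovl W"
proof
  fix i show "x i = ovl W i"
    using assms(2)
  proof (induction i arbitrary: x rule: less_induct)
    case (less i)
    obtain x' where x': "x' \<in> E" "x = appw W x'" using assms(3)[OF less.prems] by blast
    show ?case
    proof (cases "i < length W")
      case True
      then show ?thesis by (simp add: x' appw_nth ovl_nth)
    next
      case False
      then have "x i = x' (i - length W)" by (simp add: x' appw_def)
      also have "\<dots> = ovl W (i - length W)"
      proof (rule less.IH[OF _ x'(1)])
        show "i - length W < i"
          using False assms(1) by (metis diff_less length_greater_0_conv less_le_trans not_less)
      qed
      also have "\<dots> = ovl W i" using False by (simp add: ovl_def le_mod_geq)
      finally show ?thesis .
    qed
  qed
qed

text \<open>The block of even length is the larger one to start with, and it preserves the order of
  what follows, so repeating it is maximal. The block of odd length is the smaller one and reverses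
  the order, so the minimum continues it with the maximum.\<close>

lemma blocks_between_min_max:
  assumes a: "a \<noteq> []"
    and step: "\<And>x. x \<in> E \<Longrightarrow> \<exists>x'\<in>E. x = appw a x' \<or> x = appw (low a) x'"
    and x: "x \<in> E"
  shows "altle x (max_word a)" "altle (min_word a) x"
proof -
  let ?M = "max_word a"
  have le: "altle x ?M" if "x \<in> E" for x
  proof (cases "even (length a)")
    case True
    then have M: "?M = appw a ?M" using max_word_fixed[OF a] by simp
    show ?thesis
    proof (rule altle_fixed_wordI[OF True a M _ that])
      fix x assume "x \<in> E"
      from step[OF this] obtain x' where x': "x' \<in> E" "x = appw a x' \<or> x = appw (low a) x'" by blast
      have "altless (appw (low a) x') ?M"
        by (subst M, unfold appw_low) (rule altless_dec_last(1)[OF a True])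
      then show "(\<exists>x'\<in>E. x = appw a x') \<or> altless x ?M" using x' by blast
    qed
  next
    case False
    then have M: "?M = appw (low a) ?M" using max_word_fixed[OF a] by simp
    show ?thesis
    proof (rule altle_fixed_wordI[OF _ low_nonempty M _ that])
      fix x assume "x \<in> E"
      from step[OF this] obtain x' where x': "x' \<in> E" "x = appw a x' \<or> x = appw (low a) x'" by blast
      have "altless (appw a x') ?M"
        by (subst M, unfold appw_low) (rule altless_dec_last(2)[OF a False])
      then show "(\<exists>x'\<in>E. x = appw (low a) x') \<or> altless x ?M" using x' by blast
    qed (use a False in simp)
  qed
  show "altle x ?M" using le[OF x] .
  obtain x' where x': "x' \<in> E" "x = appw a x' \<or> x = appw (low a) x'" using step[OF x] by blast
  show "altle (min_word a) x"
  proof (cases "even (length a)")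
    case True
    have "altle (appw (low a) ?M) (appw (low a) x')"
      using le[OF x'(1)] True a by (simp add: altle_appw)
    moreover have "altle (appw (low a) ?M) (appw a x')"
      unfolding appw_low by (rule altless_imp_altle[OF altless_dec_last(1)[OF a True]])
    ultimately show ?thesis using x'(2) True by (auto simp: min_word_max_word)
  next
    case False
    have "altle (appw a ?M) (appw a x')"
      using le[OF x'(1)] False a by (simp add: altle_appw)
    moreover have "altle (appw a ?M) (appw (low a) x')"
      unfolding appw_low by (rule altless_imp_altle[OF altless_dec_last(2)[OF a False]])
    ultimately show ?thesis using x'(2) False by (auto simp: min_word_max_word)
  qed
qed

text \<open>A converse of \<open>blocks_between_min_max\<close> for one block. Only the upper bound
  passes on to \<open>y'\<close>; in the applications the lower bound comes from minimality of a
  Lyndon word.\<close>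

lemma between_min_max_parse:
  assumes a: "a \<noteq> []" and y: "\<And>i. 0 \<le> y i" "altle (min_word a) y" "altle y (max_word a)"
  obtains y' where "altle y' (max_word a)" "y = appw a y' \<or> y = appw (low a) y'"
    "\<And>i. i < length a - 1 \<Longrightarrow> y i = a ! i" "y (length a - 1) \<le> last a" "last a - 1 \<le> y (length a - 1)"
proof -
  obtain w c where aw: "a = w @ [c]" using a by (metis rev_exhaust)
  let ?M = "max_word a" and ?k = "length w"
  have mw: "min_word a i = w ! i" "?M i = w ! i" if "i < ?k" for i
  proof -
    have "appw a ?M i = w ! i" "appw (low a) ?M i = w ! i"
      using that by (simp_all add: aw low_snoc appw_nth nth_append)
    then show "min_word a i = w ! i" "?M i = w ! i"
      using max_word_fixed[OF a] min_word_max_word[of a] by metis+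
  qed
  have yw: "y i = w ! i" if "i < ?k" for i
    using altle_between[OF y(2,3), of ?k i] mw that by simp
  have ends: "appw a ?M ?k = c" "appw (low a) ?M ?k = c - 1"
    by (simp_all add: aw low_snoc appw_nth nth_append)
  have at: "if even ?k then y ?k \<le> min_word a ?k else min_word a ?k \<le> y ?k"
    "if even ?k then ?M ?k \<le> y ?k else y ?k \<le> ?M ?k"
    using altle_at[OF y(2), of ?k] altle_at[OF y(3), of ?k] mw yw by auto
  have yk: "c - 1 \<le> y ?k \<and> y ?k \<le> c"
  proof (cases "even ?k")
    case True
    then have "min_word a = appw a ?M" "?M = appw (low a) ?M"
      using min_word_max_word[of a] max_word_fixed[OF a] by (auto simp: aw)
    then have "min_word a ?k = c" "?M ?k = c - 1" using ends by metis+
    then show ?thesis using at True by simp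
  next
    case False
    then have "min_word a = appw (low a) ?M" "?M = appw a ?M"
      using min_word_max_word[of a] max_word_fixed[OF a] by (auto simp: aw)
    then have "min_word a ?k = c - 1" "?M ?k = c" using ends by metis+
    then show ?thesis using at False by simp
  qed
  have "\<exists>y'. altle y' ?M \<and> (y = appw a y' \<or> y = appw (low a) y')"
  proof (cases "y ?k = c")
    case True
    have ya: "y = appw a (shiftw y (length a))"
      by (rule appw_eqI) (auto simp: aw nth_append yw True less_Suc_eq)
    have "altle (shiftw y (length a)) ?M"
    proof (cases "even (length a)")
      case True
      then have "altle (appw a (shiftw y (length a))) (appw a ?M)"
        using y(3) ya max_word_fixed[OF a] by metis
      then show ?thesis using True by (simp add: altle_appw)
    next
      case False
      then have "altle (appw a ?M) (appw a (shiftw y (length a)))"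
        using y(2) ya min_word_max_word[of a] by metis
      then show ?thesis using False by (simp add: altle_appw)
    qed
    then show ?thesis using ya by blast
  next
    case False
    then have yk1: "y ?k = c - 1" using yk by simp
    define v where "v = shiftw y (length a)"
    have ya: "y = appw (dec_last a) v"
      unfolding v_def by (rule appw_eqI_length) (auto simp: aw nth_append yw yk1 less_Suc_eq)
    \<comment> \<open>This bounds the next letter by 0 from above, and nonnegativity makes it the 0
      that completes \<open>low a\<close>.\<close>
    have zero: "altle (appw [0] ?M) v"
    proof (cases "even (length a)")
      case True
      then have "altle (appw (dec_last a) (appw [0] ?M)) (appw (dec_last a) v)"
        using y(2) ya min_word_max_word[of a] appw_low by metis
      then show ?thesis using True a by (simp add: altle_appw)
    next
      case False
      then have "altle (appw (dec_last a) v) (appw (dec_last a) (appw [0] ?M))"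
        using y(3) ya max_word_fixed[OF a] appw_low by metis
      then show ?thesis using False a by (simp add: altle_appw)
    qed
    have "v 0 \<le> 0" using altle_at[OF zero, of 0] by simp
    then have "v 0 = 0" using y(1)[of "length a"] by (simp add: v_def)
    then have v: "v = appw [0] (shiftw v 1)" by (intro appw_eqI_length) auto
    then have "altle (shiftw v 1) ?M" using zero altle_appw[of "[0]" ?M "shiftw v 1"] by simp
    then show ?thesis using ya v appw_low by metis
  qed
  then show ?thesis using that yw yk by (auto simp: aw nth_append)
qed

section \<open>Words with the same value\<close>

text \<open>\<open>E\<close> consists of the words of the system that have the value of its minimum \<open>d\<close>;
  \<open>length w\<close> is the first position at which two of them differ.\<close>

locale block_pair =
  fixes d :: "nat \<Rightarrow> int" and R :: real and E :: "(nat \<Rightarrow> int) set"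
    and w :: "int list" and c :: int and hi lo :: "nat \<Rightarrow> int"
  assumes R: "0 < R" "R < 1"
    and E_def: "E = {x \<in> alt_system d. wval R x = 0}"
    and vals: "\<And>x. x \<in> alt_system d \<Longrightarrow> 0 \<le> wval R x"
    and d: "nonneg_lyndon d" "d \<in> E"
    and agree: "\<And>x i. x \<in> E \<Longrightarrow> i < length w \<Longrightarrow> x i = w ! i"
    and letter: "\<And>x. x \<in> E \<Longrightarrow> x (length w) = c \<or> x (length w) = c - 1"
    and hi: "hi \<in> E" "appw (w @ [c]) hi \<in> E"
    and lo: "lo \<in> E" "appw (w @ [c - 1, 0]) lo \<in> E"
    and d_letter: "odd (length w) \<Longrightarrow> d (length w) = c - 1"
begin

abbreviation a :: "int list" where "a \<equiv> w @ [c]"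

lemma E_system: "x \<in> E \<Longrightarrow> x \<in> alt_system d"
  and E_wval: "x \<in> E \<Longrightarrow> wval R x = 0"
  and E_bndw: "x \<in> E \<Longrightarrow> bndw x"
  using bndw_alt_system by (auto simp: E_def)

text \<open>\<open>hi\<close> and its extension by \<open>a\<close> both have value 0, so the affine
  map of \<open>a\<close> fixes 0.\<close>

lemma aff_a: "aff R a 0 = 0"
  using wval_appw[of hi R a] E_wval[OF hi(1)] E_wval[OF hi(2)] E_bndw[OF hi(1)] R by simp

lemma c_ge: "1 \<le> c"
  using alt_system_nonneg[OF E_system[OF lo(2)], of "length w"]
  by (simp add: appw_nth nth_append)

lemma a_nonneg: "0 \<le> ovl a i"
proof -
  have "0 \<le> b" if "b \<in> set a" for b
  proof -
    have "b = c \<or> (\<exists>i<length w. b = w ! i)" using that by (auto simp: in_set_conv_nth)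
    then show ?thesis
      using c_ge agree[OF d(2)] d(1) unfolding nonneg_lyndon_def by (metis order_trans zero_le_one)
  qed
  then show ?thesis using ovl_in_set[of a i] by blast
qed

lemma value_one:
  assumes "v \<in> alt_system d" "wval R v = 1"
  shows "v 0 = 0" "shiftw v 1 \<in> E"
proof -
  have "R * (of_int (v 0) + wval R (shiftw v 1)) = 0"
    using wval_rec[OF bndw_alt_system[OF assms(1)], of R] assms(2) R by simp
  then have "of_int (v 0) + wval R (shiftw v 1) = 0" using R by simp
  moreover have "0 \<le> wval R (shiftw v 1)" using vals alt_system_shift[OF assms(1)] by blast
  moreover have "0 \<le> real_of_int (v 0)" using alt_system_nonneg[OF assms(1)] by simp
  ultimately have z: "real_of_int (v 0) = 0" "wval R (shiftw v 1) = 0" by linarith+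
  then show "v 0 = 0" "shiftw v 1 \<in> E"
    using alt_system_shift[OF assms(1)] by (auto simp: E_def)
qed

text \<open>Since the map of \<open>a\<close> fixes 0, a tail behind \<open>a\<close> has value 0.
  With the last letter lowered by one the tail has value 1, which \<open>value_one\<close> resolves
  into a letter 0 and an element of \<open>E\<close>.\<close>

lemma E_blocks:
  assumes "x \<in> E"
  shows "\<exists>x'\<in>E. x = appw a x' \<or> x = appw (low a) x'"
proof -
  let ?k = "length w"
  let ?v = "shiftw x (Suc ?k)"
  have vs: "?v \<in> alt_system d" using alt_system_shift E_system[OF assms] by blast
  have nz: "(- R) ^ length a \<noteq> 0" using R by simp
  show ?thesis
  proof (cases "x ?k = c")
    case True
    have x: "x = appw a ?v"
      by (rule appw_eqI_length) (auto simp: nth_append less_Suc_eq agree[OF assms] True)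
    then have "0 = aff R a (wval R ?v)"
      using wval_appw[of ?v R a] bndw_alt_system[OF vs] R E_wval[OF assms] by simp
    then have "wval R ?v = 0" using aff_affine[of R a "wval R ?v"] aff_a nz by simp
    then show ?thesis using x vs by (auto simp: E_def)
  next
    case False
    then have xk: "x ?k = c - 1" using letter[OF assms] by blast
    have x: "x = appw (w @ [c - 1]) ?v"
      by (rule appw_eqI_length) (auto simp: nth_append less_Suc_eq agree[OF assms] xk)
    then have "0 = aff R (w @ [c - 1]) (wval R ?v)"
      using wval_appw[of ?v R "w @ [c - 1]"] bndw_alt_system[OF vs] R E_wval[OF assms] by simp
    also have "\<dots> = aff R a (wval R ?v - 1)" by (rule aff_snoc_dec)
    finally have "wval R ?v = 1" using aff_affine[of R a "wval R ?v - 1"] aff_a nz by simp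
    from value_one[OF vs this] have v: "?v 0 = 0" "shiftw ?v 1 \<in> E" .
    then have "?v = appw [0] (shiftw ?v 1)" by (intro appw_eqI_length) auto
    then have "x = appw (low a) (shiftw ?v 1)"
      using x appw_low[of a] by simp
    then show ?thesis using v by blast
  qed
qed

lemma wval_ovl_a: "wval R (ovl a) = 0"
  using wval_ovl[of a R] aff_a R by simp

lemma ovl_a_nth: "i < length w \<Longrightarrow> ovl a i = w ! i" "ovl a (length w) = c"
  by (simp_all add: ovl_nth nth_append)

text \<open>For a shorter period \<open>m\<close> the last \<open>m\<close> letters of
  \<open>a\<close> are its first \<open>m\<close> letters. The tail of
  \<open>appw (w @ [c - 1, 0]) lo\<close> that starts there has value 0 again, so it lies in
  \<open>E\<close>; but it has \<open>c - 1\<close> at an index where all words of \<open>E\<close>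
  have the letter \<open>c\<close> of \<open>w\<close>.\<close>

lemma minimal_period_a: "minimal_period a"
proof -
  have False if m: "0 < m" "m < length a" and per: "\<And>i. ovl a (i + m) = ovl a i" for m
  proof -
    let ?k = "length a"
    have suffix: "a ! (i + (?k - m)) = ovl a i" if "i < m" for i
    proof -
      have "a ! (i + (?k - m)) = ovl a (i + (?k - m))" using that m by (simp add: ovl_nth)
      also have "\<dots> = ovl a (i + (?k - m) + m)" using per by simp
      also have "\<dots> = ovl a (i + ?k)" using m by (simp add: add.assoc)
      also have "\<dots> = shiftw (ovl a) ?k i" by simp
      also have "\<dots> = ovl a i" by (simp only: shiftw_ovl)
      finally show ?thesis .
    qed
    define b where "b = pref (ovl a) (m - 1)"
    have last: "ovl a (m - 1) = c"
      using suffix[of "m - 1"] m by (simp add: nth_append)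
    have bm: "pref (ovl a) m = b @ [c]"
    proof (rule nth_equalityI)
      fix i assume "i < length (pref (ovl a) m)"
      then have "i < m - 1 \<or> i = m - 1" by auto
      then show "pref (ovl a) m ! i = (b @ [c]) ! i" using m last by (auto simp: b_def nth_append)
    qed (use m in \<open>simp add: b_def\<close>)
    define v where "v = appw (b @ [c - 1, 0]) lo"
    have "v = shiftw (appw (w @ [c - 1, 0]) lo) (?k - m)"
    proof -
      have "drop (?k - m) (w @ [c - 1, 0]) = b @ [c - 1, 0]"
      proof (rule nth_equalityI)
        show "length (drop (?k - m) (w @ [c - 1, 0])) = length (b @ [c - 1, 0])"
          using m by (simp add: b_def)
        fix i assume "i < length (drop (?k - m) (w @ [c - 1, 0]))"
        then have i: "i < m + 1" using m by simp
        show "drop (?k - m) (w @ [c - 1, 0]) ! i = (b @ [c - 1, 0]) ! i"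
        proof (cases "i < m - 1")
          case True
          then have "(w @ [c - 1, 0]) ! (i + (?k - m)) = a ! (i + (?k - m))"
          proof -
            have "i + (?k - m) < length w" using True m by simp
            then show ?thesis by (simp only: nth_append if_True)
          qed
          moreover have "drop (?k - m) (w @ [c - 1, 0]) ! i = (w @ [c - 1, 0]) ! (i + (?k - m))"
            unfolding add.commute[of i] by (rule nth_drop) simp
          moreover have "(b @ [c - 1, 0]) ! i = ovl a i" using True by (simp add: b_def nth_append)
          ultimately show ?thesis using True suffix[of i] by simp
        next
          case False
          then have "i = m - 1 \<or> i = m" using i by linarith
          then show ?thesis using m by (auto simp: b_def nth_append)
        qed
      qed
      then show ?thesis unfolding v_def using shiftw_appw_drop[of "?k - m" "w @ [c - 1, 0]" lo] by simp
    qed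
    then have vs: "v \<in> alt_system d" using alt_system_shift E_system[OF lo(2)] by simp
    have "shiftw (ovl a) m = ovl a" using per by auto
    then have "wval R (ovl a) = aff R (b @ [c]) (wval R (ovl a))"
      using wval_split[of "ovl a" R m] R bm by simp
    then have "aff R (b @ [c]) 0 = 0" using wval_ovl_a by simp
    then have "wval R v = 0"
      unfolding v_def using wval_appw[of lo R "b @ [c - 1, 0]"] E_bndw[OF lo(1)] E_wval[OF lo(1)] R
        aff_dec_zero[of R b c 0] by simp
    then have "v \<in> E" using vs by (simp add: E_def)
    then have "v (m - 1) = w ! (m - 1)" using agree m by simp
    also have "\<dots> = c" using last ovl_a_nth(1)[of "m - 1"] m by simp
    finally show False using m by (simp add: v_def b_def appw_nth nth_append)
  qed
  then show ?thesis unfolding minimal_period_def by auto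
qed

text \<open>\<open>d\<close> and \<open>ovl a\<close> agree on \<open>length w\<close> letters, so
  an inequality with \<open>d\<close> that is decided there holds for \<open>ovl a\<close>, whatever
  follows \<open>v\<close>.\<close>

lemma compare_tail:
  assumes "altle d (appw v h)" "length v \<le> length w"
  shows "(\<forall>i<length v. v ! i = ovl a i) \<or> altless (ovl a) (appw v h')"
proof (cases "\<forall>i<length v. v ! i = ovl a i")
  case False
  define r where "r = (LEAST i. i < length v \<and> v ! i \<noteq> ovl a i)"
  have r: "r < length v" "v ! r \<noteq> ovl a r"
    using LeastI_ex[of "\<lambda>i. i < length v \<and> v ! i \<noteq> ovl a i"] False unfolding r_def by blast+
  have before: "v ! i = ovl a i" if "i < r" for i
    using not_less_Least[of i "\<lambda>i. i < length v \<and> v ! i \<noteq> ovl a i"] that r unfolding r_def by auto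
  have dw: "d i = ovl a i" if "i \<le> r" for i
    using agree[OF d(2), of i] ovl_a_nth(1)[of i] that r assms(2) by simp
  have "if even r then v ! r \<le> ovl a r else ovl a r \<le> v ! r"
  proof -
    have "d i = appw v h i" if "i < r" for i using dw[of i] before[of i] that r by (simp add: appw_nth)
    then have "if even r then appw v h r \<le> d r else d r \<le> appw v h r"
      by (rule altle_at[OF assms(1)])
    then show ?thesis using dw[of r] r by (auto simp: appw_nth split: if_splits)
  qed
  then have "altless (ovl a) (appw v h')"
    using r before by (intro altlessI[of r]) (auto simp: appw_nth split: if_splits)
  then show ?thesis by blast
qed simp

text \<open>A suffix of \<open>a\<close> that is no prefix of it is settled by
  \<open>compare_tail\<close>. If the suffix of length \<open>m\<close> is a prefix, then
  \<open>m\<close> turns out to be odd, so cancelling it reverses the comparison and reduces it to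
  the shift by \<open>m\<close>.\<close>

lemma alt_lyndon_a: "alt_lyndon (ovl a)"
proof -
  let ?x = "ovl a" and ?k = "length a"
  have tail: "shiftw ?x i = appw (drop i a) ?x" if "i \<le> ?k" for i
    using shiftw_appw_drop[OF that, of ?x] appw_ovl[of a] by simp
  have hi_tail: "altle d (appw (drop i a) hi)" if "i \<le> ?k" for i
    using alt_system_ge[OF E_system[OF hi(2)], of i] shiftw_appw_drop[OF that] by simp
  have main: "altle ?x (shiftw ?x i)" if i: "0 < i" "i < ?k" for i
  proof -
    define m where "m = ?k - i"
    have m: "0 < m" "m < ?k" "?k - m = i" using i by (auto simp: m_def)
    have "(\<forall>l<length (drop i a). drop i a ! l = ?x l) \<or> altless ?x (appw (drop i a) ?x)"
      by (rule compare_tail[OF hi_tail]) (use i in auto)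
    then show ?thesis
    proof
      assume "altless ?x (appw (drop i a) ?x)"
      then show ?thesis using tail[of i] i by (simp add: altless_imp_altle)
    next
      assume "\<forall>l<length (drop i a). drop i a ! l = ?x l"
      then have pm: "a ! (i + l) = ?x l" if "l < m" for l
        using that i nth_drop[of i a l] by (metis length_drop less_imp_le m_def)
      have dp: "drop i a = pref ?x m"
      proof (rule nth_equalityI)
        fix l assume "l < length (drop i a)"
        then have "l < m" by (simp add: m_def)
        then show "drop i a ! l = pref ?x m ! l" using pm[of l] i by (simp only: nth_drop nth_pref less_imp_le)
      qed (simp add: m_def)
      have xm: "?x (m - 1) = c" using pm[of "m - 1"] m i by (simp add: m_def nth_append)
      \<comment> \<open>In the word through \<open>lo\<close> this suffix ends in
        \<open>c - 1\<close> instead of \<open>c\<close> and is still not below \<open>d\<close>; so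
        its last index must be even.\<close>
      have "odd m"
      proof -
        let ?LO = "appw (w @ [c - 1, 0]) lo"
        have LO: "altle d (shiftw ?LO i)" using alt_system_ge[OF E_system[OF lo(2)]] .
        have dx: "d l = ?x l" if "l < m" for l
          using agree[OF d(2), of l] ovl_a_nth(1)[of l] that m by simp
        have "d l = shiftw ?LO i l" if "l < m - 1" for l
        proof -
          have "shiftw ?LO i l = a ! (i + l)"
            using that i by (simp add: m_def appw_nth nth_append add.commute)
          then show ?thesis using dx[of l] pm[of l] that by simp
        qed
        moreover have "shiftw ?LO i (m - 1) = c - 1"
          using m i by (simp add: m_def appw_nth nth_append)
        moreover have "d (m - 1) = c" using dx[of "m - 1"] xm m by simp
        ultimately have "even (m - 1)"
          using altle_at[OF LO, of "m - 1"] by (auto split: if_splits)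
        then show ?thesis using m by simp
      qed
      have "(\<forall>l<length (drop m a). drop m a ! l = ?x l) \<or> altless ?x (appw (drop m a) ?x)"
        by (rule compare_tail[OF hi_tail]) (use m in auto)
      then have "altle ?x (shiftw ?x m)"
      proof
        assume "altless ?x (appw (drop m a) ?x)"
        then show ?thesis using tail[of m] m by (simp add: altless_imp_altle)
      next
        assume "\<forall>l<length (drop m a). drop m a ! l = ?x l"
        then have pi: "a ! (m + l) = ?x l" if "l < i" for l
          using that m nth_drop[of m a l] by (metis length_drop less_imp_le)
        \<comment> \<open>Now both complementary suffixes are prefixes: \<open>a\<close> is the
          concatenation of the same two words in either order. So the shift by \<open>m\<close> is
          \<open>ovl a\<close> itself, against the minimality of its period.\<close>
        define y where "y = shiftw ?x m"
        have "y l = a ! l" if l: "l < ?k" for l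
        proof (cases "l < i")
          case True
          have "y l = appw (drop m a) ?x l" unfolding y_def using tail[of m] m by simp
          also have "\<dots> = drop m a ! l" by (rule appw_nth) (use True m in simp)
          also have "\<dots> = a ! (m + l)" by (rule nth_drop) (use m in simp)
          also have "\<dots> = ?x l" using pi True by simp
          finally show ?thesis using l by (simp add: ovl_nth)
        next
          case False
          have "y l = appw (drop m a) ?x l" unfolding y_def using tail[of m] m by simp
          also have "\<dots> = ?x (l - i)"
          proof -
            have "length (drop m a) = i" using m(3) by (simp only: length_drop)
            then show ?thesis using False by (simp only: appw_def if_False)
          qed
          also have "\<dots> = a ! (i + (l - i))" using pm[of "l - i"] False l i by (simp add: m_def)
          finally show ?thesis using False by simp
        qed
        then have "y = appw a (shiftw y ?k)" by (intro appw_eqI) auto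
        moreover have "shiftw y ?k = y"
        proof -
          have "shiftw y ?k = shiftw (shiftw ?x ?k) m" unfolding y_def by (simp only: shiftw_shiftw add.commute)
          then show ?thesis unfolding y_def by (simp only: shiftw_ovl)
        qed
        ultimately have "y = ?x" using eq_ovlI[of a y] by simp
        then have "\<forall>l. ?x (l + m) = ?x l" unfolding y_def by (metis shiftw_apply)
        then show ?thesis using minimal_period_a m unfolding minimal_period_def by blast
      qed
      then have "altle (appw (drop i a) (shiftw ?x m)) (appw (drop i a) ?x)"
        using \<open>odd m\<close> i by (simp add: altle_appw m_def)
      moreover have "appw (drop i a) (shiftw ?x m) = ?x" unfolding dp by simp
      ultimately show ?thesis using tail[of i] i by simp
    qed
  qed
  have "altle ?x (shiftw ?x n)" for n
  proof -
    have e: "shiftw ?x n = shiftw ?x (n mod ?k)"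
      by (rule ext) (simp only: shiftw_apply ovl_def mod_add_right_eq)
    show ?thesis
    proof (cases "n mod ?k = 0")
      case True
      then show ?thesis using e by simp
    next
      case False
      then show ?thesis unfolding e by (intro main) auto
    qed
  qed
  then show ?thesis by (simp add: alt_lyndon_def)
qed

lemma lyndon_a: "nonneg_lyndon (ovl a)"
  using alt_lyndon_a a_nonneg by (simp add: nonneg_lyndon_def)

text \<open>For odd length, suppose \<open>phi_inf\<close> did not exceed the maximum. A tail of
  \<open>phi_inf\<close> starting with \<open>a\<close> would be below \<open>ovl a\<close>, hence
  below \<open>phi_inf\<close>, since \<open>a\<close> reverses the order. So \<open>phi_inf\<close>
  would be \<open>ovl (low a)\<close>, whose value at \<open>R\<close> is 0.\<close>

lemma max_word_below: "altless (max_word a) phi_inf"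
proof -
  let ?u = phi_inf and ?M = "max_word a"
  have below: "altless (ovl a) ?u"
    using altless_phi_inf_if_zero[OF lyndon_a R wval_ovl_a] .
  show ?thesis
  proof (cases "even (length a)")
    case True
    then show ?thesis using below by (simp add: max_word_def)
  next
    case odd: False
    show ?thesis
    proof (rule ccontr)
      assume "\<not> altless ?M ?u"
      then have uM: "altle ?u ?M" by (simp add: not_altless)
      define T where "T = {y. (\<exists>n. y = shiftw ?u n) \<and> altle y ?M}"
      have M: "?M = ovl (low a)" using odd by (simp add: max_word_def low_def)
      have aa: "ovl a = appw a (ovl a)" by (simp add: appw_ovl)
      have "?u = ovl (low a)"
      proof (rule eq_ovl_coinduct[of _ _ T])
        show "?u \<in> T" using uM unfolding T_def by (auto intro!: exI[of _ 0])
        fix y assume y: "y \<in> T"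
        then obtain n where n: "y = shiftw ?u n" by (auto simp: T_def)
        have yu: "altle ?u y" using lyndon_phi_inf unfolding n nonneg_lyndon_def alt_lyndon_def by blast
        have ynn: "0 \<le> y i" for i using n binw_nonneg[OF binw_phi_inf] by simp
        have "altle (min_word a) (ovl a)"
        proof -
          have "altless (ovl a) ?M"
            using altless_dec_last(2)[OF _ odd, of "ovl a"] aa max_word_fixed[of a] odd appw_low
            by (metis snoc_eq_iff_butlast)
          then have "altle (appw a ?M) (appw a (ovl a))"
            using odd by (simp add: altle_appw altless_imp_altle)
          then show ?thesis using aa odd by (simp add: min_word_max_word)
        qed
        then have ymin: "altle (min_word a) y"
          using below yu altle_trans altless_imp_altle by blast
        obtain y' where y': "altle y' ?M" "y = appw a y' \<or> y = appw (low a) y'"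
          using between_min_max_parse[of a y] ynn ymin y unfolding T_def
          by (metis (mono_tags, lifting) mem_Collect_eq snoc_eq_iff_butlast)
        have notA: "y \<noteq> appw a y'"
        proof
          assume ya: "y = appw a y'"
          have "altle ?u y'"
          proof -
            have "y' = shiftw y (length a)" unfolding ya by (rule shiftw_appw_length[symmetric])
            then have "y' = shiftw ?u (n + length a)" unfolding n by (simp only: shiftw_shiftw)
            then show ?thesis using lyndon_phi_inf unfolding nonneg_lyndon_def alt_lyndon_def by simp
          qed
          then have "altless (ovl a) y'" using below altless_le_trans by blast
          then have "altless y (ovl a)" using altless_appw[of a y' "ovl a"] odd aa ya by simp
          then show False using below yu altless_trans altle_less_trans altless_irrefl by blast
        qed
        then have yl: "y = appw (low a) y'" using y' by blast
        then have "y' = shiftw ?u (n + length (low a))"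
          using n shiftw_appw_length by (metis shiftw_shiftw)
        then show "\<exists>x'\<in>T. y = appw (low a) x'" using yl y'(1) unfolding T_def by blast
      qed simp
      then have "wval R ?u = aff R (low a) (wval R ?u)"
        using wval_ovl_fixed[of "low a" R] R by simp
      then have "wval R ?u = (- R) ^ length a * (- R * wval R ?u)"
        using aff_low[of a R "wval R ?u"] aff_affine[of R a "- R * wval R ?u"] aff_a by simp
      then have "wval R ?u * (1 - (- R) ^ Suc (length a)) = 0" by (simp add: algebra_simps)
      moreover have "(- R) ^ Suc (length a) < 1" using R by (intro neg_power_less_one) auto
      ultimately have "wval R ?u = 0" by simp
      then show False using wval_above_phi_inf[OF nonneg_lyndon_mem[OF lyndon_phi_inf] R] by simp
    qed
  qed
qed

lemma d_between: "altle (min_word a) d" "altle d (max_word a)"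
  using blocks_between_min_max[of a E d] E_blocks d(2) by auto

lemma E_le_max: "x \<in> E \<Longrightarrow> altle x (max_word a)"
  using blocks_between_min_max(1)[of a E x] E_blocks by auto

text \<open>The block \<open>a\<close> witnesses \<open>d \<in> Lyn\<close> as soon as
  \<open>d \<noteq> ovl a\<close>. If its length is even, \<open>d\<close> has \<open>c - 1\<close>
  at the end of the block, where \<open>ovl a\<close> has \<open>c\<close>.\<close>

lemma odd_period_if_not_Lyn:
  assumes "d \<notin> Lyn"
  shows "d = ovl a \<and> odd (length a)"
proof -
  have "d = ovl a"
  proof (rule ccontr)
    assume "d \<noteq> ovl a"
    then have "d \<in> Lyn" unfolding Lyn_def
      using d(1) minimal_period_a c_ge alt_lyndon_a d_between max_word_below
      by (intro CollectI conjI exI[of _ a]) (auto simp: nonneg_lyndon_def)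
    then show False using assms by simp
  qed
  moreover have "odd (length a)"
  proof
    assume "even (length a)"
    then have "d (length w) = c - 1" using d_letter by simp
    then show False using \<open>d = ovl a\<close> ovl_a_nth(2) by simp
  qed
  ultimately show ?thesis by blast
qed

end

lemma block_pair_exists:
  assumes d: "nonneg_lyndon d" "attached d \<beta>" and b: "1 < \<beta>"
    and y: "y \<in> alt_system d" "y \<noteq> d" "wval (1 / \<beta>) y = 0"
  obtains w c hi lo where "block_pair d (1 / \<beta>) {x \<in> alt_system d. wval (1 / \<beta>) x = 0} w c hi lo"
proof -
  define R where "R = 1 / \<beta>"
  have R: "0 < R" "R < 1" using b by (auto simp: R_def)
  have vals: "0 \<le> wval R x" if "x \<in> alt_system d" for x
    using wval_at_radius(2)[OF d b that] by (simp add: R_def)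
  have le1: "wval R x \<le> 1" if "x \<in> alt_system d" for x
    using wval_le_one[OF that R vals[OF alt_system_shift[OF that]]] .
  define E where "E = {x \<in> alt_system d. wval R x = 0}"
  have dE: "d \<in> E"
    using wval_at_radius(1)[OF d b] nonneg_lyndon_mem[OF d(1)] by (simp add: E_def R_def)
  have yE: "y \<in> E" using y by (simp add: E_def R_def)
  define j where "j = (LEAST j. \<exists>x\<in>E. x j \<noteq> d j)"
  have ex: "\<exists>j. \<exists>x\<in>E. x j \<noteq> d j" using yE y(2) by blast
  obtain y0 where y0: "y0 \<in> E" "y0 j \<noteq> d j" using LeastI_ex[OF ex] unfolding j_def by blast
  have before: "x i = d i" if "x \<in> E" "i < j" for x i
    using not_less_Least[of i "\<lambda>j. \<exists>x\<in>E. x j \<noteq> d j"] that unfolding j_def by blast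
  have sys: "x \<in> alt_system d" "bndw x" if "x \<in> E" for x
    using that bndw_alt_system by (auto simp: E_def)
  have differ: "if even j then x j = d j - 1 \<and> wval R (shiftw x (Suc j)) = 1 \<and> wval R (shiftw d (Suc j)) = 0
      else x j = d j + 1 \<and> wval R (shiftw x (Suc j)) = 0 \<and> wval R (shiftw d (Suc j)) = 1"
    if x: "x \<in> E" "x j \<noteq> d j" for x
  proof -
    let ?X = "wval R (shiftw x (Suc j))" and ?D = "wval R (shiftw d (Suc j))"
    have "wval R x - wval R d = (- R) ^ Suc j * ((of_int (x j) + ?X) - (of_int (d j) + ?D))"
      using wval_diff[of x d R j] sys[OF x(1)] sys[OF dE] R before[OF x(1)] by simp
    moreover have "wval R x = 0" "wval R d = 0" using x dE by (auto simp: E_def)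
    ultimately have eq: "of_int (x j) + ?X = of_int (d j) + ?D" using R by simp
    have X: "0 \<le> ?X" "?X \<le> 1" using vals le1 alt_system_shift[OF sys(1)[OF x(1)]] by blast+
    have D: "0 \<le> ?D" "?D \<le> 1" using vals le1 alt_system_shift[OF sys(1)[OF dE]] by blast+
    have ord: "if even j then x j \<le> d j else d j \<le> x j"
      using altle_at[OF alt_system_ge0[OF sys(1)[OF x(1)]], of j] before[OF x(1)] by simp
    show ?thesis
    proof (cases "even j")
      case True
      then have "x j \<le> d j - 1" using ord x(2) by simp
      then have "real_of_int (x j) \<le> of_int (d j) - 1" by linarith
      then have "?X = 1" "?D = 0" "real_of_int (x j) = of_int (d j) - 1" using eq X D by linarith+
      then show ?thesis using True by simp
    next
      case False
      then have "d j + 1 \<le> x j" using ord x(2) by simp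
      then have "real_of_int (d j) + 1 \<le> of_int (x j)" by linarith
      then have "?X = 0" "?D = 1" "real_of_int (x j) = of_int (d j) + 1" using eq X D by linarith+
      then show ?thesis using False by simp
    qed
  qed
  \<comment> \<open>\<open>c\<close> is the larger of the two letters at \<open>j\<close>; the
    minimum \<open>d\<close> has it at an even index, and the smaller one at an odd index.\<close>
  define c where "c = (if even j then d j else d j + 1)"
  define w where "w = pref d j"
  have letter: "x j = c \<or> x j = c - 1" if "x \<in> E" for x
    using differ[OF that] unfolding c_def by (cases "x j = d j") (auto split: if_splits)
  obtain HI where HI: "HI \<in> E" "HI j = c" "wval R (shiftw HI (Suc j)) = 0"
    using differ[OF y0] dE y0 by (cases "even j") (auto simp: c_def)
  obtain LO where LO: "LO \<in> E" "LO j = c - 1" "wval R (shiftw LO (Suc j)) = 1"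
    using differ[OF y0] dE y0 by (cases "even j") (auto simp: c_def)
  define hi where "hi = shiftw HI (Suc j)"
  have hiE: "hi \<in> E" unfolding hi_def E_def using alt_system_shift[OF sys(1)[OF HI(1)]] HI by simp
  have HI_eq: "HI = appw (w @ [c]) hi"
    unfolding hi_def
    by (rule appw_eqI_length) (auto simp: w_def nth_append less_Suc_eq before[OF HI(1)] HI(2))
  define v where "v = shiftw LO (Suc j)"
  have v: "v \<in> alt_system d" "wval R v = 1"
    using alt_system_shift[OF sys(1)[OF LO(1)]] LO by (auto simp: v_def)
  have "R * (of_int (v 0) + wval R (shiftw v 1)) = 0"
    using wval_rec[OF bndw_alt_system[OF v(1)], of R] v(2) R by simp
  then have "of_int (v 0) + wval R (shiftw v 1) = 0" using R by simp
  moreover have "0 \<le> wval R (shiftw v 1)" using vals alt_system_shift[OF v(1)] by blast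
  moreover have "0 \<le> real_of_int (v 0)" using alt_system_nonneg[OF v(1)] by simp
  ultimately have v0: "real_of_int (v 0) = 0" "wval R (shiftw v 1) = 0" by linarith+
  define lo where "lo = shiftw v 1"
  have loE: "lo \<in> E" unfolding lo_def E_def using alt_system_shift[OF v(1)] v0 by simp
  have "v = appw [0] lo" unfolding lo_def by (rule appw_eqI_length) (use v0 in auto)
  moreover have "LO = appw (w @ [c - 1]) v"
    unfolding v_def
    by (rule appw_eqI_length) (auto simp: w_def nth_append less_Suc_eq before[OF LO(1)] LO(2))
  ultimately have LO_eq: "LO = appw (w @ [c - 1, 0]) lo"
    using appw_append[of "w @ [c - 1]" "[0]" lo] by simp
  have "block_pair d R E w c hi lo"
  proof
    show "x i = w ! i" if "x \<in> E" "i < length w" for x i using before that by (simp add: w_def)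
    show "odd (length w) \<Longrightarrow> d (length w) = c - 1" by (simp add: w_def c_def)
    show "appw (w @ [c]) hi \<in> E" using HI HI_eq by simp
    show "appw (w @ [c - 1, 0]) lo \<in> E" using LO LO_eq by simp
    show "x (length w) = c \<or> x (length w) = c - 1" if "x \<in> E" for x
      using letter[OF that] by (simp add: w_def)
  qed (use R vals d dE hiE loE in \<open>auto simp: E_def\<close>)
  then show ?thesis using that unfolding E_def R_def by blast
qed


section \<open>Expansions of the left end point\<close>

text \<open>The orbit condition of the transformation, translated by \<open>- lbeta \<beta>\<close>:
  the strict bound excludes the right end point, which has become 1.\<close>

definition in_unit :: "real \<Rightarrow> (nat \<Rightarrow> int) \<Rightarrow> bool" where
  "in_unit z d \<longleftrightarrow> wval z d = 0 \<and> (\<forall>n. 0 \<le> wval z (shiftw d n) \<and> wval z (shiftw d n) < 1)"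

lemma lbeta_scale: "1 < \<beta> \<Longrightarrow> - lbeta \<beta> * (1 + 1 / \<beta>) = 1"
  by (simp add: lbeta_def divide_simps)

text \<open>The tail values and the translated orbit obey the same recursion. Their difference is
  bounded and shrinks by the factor \<open>z\<close> with each backward step, so it is 0.
  Conversely, values in \<open>[0, 1)\<close> make each letter the required floor.\<close>

lemma negbeta_exp_iff:
  assumes "bndw d" "1 < \<beta>"
  shows "d = negbeta_exp \<beta> (lbeta \<beta>) \<longleftrightarrow> in_unit (1 / \<beta>) d"
proof
  define z where "z = 1 / \<beta>"
  have z: "0 < z" "z < 1" "z * \<beta> = 1" using assms(2) by (auto simp: z_def)
  have rec: "wval z (shiftw d n) = 1 - z * (of_int (d n) + wval z (shiftw d (Suc n)))" for n
    using wval_rec[of "shiftw d n" z] assms(1) z by simp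
  {
    assume e: "d = negbeta_exp \<beta> (lbeta \<beta>)"
    define v where "v n = (negbeta_T \<beta> ^^ n) (lbeta \<beta>)" for n
    have dn: "d n = \<lfloor>- \<beta> * v n - lbeta \<beta>\<rfloor>" for n by (simp add: e negbeta_exp_def v_def)
    have vS: "v (Suc n) = - \<beta> * v n - of_int (d n)" for n
      by (simp add: dn v_def negbeta_T_def)
    have vr: "0 \<le> v n - lbeta \<beta> \<and> v n - lbeta \<beta> < 1" for n
    proof (cases n)
      case 0
      then show ?thesis by (simp add: v_def)
    next
      case (Suc m)
      have "real_of_int (d m) \<le> - \<beta> * v m - lbeta \<beta>" "- \<beta> * v m - lbeta \<beta> < of_int (d m) + 1"
        unfolding dn by linarith+
      then show ?thesis using Suc vS[of m] by auto
    qed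
    have e_rec: "v n - lbeta \<beta> = 1 - z * (of_int (d n) + (v (Suc n) - lbeta \<beta>))" for n
    proof -
      have "1 - z * (of_int (d n) + (v (Suc n) - lbeta \<beta>)) = 1 + (z * \<beta>) * v n + z * lbeta \<beta>"
        unfolding vS by (simp add: algebra_simps)
      also have "\<dots> = v n + (1 + z * lbeta \<beta>)" using z by simp
      also have "1 + z * lbeta \<beta> = - lbeta \<beta>"
        using lbeta_scale[OF assms(2)] by (simp add: z_def algebra_simps)
      finally show ?thesis by simp
    qed
    obtain K where K: "\<And>i. \<bar>d i\<bar> \<le> K" using assms(1) unfolding bndw_def by blast
    define B where "B = 2 + (of_int K + 1) * z / (1 - z)"
    define f where "f n = wval z (shiftw d n) - (v n - lbeta \<beta>)" for n
    have fB: "\<bar>f n\<bar> \<le> B" for n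
    proof -
      have "\<bar>wval z (shiftw d n)\<bar> \<le> 1 + (of_int K + 1) * z / (1 - z)"
        by (rule wval_bound) (use K z in auto)
      then show ?thesis using vr[of n] unfolding f_def B_def by linarith
    qed
    have f_rec: "f n = - z * f (Suc n)" for n
      unfolding f_def by (subst rec, subst e_rec) (simp add: algebra_simps)
    have fn: "\<bar>f n\<bar> \<le> z ^ m * B" for n m
    proof (induction m arbitrary: n)
      case 0
      then show ?case using fB by simp
    next
      case (Suc m)
      have "\<bar>f n\<bar> = z * \<bar>f (Suc n)\<bar>" using f_rec[of n] z by (simp add: abs_mult)
      also have "\<dots> \<le> z * (z ^ m * B)" using Suc z by (intro mult_left_mono) auto
      finally show ?case by simp
    qed
    have f0: "f n = 0" for n
    proof -
      have "(\<lambda>m. z ^ m * B) \<longlonglongrightarrow> 0 * B" using z by (intro tendsto_intros LIMSEQ_power_zero) auto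
      then have "\<bar>f n\<bar> \<le> 0 * B" using fn[of n] by (intro LIMSEQ_le_const) auto
      then show ?thesis by simp
    qed
    have eq: "wval z (shiftw d n) = v n - lbeta \<beta>" for n using f0[of n] by (simp add: f_def)
    have "v 0 = lbeta \<beta>" by (simp add: v_def)
    then have "wval z d = 0" using eq[of 0] by simp
    then show "in_unit (1 / \<beta>) d"
      using eq vr unfolding in_unit_def z_def[symmetric] by auto
  }
  {
    assume "in_unit (1 / \<beta>) d"
    then have u: "wval z d = 0" "\<And>n. 0 \<le> wval z (shiftw d n)" "\<And>n. wval z (shiftw d n) < 1"
      by (auto simp: in_unit_def z_def)
    have step: "- \<beta> * (lbeta \<beta> + wval z (shiftw d n)) - lbeta \<beta> = of_int (d n) + wval z (shiftw d (Suc n))" for n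
    proof -
      have "\<beta> * (1 - z * X) = \<beta> - X" for X
        using assms(2) by (simp add: z_def algebra_simps)
      then have "\<beta> * wval z (shiftw d n) = \<beta> - (of_int (d n) + wval z (shiftw d (Suc n)))"
        by (subst rec) blast
      moreover have "- \<beta> * lbeta \<beta> - lbeta \<beta> = \<beta>"
        using lbeta_scale[OF assms(2)] assms(2) by (simp add: field_simps)
      ultimately show ?thesis using z by (simp add: algebra_simps)
    qed
    have fl: "\<lfloor>- \<beta> * (lbeta \<beta> + wval z (shiftw d n)) - lbeta \<beta>\<rfloor> = d n" for n
      unfolding step using u(2,3)[of "Suc n"] by (intro floor_unique) auto
    have v: "(negbeta_T \<beta> ^^ n) (lbeta \<beta>) = lbeta \<beta> + wval z (shiftw d n)" for n
    proof (induction n)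
      case 0
      then show ?case using u(1) by simp
    next
      case (Suc n)
      let ?v = "lbeta \<beta> + wval z (shiftw d n)"
      have "(negbeta_T \<beta> ^^ Suc n) (lbeta \<beta>) = negbeta_T \<beta> ?v"
        by (simp only: funpow.simps o_apply Suc)
      also have "\<dots> = - \<beta> * ?v - of_int (d n)" by (simp only: negbeta_T_def fl)
      also have "\<dots> = lbeta \<beta> + wval z (shiftw d (Suc n))" using step[of n] by linarith
      finally show ?case .
    qed
    show "d = negbeta_exp \<beta> (lbeta \<beta>)"
      by (rule ext) (simp only: negbeta_exp_def v fl)
  }
qed

text \<open>Tail values in \<open>[0, 1)\<close> differ by less than one, so the sign of a
  difference of values fixes the sign of the first difference of letters.\<close>

lemma in_unit_lyndon:
  assumes "bndw d" "0 < z" "z < 1" "in_unit z d"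
  shows "alt_lyndon d"
  unfolding alt_lyndon_def
proof
  fix n
  show "altle d (shiftw d n)"
  proof (cases "d = shiftw d n")
    case False
    then obtain j where j: "\<And>i. i < j \<Longrightarrow> d i = shiftw d n i" "d j \<noteq> shiftw d n j"
      using first_difference by blast
    let ?y = "shiftw d n"
    let ?X = "wval z (shiftw d (Suc j))" and ?Y = "wval z (shiftw ?y (Suc j))"
    have u: "0 \<le> ?X" "?X < 1" "0 \<le> ?Y" "?Y < 1" using assms(4) by (auto simp: in_unit_def)
    have "wval z d - wval z ?y = (- z) ^ Suc j * ((of_int (d j) + ?X) - (of_int (?y j) + ?Y))"
      using wval_diff[of d ?y z j] assms j by simp
    moreover have "wval z d - wval z ?y \<le> 0" using assms(4) by (simp add: in_unit_def)
    ultimately have "z ^ Suc j * ((- 1) ^ Suc j * ((of_int (d j) + ?X) - (of_int (?y j) + ?Y))) \<le> 0"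
      by (subst (asm) power_minus) (simp add: mult_ac)
    then have s: "(- 1) ^ Suc j * ((of_int (d j) + ?X) - (of_int (?y j) + ?Y)) \<le> 0"
      using zero_less_power[OF assms(2), of "Suc j"] by (simp only: mult_le_0_iff) linarith
    have "altless d ?y"
    proof (rule altlessI[of j])
      show "even j \<Longrightarrow> ?y j < d j" using s u j(2) by simp
      show "odd j \<Longrightarrow> d j < ?y j" using s u j(2) by simp
    qed (use j in auto)
    then show ?thesis by (rule altless_imp_altle)
  qed (simp add: altle_def)
qed

text \<open>If \<open>ovl b\<close> were below \<open>d\<close>, it would be below the tail
  \<open>x\<close> as well, and the odd prefix \<open>b\<close> would reverse this to
  \<open>d\<close> below \<open>ovl b\<close>.\<close>

lemma lyndon_le_ovl_odd_prefix:
  assumes "alt_lyndon d" "odd (length b)" "d = appw b x"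
  shows "altle d (ovl b)"
proof (rule ccontr)
  have b: "b \<noteq> []" using assms(2) by auto
  assume "\<not> altle d (ovl b)"
  then have less: "altless (ovl b) d" by (simp add: not_altle)
  have "x = shiftw d (length b)" unfolding assms(3) by (rule shiftw_appw_length[symmetric])
  then have "altless (ovl b) x" using less alt_lyndonD[OF assms(1)] altless_le_trans by blast
  then have "altless (appw b x) (appw b (ovl b))" using assms(2) by (simp add: altless_appw)
  then have "altless d (ovl b)" using assms(3) appw_ovl[OF b] by metis
  then show False using less altless_trans altless_irrefl by blast
qed

lemma min_word_le_ovl_odd:
  assumes "odd (length b)"
  shows "altle (min_word b) (ovl b)"
proof -
  have b: "b \<noteq> []" using assms by auto
  have M: "max_word b = appw (low b) (max_word b)" using max_word_fixed[OF b] assms by simp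
  have "altless (appw b (ovl b)) (appw (low b) (max_word b))"
    unfolding appw_low by (rule altless_dec_last(2)[OF b assms])
  then have "altless (ovl b) (max_word b)" using M appw_ovl[OF b] by simp
  then have "altle (appw b (max_word b)) (appw b (ovl b))"
    using assms by (simp add: altle_appw altless_imp_altle)
  then show ?thesis using assms appw_ovl[OF b] by (simp add: min_word_max_word)
qed

text \<open>A letter 0 followed by a tail of value 0 would have the excluded value 1.\<close>

lemma in_unit_after_zero:
  assumes "bndw d" "0 < z" "z < 1" "in_unit z d" "d n = 0"
  shows "0 < wval z (shiftw d (Suc n))"
proof -
  have "wval z (shiftw d n) = 1 - z * wval z (shiftw d (Suc n))"
    using wval_rec[of "shiftw d n" z] assms by simp
  moreover have "wval z (shiftw d n) < 1" using assms(4) by (simp add: in_unit_def)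
  ultimately show ?thesis using assms(2) by (simp add: zero_less_mult_iff)
qed

text \<open>Tails of \<open>d\<close> below \<open>max_word a\<close> start with \<open>a\<close> or
  \<open>low a\<close>, so their values arise from those of later tails by maps with the common
  constant part \<open>g\<close>. If \<open>g \<le> 0\<close>, the range of the values leaves only
  one block to repeat. If \<open>g > 0\<close>, the entropy of \<open>ovl a\<close> bounds
  \<open>z\<close> so strongly that the value 0 is out of reach.\<close>

lemma in_unit_not_Lyn:
  assumes d: "nonneg_lyndon d" and z: "0 < z" "z < 1" and unit: "in_unit z d"
  shows "d \<notin> Lyn"
proof
  assume "d \<in> Lyn"
  then obtain a where a: "minimal_period a" "alt_lyndon (ovl a)" "d \<noteq> ovl a"
    "altle (min_word a) d" "altle d (max_word a)" "altless (max_word a) phi_inf"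
    unfolding Lyn_def by blast
  have an: "a \<noteq> []" using a(1) by (auto simp: minimal_period_def)
  let ?M = "max_word a" and ?k = "length a"
  have k: "0 < ?k" using an by simp
  have nn: "0 \<le> d i" for i using d by (simp add: nonneg_lyndon_def)
  have lyn: "altle d (shiftw d n)" for n using d by (simp add: nonneg_lyndon_def alt_lyndon_def)
  have bd: "bndw d" using bndw_alt_system[OF nonneg_lyndon_mem[OF d]] .
  have unit0: "wval z d = 0" and unitn: "0 \<le> wval z (shiftw d n)" "wval z (shiftw d n) < 1" for n
    using unit by (auto simp: in_unit_def)
  define T where "T = {x. (\<exists>n. x = shiftw d n) \<and> altle x ?M}"
  have dT: "d \<in> T" using a(5) unfolding T_def by (auto intro!: exI[of _ 0])
  define g where "g = aff z a 0"
  have step: "\<exists>x'\<in>T. (x = appw a x' \<and> wval z x = g + (- z) ^ ?k * wval z x') \<or>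
      (x = appw (low a) x' \<and> wval z x = g + (- z) ^ Suc ?k * wval z x' \<and> 0 < wval z x')"
    if xT: "x \<in> T" for x
  proof -
    obtain n where n: "x = shiftw d n" "altle x ?M" using xT unfolding T_def by blast
    have xnn: "0 \<le> x i" for i using n nn by simp
    have xmin: "altle (min_word a) x" using a(4) lyn[of n] n altle_trans by blast
    obtain x' where x': "altle x' ?M" "x = appw a x' \<or> x = appw (low a) x'"
      using between_min_max_parse[OF an xnn xmin n(2)] by blast
    show ?thesis
    proof (cases "x = appw a x'")
      case True
      then have "x' = shiftw d (n + ?k)" using n shiftw_appw_length by (metis shiftw_shiftw)
      then have T: "x' \<in> T" using x' by (auto simp: T_def)
      moreover have "wval z x = g + (- z) ^ ?k * wval z x'"
        using wval_appw[of x' z a] aff_affine[of z a "wval z x'"] z bd True \<open>x' = shiftw d (n + ?k)\<close>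
        by (simp add: g_def)
      ultimately show ?thesis using True by blast
    next
      case False
      then have xl: "x = appw (low a) x'" using x' by blast
      then have e: "x' = shiftw d (n + Suc ?k)"
        using n shiftw_appw_length[of "low a" x'] an by (metis shiftw_shiftw length_low)
      then have T: "x' \<in> T" using x' by (auto simp: T_def)
      have "wval z x = aff z a (- z * wval z x')"
        using wval_appw[of x' z "low a"] aff_low[OF an] z bd e xl by simp
      then have v: "wval z x = g + (- z) ^ Suc ?k * wval z x'"
        using aff_affine[of z a "- z * wval z x'"] by (simp add: g_def)
      have "d (n + ?k) = x ?k" using n by (simp add: add.commute)
      also have "\<dots> = 0" unfolding xl using an by (simp add: low_def appw_nth nth_append)
      finally have "0 < wval z (shiftw d (Suc (n + ?k)))"
        by (rule in_unit_after_zero[OF bd z unit])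
      then have "0 < wval z x'" using e by simp
      then show ?thesis using T xl v by blast
    qed
  qed
  have wT: "0 \<le> wval z x" "wval z x < 1" if "x \<in> T" for x using that unitn by (auto simp: T_def)
  have "g \<noteq> 0"
  proof
    assume g0: "g = 0"
    have "d = ovl a"
    proof (rule eq_ovl_coinduct[OF an, of _ "{x \<in> T. wval z x = 0}"])
      show "d \<in> {x \<in> T. wval z x = 0}" using dT unit0 by simp
      fix x assume x: "x \<in> {x \<in> T. wval z x = 0}"
      obtain x' where x': "x' \<in> T" "(x = appw a x' \<and> wval z x = g + (- z) ^ ?k * wval z x') \<or>
        (x = appw (low a) x' \<and> wval z x = g + (- z) ^ Suc ?k * wval z x' \<and> 0 < wval z x')"
        using step x by blast
      show "\<exists>x'\<in>{x \<in> T. wval z x = 0}. x = appw a x'"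
        using x x' g0 z by (intro bexI[of _ x']) auto
    qed
    then show False using a(3) by simp
  qed
  moreover have "\<not> g < 0"
  proof
    assume g: "g < 0"
    show False
    proof (cases "even ?k")
      case True
      have "d = ovl a"
      proof (rule eq_ovl_coinduct[OF an dT])
        fix x assume x: "x \<in> T"
        obtain x' where x': "x' \<in> T" "(x = appw a x' \<and> wval z x = g + (- z) ^ ?k * wval z x') \<or>
          (x = appw (low a) x' \<and> wval z x = g + (- z) ^ Suc ?k * wval z x' \<and> 0 < wval z x')"
          using step[OF x] by blast
        have "0 \<le> z ^ Suc ?k * wval z x'" using z wT[OF x'(1)] by simp
        then have "g + (- z) ^ Suc ?k * wval z x' < 0" using g True by simp
        then show "\<exists>x'\<in>T. x = appw a x'" using x' wT(1)[OF x] by fastforce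
      qed
      then show False using a(3) by simp
    next
      case False
      have st: "\<exists>x'\<in>T. x = appw (low a) x' \<and> 0 < wval z x'" if x: "x \<in> T" for x
      proof -
        obtain x' where x': "x' \<in> T" "(x = appw a x' \<and> wval z x = g + (- z) ^ ?k * wval z x') \<or>
          (x = appw (low a) x' \<and> wval z x = g + (- z) ^ Suc ?k * wval z x' \<and> 0 < wval z x')"
          using step[OF x] by blast
        have "0 \<le> z ^ ?k * wval z x'" using z wT[OF x'(1)] by simp
        then have "g + (- z) ^ ?k * wval z x' < 0" using g False by simp
        then show ?thesis using x' wT(1)[OF x] by fastforce
      qed
      have all: "x = ovl (low a)" if "x \<in> T" for x
        by (rule eq_ovl_coinduct[OF low_nonempty that]) (use st in blast)
      obtain x' where "x' \<in> T" "0 < wval z x'" using st[OF dT] by blast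
      then show False using all[of x'] all[OF dT] unit0 by simp
    qed
  qed
  ultimately have g: "0 < g" by simp
  \<comment> \<open>The contraction factors of the blocks of even (\<open>W\<close>) and odd
    (\<open>V\<close>) length; the former acts on the tail value with the sign plus, the latter with
    minus.\<close>
  define W where "W = (if even ?k then z ^ ?k else z ^ Suc ?k)"
  define V where "V = (if even ?k then z ^ Suc ?k else z ^ ?k)"
  have step': "\<exists>x'\<in>T. (wval z x = g + W * wval z x') \<or> (wval z x = g - V * wval z x')"
    if "x \<in> T" for x
    using step[OF that] unfolding W_def V_def by (cases "even ?k") fastforce+
  have pk: "z ^ ?k < 1" "z ^ Suc ?k < 1"
    using z k power_strict_decreasing[of 0 "?k" z] power_strict_decreasing[of 0 "Suc ?k" z] by auto
  have W: "0 < W" "W < 1" "0 < V" using z pk by (auto simp: W_def V_def)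
  \<comment> \<open>The letters of \<open>a\<close> are those of \<open>d\<close> except for the
    last, which is at least the letter of \<open>d\<close> there.\<close>
  have ann: "0 \<le> ovl a i" for i
  proof -
    have "\<exists>y'. (\<forall>i. i < ?k - 1 \<longrightarrow> d i = a ! i) \<and> d (?k - 1) \<le> last a"
      using between_min_max_parse[OF an nn a(4,5)] by blast
    then have e: "\<And>i. i < ?k - 1 \<Longrightarrow> d i = a ! i" "d (?k - 1) \<le> last a" by auto
    have "0 \<le> a ! i" if "i < ?k" for i
    proof (cases "i < ?k - 1")
      case True
      then show ?thesis using e(1)[of i] nn[of i] by simp
    next
      case False
      then have "i = ?k - 1" using that by simp
      then show ?thesis using e(2) nn[of "?k - 1"] an by (simp add: last_conv_nth)
    qed
    then show ?thesis using k by (simp add: ovl_def)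
  qed
  have la: "nonneg_lyndon (ovl a)" using a(2) ann by (simp add: nonneg_lyndon_def)
  have below: "altless (ovl a) phi_inf"
  proof (cases "even ?k")
    case True
    then show ?thesis using a(6) by (simp add: max_word_def)
  next
    case False
    have "altless (appw a (ovl a)) (appw (low a) ?M)"
      unfolding appw_low by (rule altless_dec_last(2)[OF an False])
    then have "altless (ovl a) ?M" using appw_ovl[OF an] max_word_fixed[OF an] False by simp
    then show ?thesis using a(6) altless_trans by blast
  qed
  obtain \<beta>a where ba: "attached (ovl a) \<beta>a" using attached_exists[OF la] by blast
  have ba1: "1 < \<beta>a" and sumR: "(1 / \<beta>a) ^ ?k + (1 / \<beta>a) ^ Suc ?k \<le> 1"
    using below_phi_inf[OF la ba below] k shiftw_ovl by auto
  have da: "altle d (ovl a)"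
  proof (cases "even ?k")
    case True
    then show ?thesis using a(5) by (simp add: max_word_def)
  next
    case False
    \<comment> \<open>For odd length the block \<open>low a\<close> would give \<open>d\<close> a
      positive value, so \<open>d\<close> starts with the odd block \<open>a\<close>.\<close>
    obtain x' where x': "x' \<in> T" "(d = appw a x' \<and> wval z d = g + (- z) ^ ?k * wval z x') \<or>
      (d = appw (low a) x' \<and> wval z d = g + (- z) ^ Suc ?k * wval z x' \<and> 0 < wval z x')"
      using step[OF dT] by blast
    have "0 \<le> z ^ Suc ?k * wval z x'" using z wT[OF x'(1)] by simp
    then have "0 < g + (- z) ^ Suc ?k * wval z x'" using g False by simp
    then have "d = appw a x'" using x'(2) unit0 by fastforce
    then show ?thesis using lyndon_le_ovl_odd_prefix[OF _ False] d by (simp add: nonneg_lyndon_def)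
  qed
  have sub: "ovl a \<in> alt_system d" "alt_system (ovl a) \<subseteq> alt_system d"
    using alt_system_mono[OF a(2) da ann] by auto
  have ge0: "0 \<le> wval z x" if "x \<in> alt_system d" for x
    by (rule wval_contraction[OF d z _ _ that]) (use unitn less_imp_le in auto)
  have le1: "wval z x \<le> 1" if "x \<in> alt_system d" for x
    using wval_le_one[OF that z ge0[OF alt_system_shift[OF that]]] .
  define \<delta> where "\<delta> = wval z (ovl a)"
  have \<delta>: "0 < \<delta>"
    unfolding \<delta>_def using wval_ovl[OF an z] g neg_power_less_one[OF z k] by (simp add: g_def)
  have "\<delta> \<le> wval z x" if x: "x \<in> alt_system (ovl a)" for x
    unfolding \<delta>_def
  proof (rule wval_mono[OF z])
    have xd: "x \<in> alt_system d" using x sub by blast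
    show "bndw (ovl a)" "bndw x" using bndw_alt_system sub(1) xd by blast+
    show "0 \<le> wval z (shiftw (ovl a) n)" "wval z (shiftw (ovl a) n) \<le> 1"
      "0 \<le> wval z (shiftw x n)" "wval z (shiftw x n) \<le> 1" for n
      using ge0 le1 alt_system_shift sub(1) xd by blast+
    show "altle (ovl a) x" using alt_system_ge0[OF x] .
  qed
  then have "\<beta>a \<le> 1 / z" using radius_ge_if_gap[OF la ba z \<delta>] by blast
  then have "z \<le> 1 / \<beta>a" using z ba1 by (simp add: field_simps)
  moreover have "z \<noteq> 1 / \<beta>a" using wval_at_radius(1)[OF la ba ba1] \<delta> unfolding \<delta>_def by auto
  ultimately have zR: "z < 1 / \<beta>a" by simp
  have "z ^ ?k < (1 / \<beta>a) ^ ?k" "z ^ Suc ?k < (1 / \<beta>a) ^ Suc ?k"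
    using zR z k by (intro power_strict_mono; simp)+
  then have WV: "W + V < 1" using sumR by (auto simp: W_def V_def)
  \<comment> \<open>The fixed point of the map with factor \<open>W\<close> bounds the values on
    \<open>T\<close>, so a block of odd length still leaves at least
    \<open>g - V * c = c * (1 - W - V)\<close>.\<close>
  define c where "c = g / (1 - W)"
  have c: "g + W * c = c" "g \<le> c" "0 < c"
  proof -
    have cW: "c * (1 - W) = g" using W by (simp add: c_def)
    then show "g + W * c = c" by (simp add: algebra_simps)
    show c0: "0 < c" using g W by (simp add: c_def)
    have "0 < W * c" using W c0 by simp
    then show "g \<le> c" using \<open>g + W * c = c\<close> by linarith
  qed
  have bound: "wval z x \<le> c + W ^ j" if "x \<in> T" for x j
    using that
  proof (induction j arbitrary: x)
    case 0
    then show ?case using wT(2)[of x] c by simp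
  next
    case (Suc j)
    obtain x' where x': "x' \<in> T" "(wval z x = g + W * wval z x') \<or> (wval z x = g - V * wval z x')"
      using step'[OF Suc.prems] by blast
    have "W * wval z x' \<le> W * (c + W ^ j)" using Suc.IH[OF x'(1)] W by (intro mult_left_mono) auto
    then have "g + W * wval z x' \<le> c + W ^ Suc j" using c by (simp add: algebra_simps)
    moreover have "0 \<le> V * wval z x'" using W wT(1)[OF x'(1)] by simp
    then have "g - V * wval z x' \<le> c + W ^ Suc j" using c W by (smt (verit) zero_le_power)
    ultimately show ?case using x'(2) by auto
  qed
  have le_c: "wval z x \<le> c" if "x \<in> T" for x
  proof -
    have "(\<lambda>j. c + W ^ j) \<longlonglongrightarrow> c + 0" using W by (intro tendsto_intros LIMSEQ_power_zero) auto
    then show ?thesis using bound[OF that] by (intro LIMSEQ_le_const) auto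
  qed
  obtain x' where x': "x' \<in> T" "(wval z d = g + W * wval z x') \<or> (wval z d = g - V * wval z x')"
    using step'[OF dT] by blast
  have "0 < g + W * wval z x'"
  proof -
    have "0 \<le> W * wval z x'" using W wT(1)[OF x'(1)] by simp
    then show ?thesis using g by simp
  qed
  moreover have "0 < g - V * wval z x'"
  proof -
    have "V * wval z x' \<le> V * c" using W le_c[OF x'(1)] by simp
    moreover have "g = c * (1 - W)" using c(1) by (simp add: algebra_simps)
    moreover have "0 < c * (1 - W - V)" using c(3) WV by simp
    ultimately show ?thesis by (simp add: algebra_simps)
  qed
  ultimately show False using x'(2) unit0 by auto
qed

section \<open>Odd periods and the upper bound by \<open>dstar\<close>\<close>

lemma sum_shift_periodic:
  fixes f :: "nat \<Rightarrow> int"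
  assumes "\<And>i. f (i + k) = f i"
  shows "(\<Sum>i<k. f (i + m)) = (\<Sum>i<k. f i)"
proof (induction m)
  case (Suc m)
  have "(\<Sum>i<Suc k. f (i + m)) = f m + (\<Sum>i<k. f (Suc i + m))"
    by (subst sum.lessThan_Suc_shift) simp
  moreover have "(\<Sum>i<Suc k. f (i + m)) = (\<Sum>i<k. f (i + m)) + f m"
    using assms[of m] by (simp add: add.commute)
  ultimately show ?case using Suc by simp
qed simp

text \<open>The tail at \<open>m\<close> has value 0 too. If it starts with \<open>a\<close>, then
  \<open>m\<close> is a period. If it starts with \<open>low a\<close>, its first
  \<open>length a\<close> letters sum to one less than those of \<open>d\<close>, although the sum
  over a period does not depend on the starting point.\<close>

lemma (in block_pair) prefix_period_eq:
  assumes da: "d = ovl a" and m: "0 < m" and v: "wval R (ovl (pref d m)) = 0"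
  shows "ovl (pref d m) = d"
proof -
  let ?b = "pref d m" and ?k = "length a"
  have b: "?b \<noteq> []" using m by (metis length_pref less_irrefl list.size(3))
  have "aff R ?b 0 = 0" using wval_ovl_fixed[OF b, of R] v R by simp
  moreover have "0 = aff R ?b (wval R (shiftw d m))"
    using wval_split[of d R m] E_bndw[OF d(2)] E_wval[OF d(2)] R by simp
  ultimately have "(- R) ^ m * wval R (shiftw d m) = 0"
    using aff_affine[of R ?b "wval R (shiftw d m)"] by simp
  then have "wval R (shiftw d m) = 0" using R by simp
  then have E: "shiftw d m \<in> E" using alt_system_shift[OF E_system[OF d(2)]] by (simp add: E_def)
  have per: "d (i + ?k) = d i" for i
    using shiftw_ovl[of a] unfolding da[symmetric] by (metis shiftw_apply)
  obtain x' where x': "shiftw d m = appw a x' \<or> shiftw d m = appw (low a) x'"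
    using E_blocks[OF E] by blast
  show ?thesis
  proof (cases "shiftw d m = appw a x'")
    case True
    have "shiftw (shiftw d m) ?k = shiftw d m"
      by (rule ext) (metis per shiftw_apply add.commute add.left_commute)
    then have "x' = shiftw d m" using True shiftw_appw_length by metis
    with True have "shiftw d m = appw a (shiftw d m)" by (rule subst[OF _ _, rotated])
    then have "shiftw d m = ovl a" by (intro eq_ovlI) auto
    then have "shiftw d m = d" using da by (rule trans[OF _ sym])
    from shift_period_ovl[OF this m] show ?thesis by (rule sym)
  next
    case False
    then have "shiftw d m = appw (low a) x'" using x' by blast
    then have sh: "shiftw d m i = appw (low a) x' i" for i by simp
    have s: "d (i + m) = (low a) ! i" if "i \<le> length w" for i
      using sh[of i] that by (simp add: appw_nth)
    have "(\<Sum>i<?k. d (i + m)) = (\<Sum>i<length w. w ! i) + (c - 1)"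
      using s by (simp add: low_snoc nth_append)
    moreover have "(\<Sum>i<?k. d i) = (\<Sum>i<length w. w ! i) + c"
      unfolding da by (simp add: ovl_a_nth)
    ultimately show ?thesis using sum_shift_periodic[of d ?k m] per by simp
  qed
qed

text \<open>The periodic word of the prefix lies in the system of \<open>d\<close> and has the same
  value. If it differed from \<open>d\<close>, then \<open>d\<close> would be \<open>ovl\<close> of
  the block and \<open>prefix_period_eq\<close> would apply. So under these hypotheses the modified
  case of \<open>dstar\<close> concerns only words that themselves have an odd period.\<close>

lemma odd_prefix_same_entropy:
  assumes d: "nonneg_lyndon d" "attached d \<beta>" "1 < \<beta>" "d \<notin> Lyn"
    and m: "odd m" "alt_lyndon (ovl (pref d m))" "attached (ovl (pref d m)) \<beta>"
  shows "ovl (pref d m) = d"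
proof (rule ccontr)
  let ?b = "pref d m"
  assume ne: "ovl ?b \<noteq> d"
  have m0: "0 < m" using m(1) by (rule odd_pos)
  then have b: "?b \<noteq> []" by (metis length_pref less_irrefl list.size(3))
  have nn: "0 \<le> ovl ?b i" for i
  proof -
    have "ovl ?b i \<in> set ?b" by (rule ovl_in_set[OF b])
    then show ?thesis using d(1) by (auto simp: pref_def nonneg_lyndon_def)
  qed
  have lb: "nonneg_lyndon (ovl ?b)" using m(2) nn by (simp add: nonneg_lyndon_def)
  have "altle d (ovl ?b)"
    by (rule lyndon_le_ovl_odd_prefix[of _ _ "shiftw d m"]) (use d(1) m(1) in \<open>auto simp: nonneg_lyndon_def\<close>)
  then have mem: "ovl ?b \<in> alt_system d" using alt_system_mono(1)[OF m(2) _ nn] by blast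
  have v: "wval (1 / \<beta>) (ovl ?b) = 0" using wval_at_radius(1)[OF lb m(3) d(3)] .
  obtain w c hi lo where bp: "block_pair d (1 / \<beta>) {x \<in> alt_system d. wval (1 / \<beta>) x = 0} w c hi lo"
    using block_pair_exists[OF d(1-3) mem ne v] by blast
  have "d = ovl (w @ [c])" using block_pair.odd_period_if_not_Lyn[OF bp d(4)] by blast
  then show False using block_pair.prefix_period_eq[OF bp _ m0 v] ne by blast
qed

lemma pref_odd_snoc: "pref d (2 * p + 1) = pref d (2 * p) @ [d (2 * p)]"
  by (simp add: pref_def)

lemma dstar_cases:
  obtains "dstar d \<beta> = d" "\<And>p. \<not> dstar_cond d \<beta> p"
  | p where "dstar_cond d \<beta> p" "\<And>q. dstar_cond d \<beta> q \<Longrightarrow> p \<le> q"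
    "dstar d \<beta> = ovl (low (pref d (2 * p + 1)))"
proof (cases "\<exists>p. dstar_cond d \<beta> p")
  case False
  then show ?thesis using that(1) by (simp add: dstar_def)
next
  case True
  define p where "p = (LEAST p. dstar_cond d \<beta> p)"
  have "dstar d \<beta> = ovl (low (pref d (2 * p + 1)))"
    using True unfolding dstar_def p_def[symmetric] pref_odd_snoc low_snoc by (simp add: Let_def)
  moreover have "dstar_cond d \<beta> p" unfolding p_def using True by (rule LeastI_ex)
  moreover have "p \<le> q" if "dstar_cond d \<beta> q" for q unfolding p_def using that by (rule Least_le)
  ultimately show ?thesis using that(2) by blast
qed

text \<open>The leading 0 makes the upper bound a restriction only on tails that start with
  0.\<close>

lemma not_altless_zero_word:
  assumes "\<And>i. 0 \<le> d i"
  shows "\<not> altless (shiftw d n) (\<lambda>i. if i = 0 then 0 else D (i - 1)) \<longleftrightarrow>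
    d n = 0 \<and> altle (shiftw d (Suc n)) D"
proof -
  let ?D = "\<lambda>i. if i = 0 then 0 else D (i - 1)"
  have "shiftw ?D 1 = D" by (rule ext) simp
  then have "altle ?D (shiftw d n) \<longleftrightarrow> d n < 0 \<or> 0 = d n \<and> altle (shiftw d (Suc n)) D"
    by (subst altle_Cons_decomp) simp
  then show ?thesis using assms[of n] by (auto simp: not_altless)
qed

text \<open>A violation gives a tail \<open>y\<close> behind a letter 0 that exceeds
  \<open>d\<close> but not \<open>dstar_of d\<close>. This forces the modified case, where
  \<open>d\<close> has an odd period \<open>b\<close>; then \<open>y\<close> can only be
  \<open>ovl (low b)\<close>, which has value 0, impossible behind a letter 0.\<close>

lemma in_unit_upper:
  assumes d: "nonneg_lyndon d" and z: "0 < z" "z < 1" and unit: "in_unit z d"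
  shows "altless (shiftw d n) (\<lambda>i. if i = 0 then 0 else dstar_of d (i - 1))"
proof (rule ccontr)
  assume neg: "\<not> ?thesis"
  have nn: "0 \<le> d i" for i using d by (simp add: nonneg_lyndon_def)
  have lyn: "altle d (shiftw d n)" for n using d by (simp add: nonneg_lyndon_def alt_lyndon_def)
  have bd: "bndw d" using bndw_alt_system[OF nonneg_lyndon_mem[OF d]] .
  have zero_next: "altless d (shiftw d (Suc i))" if "d i = 0" for i
  proof -
    have "0 < wval z (shiftw d (Suc i))" by (rule in_unit_after_zero[OF bd z unit that])
    moreover have "wval z d = 0" using unit by (simp add: in_unit_def)
    ultimately have "d \<noteq> shiftw d (Suc i)" by auto
    then show ?thesis using lyn[of "Suc i"] by (auto simp: altle_def)
  qed
  let ?y = "shiftw d (Suc n)"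
  have dn: "d n = 0" and yD: "altle ?y (dstar_of d)"
    using neg not_altless_zero_word[of d n, OF nn] by auto
  have dy: "altless d ?y" using zero_next[OF dn] .
  obtain \<beta> where b: "attached d \<beta>" using attached_exists[OF d] by blast
  have below: "altless d phi_inf"
    using altless_phi_inf_if_zero[OF d z] unit by (simp add: in_unit_def)
  have b1: "1 < \<beta>" using below_phi_inf(1)[OF d b below] .
  have D: "dstar_of d = dstar d \<beta>" by (simp add: dstar_of_def attached_the[OF b])
  have noL: "d \<notin> Lyn" using in_unit_not_Lyn[OF d z unit] .
  show False
  proof (cases rule: dstar_cases[of d \<beta>])
    case 1
    then show False using yD dy D not_altle by metis
  next
    case (2 p)
    let ?b = "pref d (2 * p + 1)"
    have odd: "odd (length ?b)" by simp
    then have bn: "?b \<noteq> []" by (metis even_zero list.size(3))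
    have db: "ovl ?b = d"
      by (rule odd_prefix_same_entropy[OF d b b1 noL]) (use 2(1) in \<open>auto simp: dstar_cond_def\<close>)
    let ?M = "max_word ?b"
    have M: "?M = ovl (low ?b)" using odd by (simp add: max_word_def low_def)
    have yM: "altle ?y ?M" using yD 2(3) D M by simp
    define T where "T = {x. (\<exists>i. x = shiftw d i) \<and> altless d x \<and> altle x ?M}"
    have "?y = ovl (low ?b)"
    proof (rule eq_ovl_coinduct[OF low_nonempty, of _ T])
      show "?y \<in> T" using dy yM unfolding T_def by blast
      fix x assume "x \<in> T"
      then obtain i where i: "x = shiftw d i" "altless d x" "altle x ?M" by (auto simp: T_def)
      have "altle (min_word ?b) x"
        using min_word_le_ovl_odd[OF odd] db i(2) altle_trans altless_imp_altle by metis
      moreover have "0 \<le> x l" for l using nn i(1) by simp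
      ultimately obtain x' where x': "altle x' ?M" "x = appw ?b x' \<or> x = appw (low ?b) x'"
        using between_min_max_parse[OF bn _ _ i(3)] by blast
      \<comment> \<open>The tail \<open>x'\<close> is at least \<open>d\<close>, so the odd block in
        front of it would put \<open>x\<close> at or below \<open>ovl ?b = d\<close>.\<close>
      have "x \<noteq> appw ?b x'"
      proof
        assume xb: "x = appw ?b x'"
        then have "x' = shiftw d (i + length ?b)" using i(1) shiftw_appw_length by (metis shiftw_shiftw)
        then have "altle d x'" using lyn by simp
        then have "altle (appw ?b x') (appw ?b d)" using odd by (simp only: altle_appw if_False)
        then have "altle x d" using xb appw_ovl[OF bn] db by simp
        then show False using i(2) not_altle by blast
      qed
      then have xl: "x = appw (low ?b) x'" using x' by blast
      then have e: "x' = shiftw d (i + Suc (length ?b))"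
        using i(1) shiftw_appw_length[of "low ?b" x'] bn by (metis shiftw_shiftw length_low)
      have "d (i + length ?b) = x (length ?b)" using i(1) by (simp add: add.commute)
      also have "\<dots> = 0" unfolding xl by (simp add: appw_nth pref_odd_snoc[simplified] low_snoc nth_append)
      finally have "altless d (shiftw d (Suc (i + length ?b)))" by (rule zero_next)
      then have "x' \<in> T" using x'(1) e unfolding T_def by auto
      then show "\<exists>x'\<in>T. x = appw (low ?b) x'" using xl by blast
    qed
    then have "wval z ?y = aff z (low ?b) (wval z ?y)"
      using wval_ovl_fixed[OF low_nonempty, of z ?b] z by simp
    also have "\<dots> = aff z ?b (- z * wval z ?y)" by (rule aff_low[OF bn])
    also have "\<dots> = aff z ?b 0 + (- z) ^ length ?b * (- z * wval z ?y)" by (rule aff_affine)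
    also have "aff z ?b 0 = 0"
      using wval_ovl_fixed[OF bn, of z] db unit z by (simp add: in_unit_def)
    finally have fixed: "wval z ?y = 0 + (- z) ^ length ?b * (- z * wval z ?y)" .
    have "e * (1 - (- z) ^ Suc l) = 0" if "e = 0 + (- z) ^ l * (- z * e)" for e l
      using that by (simp add: algebra_simps)
    from this[OF fixed] have "wval z ?y * (1 - (- z) ^ Suc (length ?b)) = 0" .
    moreover have "(- z) ^ Suc (length ?b) < 1" using z by (intro neg_power_less_one) auto
    ultimately have "wval z ?y = 0" by simp
    then show False using in_unit_after_zero[OF bd z unit dn] by simp
  qed
qed

text \<open>Only the value 1 has to be excluded. It would mean a letter 0 followed by a tail
  \<open>y\<close> of value 0, and \<open>y\<close> exceeds \<open>dstar\<close> by the upper bound.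
  This fails for \<open>y = d\<close>; for \<open>y \<noteq> d\<close>, \<open>dstar\<close> is
  \<open>max_word\<close> of the block, which bounds all words of value 0.\<close>

lemma in_unit_if_conditions:
  assumes d: "nonneg_lyndon d" and b: "attached d \<beta>" and noL: "d \<notin> Lyn"
    and below: "altless d phi_inf"
    and upper: "\<And>n. altless (shiftw d n) (\<lambda>i. if i = 0 then 0 else dstar_of d (i - 1))"
  shows "in_unit (1 / \<beta>) d"
proof -
  define R where "R = 1 / \<beta>"
  have b1: "1 < \<beta>" using below_phi_inf(1)[OF d b below] .
  have R: "0 < R" "R < 1" using b1 by (auto simp: R_def)
  have nn: "0 \<le> d i" for i using d by (simp add: nonneg_lyndon_def)
  have mem: "shiftw d n \<in> alt_system d" for n
    using alt_system_shift nonneg_lyndon_mem[OF d] by blast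
  have ge0: "0 \<le> wval R x" if "x \<in> alt_system d" for x
    using wval_at_radius(2)[OF d b b1 that] by (simp add: R_def)
  have le1: "wval R (shiftw d n) \<le> 1" for n
    using wval_le_one[OF mem R ge0[OF alt_system_shift[OF mem]]] .
  have D: "dstar_of d = dstar d \<beta>" by (simp add: dstar_of_def attached_the[OF b])
  have "wval R (shiftw d n) \<noteq> 1" for n
  proof
    assume one: "wval R (shiftw d n) = 1"
    let ?y = "shiftw d (Suc n)"
    have "R * (of_int (d n) + wval R ?y) = 0"
      using wval_rec[OF bndw_alt_system[OF mem], of R n] one R by simp
    then have "of_int (d n) + wval R ?y = 0" using R by simp
    moreover have "0 \<le> real_of_int (d n)" using nn by simp
    ultimately have dn: "d n = 0" and y0: "wval R ?y = 0" using ge0[OF mem[of "Suc n"]] by linarith+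
    have Dy: "altless (dstar d \<beta>) ?y"
    proof -
      have "\<not> (d n = 0 \<and> altle ?y (dstar_of d))"
        using upper[of n] not_altless_zero_word[of d n "dstar_of d", OF nn] by (simp only: not_not HOL.simp_thms)
      then have "\<not> altle ?y (dstar d \<beta>)" unfolding D using dn by simp
      then show ?thesis by (simp only: not_altle)
    qed
    show False
    proof (cases "?y = d")
      case True
      show False
      proof (cases rule: dstar_cases[of d \<beta>])
        case 1
        then show False using Dy True by simp
      next
        case (2 p)
        let ?b = "pref d (2 * p + 1)"
        have odd: "odd (length ?b)" by simp
        then have bn: "?b \<noteq> []" by (metis even_zero list.size(3))
        have "altless (appw ?b (shiftw d (2 * p + 1))) (appw (low ?b) (ovl (low ?b)))"
          unfolding appw_low by (rule altless_dec_last(2)[OF bn odd])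
        then have "altless d (dstar d \<beta>)" using 2(3) appw_ovl[OF low_nonempty] by simp
        then show False using Dy True altless_trans altless_irrefl by metis
      qed
    next
      case False
      obtain w c hi lo where bp: "block_pair d R {x \<in> alt_system d. wval R x = 0} w c hi lo"
        using block_pair_exists[OF d b b1 mem False] y0 unfolding R_def by blast
      let ?a = "w @ [c]"
      have da: "d = ovl ?a" and odd: "odd (length ?a)" using block_pair.odd_period_if_not_Lyn[OF bp noL] by auto
      obtain q where q: "length ?a = 2 * q + 1" using odd oddE by blast
      have pa: "pref d (length ?a) = ?a" unfolding da by (rule pref_ovl)
      have "dstar_cond d \<beta> q"
        unfolding dstar_cond_def q[symmetric] pa da[symmetric] using d b by (simp add: nonneg_lyndon_def)
      then show False
      proof (cases rule: dstar_cases[of d \<beta>])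
        case 1
        then show False using \<open>dstar_cond d \<beta> q\<close> by blast
      next
        case (2 p)
        let ?b = "pref d (2 * p + 1)"
        have db: "ovl ?b = d"
          by (rule odd_prefix_same_entropy[OF d b b1 noL]) (use 2(1) in \<open>auto simp: dstar_cond_def\<close>)
        have le: "2 * p + 1 \<le> length ?a" using 2(2)[OF \<open>dstar_cond d \<beta> q\<close>] q by simp
        \<comment> \<open>The prefix used by \<open>dstar\<close> gives a period of
          \<open>d\<close>, and the block has minimal period, so the two coincide.\<close>
        have "\<forall>i. ovl ?a (i + (2 * p + 1)) = ovl ?a i"
        proof -
          have "shiftw (ovl ?b) (length ?b) = ovl ?b" by (rule shiftw_ovl)
          then have "shiftw d (2 * p + 1) = d" unfolding db by simp
          then show ?thesis unfolding da[symmetric] by (metis shiftw_apply)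
        qed
        then have "\<not> 2 * p + 1 < length ?a"
          using block_pair.minimal_period_a[OF bp] unfolding minimal_period_def by auto
        then have len: "2 * p + 1 = length ?a" using le by simp
        have "dstar d \<beta> = max_word ?a"
          using 2(3) odd unfolding len pa by (simp add: max_word_def low_def)
        moreover have "altle ?y (max_word ?a)"
          by (rule block_pair.E_le_max[OF bp]) (use mem y0 in auto)
        ultimately show False using Dy not_altle by metis
      qed
    qed
  qed
  then have "wval R (shiftw d n) < 1" for n using le1[of n] by (simp add: less_le)
  then show ?thesis
    using wval_at_radius(1)[OF d b b1] ge0[OF mem] unfolding in_unit_def R_def by blast
qed

theorem theorem3:
  fixes A :: "int set" and d :: "nat \<Rightarrow> int"
  assumes "finite A" and "\<forall>a\<in>A. 0 \<le> a" and "range d \<subseteq> A"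
  shows "(\<exists>\<beta>::real. 1 < \<beta> \<and> d = negbeta_exp \<beta> (lbeta \<beta>)) \<longleftrightarrow>
         ((\<forall>n. altle d (shiftw d n) \<and>
               altless (shiftw d n) (\<lambda>i. if i = 0 then 0 else dstar_of d (i - 1)))
          \<and> d \<notin> Lyn
          \<and> altless d phi_inf)"
proof -
  have nn: "0 \<le> d i" for i using assms(2,3) by blast
  have "d i \<le> Max A" for i using assms(1,3) by (intro Max_ge) auto
  then have bd: "bndw d" using nn by (intro bndwI)
  show ?thesis
  proof
    assume "\<exists>\<beta>::real. 1 < \<beta> \<and> d = negbeta_exp \<beta> (lbeta \<beta>)"
    then obtain \<beta> :: real where b: "1 < \<beta>" "d = negbeta_exp \<beta> (lbeta \<beta>)" by blast
    have z: "0 < 1 / \<beta>" "1 / \<beta> < 1" using b(1) by auto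
    have unit: "in_unit (1 / \<beta>) d" using negbeta_exp_iff[OF bd b(1)] b(2) by blast
    have lyn: "nonneg_lyndon d"
      using in_unit_lyndon[OF bd z unit] nn by (simp add: nonneg_lyndon_def)
    have "altless d phi_inf"
      using altless_phi_inf_if_zero[OF lyn z] unit by (simp add: in_unit_def)
    then show "(\<forall>n. altle d (shiftw d n) \<and>
               altless (shiftw d n) (\<lambda>i. if i = 0 then 0 else dstar_of d (i - 1)))
          \<and> d \<notin> Lyn \<and> altless d phi_inf"
      using in_unit_upper[OF lyn z unit] in_unit_not_Lyn[OF lyn z unit] lyn
      unfolding nonneg_lyndon_def alt_lyndon_def by blast
  next
    assume c: "(\<forall>n. altle d (shiftw d n) \<and>
               altless (shiftw d n) (\<lambda>i. if i = 0 then 0 else dstar_of d (i - 1)))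
          \<and> d \<notin> Lyn \<and> altless d phi_inf"
    then have lyn: "nonneg_lyndon d" using nn by (simp add: nonneg_lyndon_def alt_lyndon_def)
    \<comment> \<open>The base is recovered as the growth rate of the system of
      \<open>d\<close>.\<close>
    obtain \<beta> where b: "attached d \<beta>" using attached_exists[OF lyn] by blast
    have b1: "1 < \<beta>" using below_phi_inf(1)[OF lyn b] c by blast
    have "in_unit (1 / \<beta>) d" using in_unit_if_conditions[OF lyn b] c by blast
    then have "d = negbeta_exp \<beta> (lbeta \<beta>)" using negbeta_exp_iff[OF bd b1] by blast
    then show "\<exists>\<beta>::real. 1 < \<beta> \<and> d = negbeta_exp \<beta> (lbeta \<beta>)" using b1 by blast
  qed
qed

end
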